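(* Let $\boldsymbol{\sigma}=(\sigma_n)_{n\in\mathbb N}$, $\sigma_n\colon A_{n+1}^+\to A_n^+$, be a primitive directive sequence, and let $\mathsf V$ be a pseudovariety of semigroups containing $\mathsf{LSl}$. The following statements are equivalent: (i) the profinite semigroup $\mathrm{Im}_{\mathsf V}(\boldsymbol{\sigma})$ is simple; (ii) the inclusion $\mathrm{Im}_{\mathsf V}(\boldsymbol{\sigma})\subseteq J_{\mathsf V}(\boldsymbol{\sigma})$ holds; (iii) all limit words of $\boldsymbol{\sigma}$ belong to $X(\boldsymbol{\sigma})$.
   Context: For a finite alphabet $A$, $A^+$ is the free semigroup on $A$, $|w|$ is the length of $w$, and $\mathrm{fac}(w)$ is the set of nonempty factors of $w$. A directive sequence is a sequence $\boldsymbol{\sigma}=(\sigma_n)_{n\in\mathbb N}$ of homomorphisms $\sigma_n\colon A_{n+1}^+\to A_n^+$, each $A_n$ a finite nonempty alphabet. Put $\sigma_{n,m}=\sigma_n\circ\cdots\circ\sigma_{m-1}$ for $n\le m$ (identity if $n=m$). Put $L(\boldsymbol{\sigma})=\bigcup_{n\ge 0}\bigcup_{a\in A_n}\mathrm{fac}(\sigma_{0,n}(a))$, and let $X(\boldsymbol{\sigma})$ be the set of $x\in A_0^{\mathbb Z}$ all of whose nonempty finite factors lie in $L(\boldsymbol{\sigma})$. A homomorphism $\varphi\colon A^+\to B^+$ is positive if for every $a\in A$ one has $|\varphi(a)|\ge 2$ and every letter of $B$ occurs in $\varphi(a)$; $\boldsymbol{\sigma}$ is primitive if for every $n$ there is $m>n$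 with $\sigma_{n,m}$ positive (then $X(\boldsymbol{\sigma})$ is a minimal shift space with language $L(\boldsymbol{\sigma})$). Homomorphisms act on biinfinite words by $\sigma(x)=\cdots\sigma(x[-1])\cdot\sigma(x[0])\sigma(x[1])\cdots$. A limit word of $\boldsymbol{\sigma}$ is an element of $\bigcap_{n\ge1}\sigma_{0,n}(A_n^{\mathbb Z})$. A pseudovariety of semigroups is a class of finite semigroups closed under subsemigroups, homomorphic images and finite direct products. $\mathsf{LSl}$ is the pseudovariety of finite semigroups $S$ such that $eSe$ is a semilattice (commutative with all elements idempotent) for every idempotent $e\in S$. $\overline{\Omega}_A\mathsf V$ is the free pro-$\mathsf V$ semigroup on $A$ (pro-$\mathsf V$: inverse limit of members of $\mathsf V$ with discrete topologies); for the $\mathsf V$ considered it contains $A^+$ as a dense subsemigroup, and each homomorphism $\varphi\colon A^+\to B^+$ extends uniquely to a continuous homomorphism $\varphi^{\mathsf V}\colon\overline{\Omega}_A\mathsf V\to\overline{\Omega}_B\mathsf V$. The set $\overline{L(\boldsymbol{\sigma})}\setminus L(\boldsymbol{\sigma})$ (closure in $\overline{\Omega}_{A_0}\mathsf V$) is contained in a single regular $\mathcal J$-class of $\overline{\Omega}_{A_0}\mathsf V$, denoted $J_{\mathsf V}(\boldsymbol{\sigma})$. The $\mathsf V$-image $\mathrm{Im}_{\mathsf V}(\boldsymbol{\sigma})=\bigcap_{n\in\mathbb N}\mathrm{Im}(\sigma_{0,n}^{\mathsf V})$ is a closed subsemigroup of $\overline{\Omega}_{A_0}\mathsf V$. A semigroup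 is simple if its Green relation $\mathcal J$ is universal. *)

theory Defs
  imports "HOL-Analysis.Analysis" "HOL-Algebra.Congruence" "HOL-Library.Sublist"
begin

section \<open>Semigroups\<close>

record 'a semigrp = "'a partial_object" +
  sgmult :: "'a \<Rightarrow> 'a \<Rightarrow> 'a"  (infixl \<open>\<odot>\<index>\<close> 70)

definition is_semigroup :: "('a, 'm) semigrp_scheme \<Rightarrow> bool" where
  "is_semigroup S \<longleftrightarrow> carrier S \<noteq> {} \<and>
     (\<forall>x\<in>carrier S. \<forall>y\<in>carrier S. x \<odot>\<^bsub>S\<^esub> y \<in> carrier S) \<and>
     (\<forall>x\<in>carrier S. \<forall>y\<in>carrier S. \<forall>z\<in>carrier S.
        (x \<odot>\<^bsub>S\<^esub> y) \<odot>\<^bsub>S\<^esub> z = x \<odot>\<^bsub>S\<^esub> (y \<odot>\<^bsub>S\<^esub> z))"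

definition is_finite_semigroup :: "('a, 'm) semigrp_scheme \<Rightarrow> bool" where
  "is_finite_semigroup S \<longleftrightarrow> is_semigroup S \<and> finite (carrier S)"

definition is_subsemigroup :: "'a set \<Rightarrow> ('a, 'm) semigrp_scheme \<Rightarrow> bool" where
  "is_subsemigroup H S \<longleftrightarrow> H \<noteq> {} \<and> H \<subseteq> carrier S \<and> (\<forall>x\<in>H. \<forall>y\<in>H. x \<odot>\<^bsub>S\<^esub> y \<in> H)"

definition sg_hom :: "('a, 'm) semigrp_scheme \<Rightarrow> ('b, 'n) semigrp_scheme \<Rightarrow> ('a \<Rightarrow> 'b) set" where
  "sg_hom S T = {f \<in> carrier S \<rightarrow> carrier T.
     \<forall>x\<in>carrier S. \<forall>y\<in>carrier S. f (x \<odot>\<^bsub>S\<^esub> y) = f x \<odot>\<^bsub>T\<^esub> f y}"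

definition sg_iso :: "('a, 'm) semigrp_scheme \<Rightarrow> ('b, 'n) semigrp_scheme \<Rightarrow> bool" where
  "sg_iso S T \<longleftrightarrow> (\<exists>f\<in>sg_hom S T. bij_betw f (carrier S) (carrier T))"

definition sg_prod :: "('a, 'm) semigrp_scheme \<Rightarrow> ('b, 'n) semigrp_scheme \<Rightarrow> ('a \<times> 'b) semigrp" where
  "sg_prod S T = \<lparr>carrier = carrier S \<times> carrier T,
     sgmult = (\<lambda>(s, t) (s', t'). (s \<odot>\<^bsub>S\<^esub> s', t \<odot>\<^bsub>T\<^esub> t'))\<rparr>"

definition idempotent :: "('a, 'm) semigrp_scheme \<Rightarrow> 'a \<Rightarrow> bool" where
  "idempotent S e \<longleftrightarrow> e \<in> carrier S \<and> e \<odot>\<^bsub>S\<^esub> e = e"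

text \<open>The ideal $S^1 x S^1$.\<close>

definition principal_ideal :: "('a, 'm) semigrp_scheme \<Rightarrow> 'a \<Rightarrow> 'a set" where
  "principal_ideal S x = {x} \<union> {s \<odot>\<^bsub>S\<^esub> x | s. s \<in> carrier S} \<union> {x \<odot>\<^bsub>S\<^esub> t | t. t \<in> carrier S} \<union>
     {s \<odot>\<^bsub>S\<^esub> x \<odot>\<^bsub>S\<^esub> t | s t. s \<in> carrier S \<and> t \<in> carrier S}"

definition green_J :: "('a, 'm) semigrp_scheme \<Rightarrow> ('a \<times> 'a) set" where
  "green_J S = {(x, y). x \<in> carrier S \<and> y \<in> carrier S \<and> principal_ideal S x = principal_ideal S y}"

definition is_simple :: "('a, 'm) semigrp_scheme \<Rightarrow> bool" where
  "is_simple S \<longleftrightarrow> green_J S = carrier S \<times> carrier S"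

definition regular_J_class :: "('a, 'm) semigrp_scheme \<Rightarrow> 'a set \<Rightarrow> bool" where
  "regular_J_class S J \<longleftrightarrow> J \<in> carrier S // green_J S \<and> (\<exists>e\<in>J. idempotent S e)"


section \<open>Pseudovarieties\<close>

text \<open>
  Every finite semigroup is isomorphic to one whose carrier is a set of natural numbers, so a class
  of finite semigroups closed under isomorphism is given by a set of finite semigroups with
  carrier in \<^typ>\<open>nat\<close>.  Such a set is closed under isomorphism because it is closed under
  homomorphic images.  The products of one or more factors are iterated binary products, up
  to isomorphism; the empty product is the one-element semigroup, a homomorphic image of any
  member, so closure under it amounts to nonemptiness.
\<close>

definition pseudovariety :: "nat semigrp set \<Rightarrow> bool" where
  "pseudovariety V \<longleftrightarrow> V \<noteq> {} \<and>
     (\<forall>S\<in>V. is_finite_semigroup S) \<and>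
     (\<forall>S\<in>V. \<forall>H. is_subsemigroup H S \<longrightarrow> S\<lparr>carrier := H\<rparr> \<in> V) \<and>
     (\<forall>S\<in>V. \<forall>T. \<forall>f\<in>sg_hom S T. is_finite_semigroup T \<and> f ` carrier S = carrier T \<longrightarrow> T \<in> V) \<and>
     (\<forall>S\<in>V. \<forall>T\<in>V. \<forall>U. is_finite_semigroup U \<and> sg_iso (sg_prod S T) U \<longrightarrow> U \<in> V)"

definition LSl :: "nat semigrp set" where
  "LSl = {S. is_finite_semigroup S \<and>
     (\<forall>e. idempotent S e \<longrightarrow>
       (let eSe = {e \<odot>\<^bsub>S\<^esub> s \<odot>\<^bsub>S\<^esub> e | s. s \<in> carrier S}
        in \<forall>x\<in>eSe. x \<odot>\<^bsub>S\<^esub> x = x \<and> (\<forall>y\<in>eSe. x \<odot>\<^bsub>S\<^esub> y = y \<odot>\<^bsub>S\<^esub> x)))}"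


section \<open>Words and directive sequences\<close>

definition free_sg :: "'a set \<Rightarrow> 'a list semigrp" where
  "free_sg A = \<lparr>carrier = lists A - {[]}, sgmult = (@)\<rparr>"

definition fac :: "'a list \<Rightarrow> 'a list set" where
  "fac w = {u. u \<noteq> [] \<and> sublist u w}"

text \<open>The alphabets are finite subsets of one common letter type.\<close>

definition directive_sequence :: "(nat \<Rightarrow> 'a set) \<Rightarrow> (nat \<Rightarrow> 'a list \<Rightarrow> 'a list) \<Rightarrow> bool" where
  "directive_sequence A \<sigma> \<longleftrightarrow>
     (\<forall>n. finite (A n) \<and> A n \<noteq> {} \<and> \<sigma> n \<in> sg_hom (free_sg (A (Suc n))) (free_sg (A n)))"

definition ds_comp :: "(nat \<Rightarrow> 'a list \<Rightarrow> 'a list) \<Rightarrow> nat \<Rightarrow> nat \<Rightarrow> 'a list \<Rightarrow> 'a list" where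
  "ds_comp \<sigma> n m = foldr (\<circ>) (map \<sigma> [n..<m]) id"

definition positive_hom :: "'a set \<Rightarrow> 'b set \<Rightarrow> ('a list \<Rightarrow> 'b list) \<Rightarrow> bool" where
  "positive_hom A B \<phi> \<longleftrightarrow> (\<forall>a\<in>A. length (\<phi> [a]) \<ge> 2 \<and> B \<subseteq> set (\<phi> [a]))"

definition primitive_ds :: "(nat \<Rightarrow> 'a set) \<Rightarrow> (nat \<Rightarrow> 'a list \<Rightarrow> 'a list) \<Rightarrow> bool" where
  "primitive_ds A \<sigma> \<longleftrightarrow> (\<forall>n. \<exists>m>n. positive_hom (A m) (A n) (ds_comp \<sigma> n m))"

definition language :: "(nat \<Rightarrow> 'a set) \<Rightarrow> (nat \<Rightarrow> 'a list \<Rightarrow> 'a list) \<Rightarrow> 'a list set" where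
  "language A \<sigma> = (\<Union>n. \<Union>a\<in>A n. fac (ds_comp \<sigma> 0 n [a]))"

definition biinfinite :: "'a set \<Rightarrow> (int \<Rightarrow> 'a) set" where
  "biinfinite A = {x. range x \<subseteq> A}"

definition shift_space :: "(nat \<Rightarrow> 'a set) \<Rightarrow> (nat \<Rightarrow> 'a list \<Rightarrow> 'a list) \<Rightarrow> (int \<Rightarrow> 'a) set" where
  "shift_space A \<sigma> = {x \<in> biinfinite (A 0). \<forall>i j. i \<le> j \<longrightarrow> map x [i..j] \<in> language A \<sigma>}"

text \<open>
  The word $\cdots\phi(x[-1])\cdot\phi(x[0])\phi(x[1])\cdots$.  Since $\phi$ is nonerasing, the letter at
  position $i \ge 0$ already occurs in the prefix $\phi(x[0]\cdots x[i])$ of the right half, and the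
  letter at position $i < 0$ is the one at distance $-i$ from the right end of the suffix
  $\phi(x[i]\cdots x[-1])$ of the left half.
\<close>

definition hom_biinf :: "('a list \<Rightarrow> 'b list) \<Rightarrow> (int \<Rightarrow> 'a) \<Rightarrow> int \<Rightarrow> 'b" where
  "hom_biinf \<phi> x i =
     (if 0 \<le> i then \<phi> (map x [0..i]) ! nat i
      else let w = \<phi> (map x [i..-1]) in w ! nat (int (length w) + i))"

definition limit_words :: "(nat \<Rightarrow> 'a set) \<Rightarrow> (nat \<Rightarrow> 'a list \<Rightarrow> 'a list) \<Rightarrow> (int \<Rightarrow> 'a) set" where
  "limit_words A \<sigma> = (\<Inter>n\<in>{1..}. hom_biinf (ds_comp \<sigma> 0 n) ` biinfinite (A n))"


section \<open>Free pro-V semigroups\<close>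

text \<open>
  The free pro-V semigroup on a finite alphabet is the inverse limit of the A-generated members of
  V, that is, of the surjective homomorphisms $\phi : A^+ \to S$ with $S$ in V.  An element is a
  family of values, one in each such $S$, respected by every homomorphism $S \to T$ that carries
  $\phi : A^+ \to S$ to $\psi : A^+ \to T$.  Isomorphic quotients, which occur repeatedly among the
  indices, are identified by this compatibility.
\<close>

type_synonym 'a quot = "nat semigrp \<times> ('a list \<Rightarrow> nat)"

definition quotients :: "nat semigrp set \<Rightarrow> 'a set \<Rightarrow> 'a quot set" where
  "quotients V A = {(S, \<phi>). S \<in> V \<and> \<phi> \<in> sg_hom (free_sg A) S \<and>
     \<phi> ` carrier (free_sg A) = carrier S}"

definition free_pro :: "nat semigrp set \<Rightarrow> 'a set \<Rightarrow> ('a quot \<Rightarrow> nat) semigrp" where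
  "free_pro V A = \<lparr>
     carrier = {x \<in> (\<Pi>\<^sub>E q\<in>quotients V A. carrier (fst q)).
       \<forall>(S, \<phi>)\<in>quotients V A. \<forall>(T, \<psi>)\<in>quotients V A. \<forall>h\<in>sg_hom S T.
         (\<forall>w\<in>carrier (free_sg A). h (\<phi> w) = \<psi> w) \<longrightarrow> h (x (S, \<phi>)) = x (T, \<psi>)},
     sgmult = (\<lambda>x y. \<lambda>q\<in>quotients V A. x q \<odot>\<^bsub>fst q\<^esub> y q)\<rparr>"

definition free_pro_top :: "nat semigrp set \<Rightarrow> 'a set \<Rightarrow> ('a quot \<Rightarrow> nat) topology" where
  "free_pro_top V A = subtopology
     (product_topology (\<lambda>q. discrete_topology (carrier (fst q))) (quotients V A))
     (carrier (free_pro V A))"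

text \<open>The canonical map from $A^+$, an embedding for the V considered here.\<close>

definition word_emb :: "nat semigrp set \<Rightarrow> 'a set \<Rightarrow> 'a list \<Rightarrow> 'a quot \<Rightarrow> nat" where
  "word_emb V A w = (\<lambda>(S, \<phi>)\<in>quotients V A. \<phi> w)"

text \<open>The unique continuous homomorphism extending $\phi : A^+ \to B^+$.\<close>

definition pro_ext ::
  "nat semigrp set \<Rightarrow> 'a set \<Rightarrow> 'b set \<Rightarrow> ('a list \<Rightarrow> 'b list) \<Rightarrow> ('a quot \<Rightarrow> nat) \<Rightarrow> 'b quot \<Rightarrow> nat" where
  "pro_ext V A B \<phi> = (THE f. f \<in> extensional (carrier (free_pro V A)) \<and>
     f \<in> sg_hom (free_pro V A) (free_pro V B) \<and>
     continuous_map (free_pro_top V A) (free_pro_top V B) f \<and>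
     (\<forall>w\<in>carrier (free_sg A). f (word_emb V A w) = word_emb V B (\<phi> w)))"

text \<open>
  The regular J-class of the free pro-V semigroup on the alphabet \<open>A 0\<close> that contains
  $\overline{L(\sigma)} \setminus L(\sigma)$.
\<close>

definition J_class ::
  "nat semigrp set \<Rightarrow> (nat \<Rightarrow> 'a set) \<Rightarrow> (nat \<Rightarrow> 'a list \<Rightarrow> 'a list) \<Rightarrow> ('a quot \<Rightarrow> nat) set" where
  "J_class V A \<sigma> = (let L = word_emb V (A 0) ` language A \<sigma> in
     THE J. regular_J_class (free_pro V (A 0)) J \<and> (free_pro_top V (A 0) closure_of L) - L \<subseteq> J)"

definition V_image ::
  "nat semigrp set \<Rightarrow> (nat \<Rightarrow> 'a set) \<Rightarrow> (nat \<Rightarrow> 'a list \<Rightarrow> 'a list) \<Rightarrow> ('a quot \<Rightarrow> nat) set" where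
  "V_image V A \<sigma> =
     (\<Inter>n. pro_ext V (A n) (A 0) (ds_comp \<sigma> 0 n) ` carrier (free_pro V (A n)))"

definition V_image_sg ::
  "nat semigrp set \<Rightarrow> (nat \<Rightarrow> 'a set) \<Rightarrow> (nat \<Rightarrow> 'a list \<Rightarrow> 'a list) \<Rightarrow> ('a quot \<Rightarrow> nat) semigrp" where
  "V_image_sg V A \<sigma> = (free_pro V (A 0))\<lparr>carrier := V_image V A \<sigma>\<rparr>"

end

theory Submission
  imports Defs
begin

text \<open>
  An element of the free pro-V semigroup is determined by its values in the finite quotients, each of
  which is the value of a word, and by compactness statements about such elements reduce to
  statements about words at a single finite quotient. There uniform recurrence makes all long words
  of the language lie in one J-class; the elements all of whose values lie in these J-classes
  form the class of the theorem.

  If the image lies in this class, then it is simple by stability of finite semigroups, and a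
  locally testable quotient shows that a word occurring in images under \<open>\<sigma>\<^sub>0\<^sub>,\<^sub>n\<close> for all \<open>n\<close>
  belongs to the language. Limit words have only such factors. Conversely, if limit words
  belong to the shift space, then for large \<open>n\<close> all short factors of images under \<open>\<sigma>\<^sub>0\<^sub>,\<^sub>n\<close> are in the
  language, and reading such an image letter by letter never leaves the R-class of a
  long word of the language.
\<close>

section \<open>Ultrafilters\<close>

text \<open>The inclusion in the J-class and the condition on limit words are never compared
  directly: each is proved equivalent to one finitary statement, that every
  \<open>persistent\<close> word belongs to the language. The obstacle in building a limit word from
  a persistent word is that its occurrences may drift away from the origin as the level grows. A
  persistent word outside the language lies in no image of a single letter, so at high levels it
  crosses exactly one boundary between two letter images; with the origin on that boundary the
  displacement is bounded by the length of the word.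

  For simplicity it is not enough to factor elements in the free pro-V semigroup: the factors must
  come from the image itself. Absorption is therefore arranged with powers of
  \<open>x @ y @ x\<close>, which stay values of products of the given elements.

  Ultrafilters supply the compactness. A limit over the directed set of quotients, or over the
  levels, is computed one finite value at a time, and finitely many such values are always realised
  by a common word.\<close>

definition ultra :: "'a filter \<Rightarrow> bool" where
  "ultra U \<longleftrightarrow> U \<noteq> bot \<and> (\<forall>P. eventually P U \<or> eventually (\<lambda>x. \<not> P x) U)"

text \<open>Finer filters are smaller, so Zorn's lemma runs on the reversed order and yields a
  minimal proper filter below \<open>F\<close>. If meeting it with the principal filter of
  \<open>P\<close> leaves it proper, minimality leaves it unchanged, and \<open>P\<close> holds
  eventually; otherwise the negation does.\<close>

lemma ultra_exists:
  assumes "F \<noteq> bot"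
  shows "\<exists>U\<le>F. ultra U"
proof -
  define \<G> where "\<G> = {G. G \<le> F \<and> G \<noteq> bot}"
  have "\<exists>M\<in>\<G>. \<forall>G\<in>\<G>. G \<le> M \<longrightarrow> G = M"
  proof (rule predicate_Zorn)
    show "partial_order_on \<G> (relation_of (\<lambda>G H. H \<le> G) \<G>)"
      by (rule partial_order_on_relation_ofI) auto
    fix C assume C: "C \<in> Chains (relation_of (\<lambda>G H. H \<le> G) \<G>)"
    then have sub: "C \<subseteq> \<G>" and total: "G \<le> H \<or> H \<le> G" if "G \<in> C" "H \<in> C" for G H
      using that unfolding Chains_def relation_of_def by auto
    show "\<exists>u\<in>\<G>. \<forall>a\<in>C. u \<le> a"
    proof (cases "C = {}")
      case True
      then show ?thesis using assms unfolding \<G>_def by auto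
    next
      case False
      then obtain G0 where "G0 \<in> C" by blast
      have C\<G>: "C \<subseteq> \<G>" using sub False by blast
      \<comment> \<open>An infimum of filters is proper once all finite infima are, and a nonempty
        finite part of a chain contains its own infimum.\<close>
      have "Inf C \<noteq> bot"
      proof (rule Inf_filter_not_bot)
        fix X assume "X \<subseteq> C" "finite X"
        have "X = {} \<or> (\<exists>G\<in>X. \<forall>H\<in>X. G \<le> H)" using \<open>finite X\<close> \<open>X \<subseteq> C\<close>
        proof (induction X rule: finite_induct)
          case (insert G X)
          show ?case
          proof (cases "X = {}")
            case False
            then obtain H where H: "H \<in> X" "\<forall>K\<in>X. H \<le> K" using insert by auto
            then show ?thesis using total[of G H] insert.prems
              by (auto intro: order_trans)
          qed simp
        qed simp
        then show "Inf X \<noteq> bot"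
        proof
          assume "\<exists>G\<in>X. \<forall>H\<in>X. G \<le> H"
          then obtain G where "G \<in> X" "\<forall>H\<in>X. G \<le> H" by blast
          then have "Inf X = G" by (intro antisym Inf_lower Inf_greatest) auto
          then show ?thesis using \<open>G \<in> X\<close> \<open>X \<subseteq> C\<close> C\<G> unfolding \<G>_def by auto
        next
          assume "X = {}"
          have "F \<le> top" by simp
          then show ?thesis using assms \<open>X = {}\<close> by (metis Inf_empty bot.extremum_unique)
        qed
      qed
      moreover have "Inf C \<le> F"
        using \<open>G0 \<in> C\<close> C\<G> unfolding \<G>_def by (auto intro: order_trans[OF Inf_lower])
      ultimately show ?thesis unfolding \<G>_def by (auto intro: Inf_lower)
    qed
  qed
  then obtain U where U: "U \<le> F" "U \<noteq> bot" and min: "\<And>G. G \<le> U \<Longrightarrow> G \<noteq> bot \<Longrightarrow> G = U"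
    unfolding \<G>_def by (auto intro: order_trans)
  have "eventually P U \<or> eventually (\<lambda>x. \<not> P x) U" for P
  proof (cases "inf U (principal {x. P x}) = bot")
    case True
    then have "eventually (\<lambda>x. P x \<longrightarrow> False) U"
      using eventually_inf_principal[of "\<lambda>_. False" U "{x. P x}"] by simp
    then show ?thesis by simp
  next
    case False
    then have "inf U (principal {x. P x}) = U" by (intro min) auto
    moreover have "eventually P (inf U (principal {x. P x}))"
      by (simp add: eventually_inf_principal)
    ultimately show ?thesis by simp
  qed
  then show ?thesis using U unfolding ultra_def by blast
qed

lemma ultra_disjE:
  assumes "ultra U" "eventually (\<lambda>x. P x \<or> Q x) U"
  shows "eventually P U \<or> eventually Q U"
proof (cases "eventually P U")
  case False
  then have "eventually (\<lambda>x. \<not> P x) U" using assms(1) unfolding ultra_def by blast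
  with assms(2) have "eventually Q U" by eventually_elim auto
  then show ?thesis ..
qed simp

lemma ultra_finite:
  assumes "ultra U" "finite C" "eventually (\<lambda>x. f x \<in> C) U"
  shows "\<exists>c\<in>C. eventually (\<lambda>x. f x = c) U"
  using assms(2,3)
proof (induction C rule: finite_induct)
  case empty
  then show ?case using assms(1) unfolding ultra_def by (simp add: eventually_False)
next
  case (insert c C)
  have "eventually (\<lambda>x. f x = c \<or> f x \<in> C) U" using insert.prems by simp
  from ultra_disjE[OF assms(1) this] insert.IH show ?case by blast
qed

lemma ultra_happens: "ultra U \<Longrightarrow> eventually P U \<Longrightarrow> \<exists>x. P x"
  unfolding ultra_def using eventually_happens' by blast

lemma free_ultra_nat: "\<exists>U::nat filter. ultra U \<and> U \<le> sequentially"
  using ultra_exists[of "sequentially :: nat filter"] by auto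


section \<open>Finite quotients of the semigroup of words\<close>

definition words :: "'a set \<Rightarrow> 'a list set" where
  "words A = lists A - {[]}"

lemma words_iff: "w \<in> words A \<longleftrightarrow> w \<noteq> [] \<and> w \<in> lists A"
  by (auto simp: words_def)

lemma words_lists: "w \<in> words A \<Longrightarrow> w \<in> lists A"
  and words_neq [simp]: "[] \<notin> words A"
  and words_append: "u \<in> words A \<Longrightarrow> v \<in> words A \<Longrightarrow> u @ v \<in> words A"
  and words_append_right: "u \<in> words A \<Longrightarrow> t \<in> lists A \<Longrightarrow> u @ t \<in> words A"
  and words_append_left: "u \<in> words A \<Longrightarrow> t \<in> lists A \<Longrightarrow> t @ u \<in> words A"
  and words_single: "[a] \<in> words A \<longleftrightarrow> a \<in> A"
  by (auto simp: words_iff)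

lemma carrier_free_sg [simp]: "carrier (free_sg A) = words A"
  by (simp add: free_sg_def words_def)

lemma mult_free_sg [simp]: "u \<odot>\<^bsub>free_sg A\<^esub> v = u @ v"
  by (simp add: free_sg_def)

definition wpow :: "nat \<Rightarrow> 'a list \<Rightarrow> 'a list" where
  "wpow n u = concat (replicate n u)"

lemma wpow_0 [simp]: "wpow 0 u = []"
  and wpow_Suc [simp]: "wpow (Suc n) u = u @ wpow n u"
  by (simp_all add: wpow_def)

lemma wpow_add: "wpow (m + n) u = wpow m u @ wpow n u"
  by (simp add: wpow_def replicate_add)

lemma wpow_lists: "u \<in> lists A \<Longrightarrow> wpow n u \<in> lists A"
  by (induction n) auto

lemma wpow_words: "u \<in> words A \<Longrightarrow> n > 0 \<Longrightarrow> wpow n u \<in> words A"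
  using wpow_lists[of u A n] by (cases n) (auto simp: words_iff)

text \<open>The kernel of \<open>\<phi>\<close> is a congruence of finite index. Asking for no
  product on the values lets tuples of combinatorial data about a word be treated like elements of a
  member of V.\<close>

locale fin_quot =
  fixes A :: "'a set" and \<phi> :: "'a list \<Rightarrow> 'c"
  assumes fin: "finite (\<phi> ` words A)"
    and cong: "\<lbrakk>u \<in> words A; u' \<in> words A; v \<in> words A; v' \<in> words A; \<phi> u = \<phi> u'; \<phi> v = \<phi> v'\<rbrakk>
                 \<Longrightarrow> \<phi> (u @ v) = \<phi> (u' @ v')"
begin

lemma cong_right: "\<lbrakk>u \<in> words A; u' \<in> words A; t \<in> lists A; \<phi> u = \<phi> u'\<rbrakk> \<Longrightarrow> \<phi> (u @ t) = \<phi> (u' @ t)"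
  using cong[of u u' t t] by (cases "t = []") (auto simp: words_iff)

lemma cong_left: "\<lbrakk>u \<in> words A; u' \<in> words A; t \<in> lists A; \<phi> u = \<phi> u'\<rbrakk> \<Longrightarrow> \<phi> (t @ u) = \<phi> (t @ u')"
  using cong[of t t u u'] by (cases "t = []") (auto simp: words_iff)

lemma cong_ctxt:
  assumes "u \<in> words A" "u' \<in> words A" "r \<in> lists A" "t \<in> lists A" "\<phi> u = \<phi> u'"
  shows "\<phi> (r @ u @ t) = \<phi> (r @ u' @ t)"
  using cong_left[of "u @ t" "u' @ t" r] cong_right[of u u' t] assms by (auto simp: words_iff)

section \<open>Periodicity of powers and stability\<close>

lemma pow_periodic:
  assumes u: "u \<in> words A"
  shows "\<exists>i>0. \<exists>p>0. \<phi> (wpow i u) = \<phi> (wpow (i + p) u)"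
proof -
  \<comment> \<open>Positive exponents only, since \<open>wpow 0 u\<close> is empty and not an
    element of the semigroup.\<close>
  have "(\<lambda>n. \<phi> (wpow (Suc n) u)) ` UNIV \<subseteq> \<phi> ` words A"
    using wpow_words[OF u] by blast
  then have "finite (range (\<lambda>n. \<phi> (wpow (Suc n) u)))" using fin finite_subset by blast
  then have "\<not> inj (\<lambda>n. \<phi> (wpow (Suc n) u))" using finite_imageD infinite_UNIV_nat by blast
  then obtain m n where "m < n" and eq: "\<phi> (wpow (Suc m) u) = \<phi> (wpow (Suc n) u)"
    unfolding inj_on_def by (metis nat_neq_iff)
  then have "\<phi> (wpow (Suc m) u) = \<phi> (wpow (Suc m + (n - m)) u)" by simp
  then show ?thesis using \<open>m < n\<close> by (metis zero_less_Suc zero_less_diff)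
qed

lemma pow_idem:
  assumes u: "u \<in> words A"
  shows "\<exists>k>0. \<phi> (wpow k u) = \<phi> (wpow k u @ wpow k u)"
proof -
  obtain i p where ip: "i > 0" "p > 0" and eq: "\<phi> (wpow i u) = \<phi> (wpow (i + p) u)"
    using pow_periodic[OF u] by blast
  have step: "\<phi> (wpow (i + j) u) = \<phi> (wpow (i + j + p) u)" for j
    using cong_right[OF wpow_words[OF u] wpow_words[OF u] wpow_lists[of u A j] eq] ip u
    by (simp add: wpow_add[symmetric] ac_simps words_lists)
  have "\<phi> (wpow (i + j) u) = \<phi> (wpow (i + j + m * p) u)" for j m
  proof (induction m)
    case (Suc m)
    then show ?case using step[of "j + m * p"] by (simp add: ac_simps)
  qed simp
  \<comment> \<open>The exponent \<open>i * p\<close> is a multiple of the period and at least the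
    index \<open>i\<close>, so adding \<open>i\<close> periods doubles it without changing the
    value.\<close>
  from this[of "i * p - i" i] have "\<phi> (wpow (i * p) u) = \<phi> (wpow (i * p + i * p) u)"
    using ip by simp
  then show ?thesis using ip by (metis wpow_add nat_0_less_mult_iff)
qed

text \<open>Stability of finite semigroups: being J-equivalent to \<open>u\<close>, the product \<open>uw\<close> is R-equivalent to \<open>u\<close>.\<close>

lemma stability:
  assumes u: "u \<in> words A" and l: "r \<in> lists A" "w \<in> lists A" "t \<in> lists A"
    and eq: "\<phi> u = \<phi> (r @ u @ w @ t)"
  shows "\<exists>t'\<in>lists A. \<phi> u = \<phi> (u @ w @ t')"
proof (cases "w @ t = []")
  case True
  then show ?thesis by (intro bexI[of _ "[]"]) auto
next
  case False
  let ?v = "w @ t"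
  have v: "?v \<in> words A" using False l by (auto simp: words_iff)
  have pow: "\<phi> u = \<phi> (wpow n r @ u @ wpow n ?v)" for n
  proof (induction n)
    case (Suc n)
    have "\<phi> u = \<phi> (r @ u @ ?v)" using eq by simp
    also have "\<dots> = \<phi> (r @ (wpow n r @ u @ wpow n ?v) @ ?v)"
      using cong_ctxt[OF _ _ _ _ Suc] u l by (simp add: wpow_lists words_iff)
    also have "\<dots> = \<phi> (wpow (Suc n) r @ u @ wpow (n + 1) ?v)"
      by (simp only: wpow_add wpow_Suc wpow_0 append_Nil2 append_assoc One_nat_def)
    finally show ?case by simp
  qed simp
  obtain i p where ip: "i > 0" "p > 0" and per: "\<phi> (wpow i ?v) = \<phi> (wpow (i + p) ?v)"
    using pow_periodic[OF v] by blast
  \<comment> \<open>At the index \<open>i\<close> a further period of \<open>w @ t\<close> can be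
    appended on the right, and the part in front of it folds back to \<open>u\<close>. This removes
    the left context.\<close>
  have "\<phi> u = \<phi> ((wpow i r @ u) @ wpow i ?v)" using pow[of i] by simp
  also have "\<dots> = \<phi> ((wpow i r @ u) @ wpow (i + p) ?v)"
    using per u l v ip by (intro cong_left wpow_words) (auto simp: wpow_lists words_iff)
  also have "\<dots> = \<phi> ((wpow i r @ u @ wpow i ?v) @ wpow p ?v)" by (simp add: wpow_add)
  also have "\<dots> = \<phi> (u @ wpow p ?v)"
    using pow[of i] u l v ip by (intro cong_right) (auto simp: wpow_lists words_iff)
  also have "\<dots> = \<phi> (u @ w @ t @ wpow (p - 1) ?v)" using ip by (cases p) auto
  finally show ?thesis using l v by (intro bexI[of _ "t @ wpow (p - 1) ?v"]) (auto simp: wpow_lists words_iff)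
qed

end

section \<open>Quotients with values in a pseudovariety\<close>

definition finer :: "'a set \<Rightarrow> 'a quot \<Rightarrow> 'a quot \<Rightarrow> bool" where
  "finer A p q \<longleftrightarrow> (\<forall>u\<in>words A. \<forall>v\<in>words A. snd p u = snd p v \<longrightarrow> snd q u = snd q v)"

lemma finer_refl: "finer A p p"
  by (simp add: finer_def)

lemma finer_trans: "finer A p q \<Longrightarrow> finer A q r \<Longrightarrow> finer A p r"
  unfolding finer_def by blast

lemma finerD: "finer A p q \<Longrightarrow> snd p u = snd p v \<Longrightarrow> u \<in> words A \<Longrightarrow> v \<in> words A \<Longrightarrow> snd q u = snd q v"
  unfolding finer_def by blast

lemma words_nonempty: "A \<noteq> {} \<Longrightarrow> words A \<noteq> {}"
proof -
  assume "A \<noteq> {}"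
  then obtain a where "a \<in> A" by blast
  then have "[a] \<in> words A" by (simp add: words_iff)
  then show ?thesis by blast
qed

locale pseudovar =
  fixes V :: "nat semigrp set"
  assumes pv: "pseudovariety V"
begin

lemma V_finite: "S \<in> V \<Longrightarrow> is_finite_semigroup S"
  using pv unfolding pseudovariety_def by blast

lemma V_sub: "S \<in> V \<Longrightarrow> is_subsemigroup H S \<Longrightarrow> S\<lparr>carrier := H\<rparr> \<in> V"
  using pv unfolding pseudovariety_def by blast

lemma V_image: "S \<in> V \<Longrightarrow> f \<in> sg_hom S T \<Longrightarrow> is_finite_semigroup T \<Longrightarrow> f ` carrier S = carrier T \<Longrightarrow> T \<in> V"
  using pv unfolding pseudovariety_def by blast

lemma V_prod: "S \<in> V \<Longrightarrow> T \<in> V \<Longrightarrow> is_finite_semigroup U \<Longrightarrow> sg_iso (sg_prod S T) U \<Longrightarrow> U \<in> V"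
  using pv unfolding pseudovariety_def by blast

lemma quotients_iff:
  "q \<in> quotients V A \<longleftrightarrow> fst q \<in> V \<and> snd q \<in> sg_hom (free_sg A) (fst q) \<and> snd q ` words A = carrier (fst q)"
  by (cases q) (simp add: quotients_def)

lemma quot_V: "q \<in> quotients V A \<Longrightarrow> fst q \<in> V"
  and quot_img: "q \<in> quotients V A \<Longrightarrow> snd q ` words A = carrier (fst q)"
  by (simp_all add: quotients_iff)

lemma quot_hom:
  assumes "q \<in> quotients V A" "u \<in> words A" "v \<in> words A"
  shows "snd q (u @ v) = snd q u \<odot>\<^bsub>fst q\<^esub> snd q v"
  using assms unfolding quotients_iff sg_hom_def by simp

lemma quot_in: "q \<in> quotients V A \<Longrightarrow> u \<in> words A \<Longrightarrow> snd q u \<in> carrier (fst q)"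
  using quot_img by blast

lemma quot_fin_quot:
  assumes "q \<in> quotients V A"
  shows "fin_quot A (snd q)"
proof
  show "finite (snd q ` words A)"
    using quot_img[OF assms] V_finite[OF quot_V[OF assms]] by (simp add: is_finite_semigroup_def)
  fix u u' v v'
  assume "u \<in> words A" "u' \<in> words A" "v \<in> words A" "v' \<in> words A"
    and "snd q u = snd q u'" "snd q v = snd q v'"
  then show "snd q (u @ v) = snd q (u' @ v')"
    using quot_hom[OF assms, of u v] quot_hom[OF assms, of u' v'] by metis
qed

section \<open>Generated quotients and their common refinements\<close>

lemma quot_sub:
  assumes "S \<in> V" "\<psi> \<in> sg_hom (free_sg A) S" "A \<noteq> {}"
  shows "(S\<lparr>carrier := \<psi> ` words A\<rparr>, \<psi>) \<in> quotients V A"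
proof -
  have "is_subsemigroup (\<psi> ` words A) S"
    unfolding is_subsemigroup_def
  proof (intro conjI ballI)
    show "\<psi> ` words A \<noteq> {}" using words_nonempty[OF assms(3)] by blast
    show "\<psi> ` words A \<subseteq> carrier S" using assms(2) by (auto simp: sg_hom_def)
    fix x y assume "x \<in> \<psi> ` words A" "y \<in> \<psi> ` words A"
    then obtain u v where uv: "u \<in> words A" "v \<in> words A" "x = \<psi> u" "y = \<psi> v" by blast
    then have "x \<odot>\<^bsub>S\<^esub> y = \<psi> (u @ v)" using assms(2) by (auto simp: sg_hom_def)
    moreover have "u @ v \<in> words A" using uv by (simp add: words_append)
    ultimately show "x \<odot>\<^bsub>S\<^esub> y \<in> \<psi> ` words A" by blast
  qed
  from V_sub[OF assms(1) this] assms(2) show ?thesis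
    unfolding quotients_iff sg_hom_def by simp
qed

lemma quot_exists: "quotients V A \<noteq> {}" if "A \<noteq> {}"
proof -
  obtain S where S: "S \<in> V" using pv unfolding pseudovariety_def by blast
  define T :: "nat semigrp" where "T = \<lparr>carrier = {0}, sgmult = (\<lambda>_ _. 0)\<rparr>"
  have "carrier S \<noteq> {}" using V_finite[OF S] by (simp add: is_finite_semigroup_def is_semigroup_def)
  then have "T \<in> V"
    by (intro V_image[OF S, of "\<lambda>_. 0"])
      (auto simp: sg_hom_def T_def is_finite_semigroup_def is_semigroup_def)
  moreover have "(\<lambda>_. 0) ` words A = {0::nat}" using words_nonempty[OF that] by blast
  ultimately have "(T, \<lambda>_. 0) \<in> quotients V A"
    unfolding quotients_iff by (simp add: sg_hom_def T_def)
  then show ?thesis by blast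
qed

text \<open>Carriers must consist of natural numbers, so the direct product is transported along the
  pairing bijection.\<close>

lemma V_prod_exists:
  assumes "S \<in> V" "T \<in> V"
  shows "\<exists>U\<in>V. (\<forall>x\<in>carrier S. \<forall>y\<in>carrier T. prod_encode (x, y) \<in> carrier U) \<and>
    (\<forall>x y x' y'. prod_encode (x, y) \<odot>\<^bsub>U\<^esub> prod_encode (x', y') = prod_encode (x \<odot>\<^bsub>S\<^esub> x', y \<odot>\<^bsub>T\<^esub> y'))"
proof -
  define U :: "nat semigrp" where "U = \<lparr>carrier = prod_encode ` (carrier S \<times> carrier T),
     sgmult = (\<lambda>m n. prod_encode (fst (prod_decode m) \<odot>\<^bsub>S\<^esub> fst (prod_decode n),
                                 snd (prod_decode m) \<odot>\<^bsub>T\<^esub> snd (prod_decode n)))\<rparr>"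
  have sg: "is_finite_semigroup S" "is_finite_semigroup T" using assms V_finite by auto
  then have "is_finite_semigroup U"
    unfolding is_finite_semigroup_def is_semigroup_def U_def by auto
  moreover have "sg_iso (sg_prod S T) U"
    unfolding sg_iso_def
  proof
    show "prod_encode \<in> sg_hom (sg_prod S T) U"
      unfolding sg_hom_def sg_prod_def U_def by auto
    show "bij_betw prod_encode (carrier (sg_prod S T)) (carrier U)"
      unfolding sg_prod_def U_def by (auto intro!: inj_on_imp_bij_betw inj_prod_encode)
  qed
  ultimately have "U \<in> V" using V_prod assms by blast
  moreover have "(\<forall>x\<in>carrier S. \<forall>y\<in>carrier T. prod_encode (x, y) \<in> carrier U) \<and>
    (\<forall>x y x' y'. prod_encode (x, y) \<odot>\<^bsub>U\<^esub> prod_encode (x', y') = prod_encode (x \<odot>\<^bsub>S\<^esub> x', y \<odot>\<^bsub>T\<^esub> y'))"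
    by (auto simp: U_def)
  ultimately show ?thesis by blast
qed

text \<open>The image of the words in the direct product refines both factors. Hence the quotients
  are directed under \<open>finer\<close>, on which all compactness arguments rest.\<close>

lemma quot_join:
  assumes A: "A \<noteq> {}" and p: "p \<in> quotients V A" and q: "q \<in> quotients V A"
  shows "\<exists>r\<in>quotients V A. finer A r p \<and> finer A r q"
proof -
  obtain U where U: "U \<in> V"
    and car: "\<And>x y. x\<in>carrier (fst p) \<Longrightarrow> y\<in>carrier (fst q) \<Longrightarrow> prod_encode (x, y) \<in> carrier U"
    and mul: "\<And>x y x' y'. prod_encode (x, y) \<odot>\<^bsub>U\<^esub> prod_encode (x', y') =
                 prod_encode (x \<odot>\<^bsub>fst p\<^esub> x', y \<odot>\<^bsub>fst q\<^esub> y')"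
    using V_prod_exists[OF quot_V[OF p] quot_V[OF q]] by blast
  define \<psi> where "\<psi> w = prod_encode (snd p w, snd q w)" for w
  have "\<psi> \<in> sg_hom (free_sg A) U"
    unfolding sg_hom_def \<psi>_def
    using quot_in[OF p] quot_in[OF q] quot_hom[OF p] quot_hom[OF q] car mul by auto
  from quot_sub[OF U this A] have "(U\<lparr>carrier := \<psi> ` words A\<rparr>, \<psi>) \<in> quotients V A" .
  moreover have "finer A (U\<lparr>carrier := \<psi> ` words A\<rparr>, \<psi>) p" "finer A (U\<lparr>carrier := \<psi> ` words A\<rparr>, \<psi>) q"
    unfolding finer_def \<psi>_def by (auto simp: prod_encode_eq)
  ultimately show ?thesis by blast
qed

lemma quot_finite_join:
  assumes A: "A \<noteq> {}" and "finite K" "K \<subseteq> quotients V A"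
  shows "\<exists>r\<in>quotients V A. \<forall>q\<in>K. finer A r q"
  using assms(2,3)
proof (induction K rule: finite_induct)
  case empty
  then show ?case using quot_exists[OF A] by blast
next
  case (insert q K)
  then obtain r where r: "r \<in> quotients V A" "\<forall>q\<in>K. finer A r q" by auto
  obtain r' where "r' \<in> quotients V A" "finer A r' r" "finer A r' q"
    using quot_join[OF A r(1), of q] insert.prems by blast
  then show ?case using finer_trans r(2) by blast
qed

text \<open>Inclusion of kernels is exactly the existence of a connecting homomorphism over the
  alphabet. This replaces the compatibility condition of the inverse limit by statements about
  words.\<close>

lemma finer_hom:
  assumes p: "p \<in> quotients V A" and q: "q \<in> quotients V A" and "finer A p q"
  shows "\<exists>h\<in>sg_hom (fst p) (fst q). \<forall>w\<in>words A. h (snd p w) = snd q w"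
proof -
  define h where "h s = snd q (SOME w. w \<in> words A \<and> snd p w = s)" for s
  have h: "h (snd p w) = snd q w" if "w \<in> words A" for w
  proof -
    have "(SOME w'. w' \<in> words A \<and> snd p w' = snd p w) \<in> words A \<and>
          snd p (SOME w'. w' \<in> words A \<and> snd p w' = snd p w) = snd p w"
      by (rule someI[where x = w]) (use that in auto)
    then show ?thesis unfolding h_def using finerD[OF assms(3)] that by blast
  qed
  have "h \<in> sg_hom (fst p) (fst q)"
    unfolding sg_hom_def
  proof (intro CollectI conjI ballI funcsetI)
    fix x assume "x \<in> carrier (fst p)"
    then show "h x \<in> carrier (fst q)" using quot_img[OF p] h quot_in[OF q] by force
    fix y assume "y \<in> carrier (fst p)"
    then obtain u v where uv: "u \<in> words A" "v \<in> words A" "x = snd p u" "y = snd p v"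
      using quot_img[OF p] \<open>x \<in> carrier (fst p)\<close> by (metis imageE)
    have "u @ v \<in> words A" using uv by (simp add: words_append)
    then have "h (snd p (u @ v)) = snd q (u @ v)" using h by blast
    then show "h (x \<odot>\<^bsub>fst p\<^esub> y) = h x \<odot>\<^bsub>fst q\<^esub> h y"
      using uv h quot_hom[OF p, of u v] quot_hom[OF q, of u v] by simp
  qed
  then show ?thesis using h by blast
qed

section \<open>The free pro-V semigroup\<close>

abbreviation F :: "'a set \<Rightarrow> ('a quot \<Rightarrow> nat) set" where
  "F A \<equiv> carrier (free_pro V A)"

lemma carrier_free_pro:
  "F A = {x \<in> (\<Pi>\<^sub>E q\<in>quotients V A. carrier (fst q)).
     \<forall>p\<in>quotients V A. \<forall>q\<in>quotients V A. \<forall>h\<in>sg_hom (fst p) (fst q).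
       (\<forall>w\<in>words A. h (snd p w) = snd q w) \<longrightarrow> h (x p) = x q}"
  by (simp add: free_pro_def case_prod_unfold)

lemma pro_in: "x \<in> F A \<Longrightarrow> q \<in> quotients V A \<Longrightarrow> x q \<in> carrier (fst q)"
  unfolding carrier_free_pro by (blast dest: PiE_mem)

lemma pro_ext_PiE: "x \<in> F A \<Longrightarrow> x \<in> (\<Pi>\<^sub>E q\<in>quotients V A. carrier (fst q))"
  unfolding carrier_free_pro by simp

lemma pro_eqI: "x \<in> F A \<Longrightarrow> y \<in> F A \<Longrightarrow> (\<And>q. q \<in> quotients V A \<Longrightarrow> x q = y q) \<Longrightarrow> x = y"
  by (rule PiE_ext[OF pro_ext_PiE pro_ext_PiE])

lemma pro_word: "x \<in> F A \<Longrightarrow> q \<in> quotients V A \<Longrightarrow> \<exists>w\<in>words A. x q = snd q w"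
  using pro_in[of x A q] quot_img[of q A] by force

lemma pro_finer:
  assumes "x \<in> F A" "p \<in> quotients V A" "q \<in> quotients V A" "finer A p q" "w \<in> words A" "x p = snd p w"
  shows "x q = snd q w"
proof -
  obtain h where h: "h\<in>sg_hom (fst p) (fst q)" "\<forall>w\<in>words A. h (snd p w) = snd q w"
    using finer_hom assms by blast
  have "h (x p) = x q" using assms(1-3) h unfolding carrier_free_pro by simp
  then show ?thesis using assms h by simp
qed

text \<open>Compatibility involves only two quotients at a time, and it holds automatically when one
  word gives both values. \<open>pro_two_word\<close> is the converse, by evaluation in a common
  refinement.\<close>

lemma proI:
  assumes "x \<in> (\<Pi>\<^sub>E q\<in>quotients V A. carrier (fst q))"
    and "\<And>p q. p \<in> quotients V A \<Longrightarrow> q \<in> quotients V A \<Longrightarrow> \<exists>w\<in>words A. x p = snd p w \<and> x q = snd q w"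
  shows "x \<in> F A"
  unfolding carrier_free_pro
proof (intro CollectI conjI ballI impI assms(1))
  fix p q h assume "p \<in> quotients V A" "q \<in> quotients V A" "\<forall>w\<in>words A. h (snd p w) = snd q w"
  moreover from this assms(2)[of p q] obtain w where "w \<in> words A" "x p = snd p w" "x q = snd q w"
    by blast
  ultimately show "h (x p) = x q" by simp
qed

lemma pro_two_word:
  assumes "A \<noteq> {}" "x \<in> F A" "p \<in> quotients V A" "q \<in> quotients V A"
  shows "\<exists>w\<in>words A. x p = snd p w \<and> x q = snd q w"
proof -
  obtain r where r: "r \<in> quotients V A" "finer A r p" "finer A r q"
    using quot_join[OF assms(1,3,4)] by blast
  obtain w where "w \<in> words A" "x r = snd r w" using pro_word[OF assms(2) r(1)] by blast
  then show ?thesis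
    using pro_finer[OF assms(2) r(1) assms(3) r(2)] pro_finer[OF assms(2) r(1) assms(4) r(3)] by blast
qed

lemma pro_mult: "q \<in> quotients V A \<Longrightarrow> (x \<odot>\<^bsub>free_pro V A\<^esub> y) q = x q \<odot>\<^bsub>fst q\<^esub> y q"
  by (simp add: free_pro_def)

lemma pro_mult_word:
  "\<lbrakk>q \<in> quotients V A; u \<in> words A; v \<in> words A; x q = snd q u; y q = snd q v\<rbrakk>
    \<Longrightarrow> (x \<odot>\<^bsub>free_pro V A\<^esub> y) q = snd q (u @ v)"
  by (simp add: pro_mult quot_hom)

lemma pro_closed:
  assumes "A \<noteq> {}" "x \<in> F A" "y \<in> F A"
  shows "x \<odot>\<^bsub>free_pro V A\<^esub> y \<in> F A"
proof (rule proI)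
  show "x \<odot>\<^bsub>free_pro V A\<^esub> y \<in> (\<Pi>\<^sub>E q\<in>quotients V A. carrier (fst q))"
  proof (rule PiE_I)
    fix q assume q: "q \<in> quotients V A"
    have "is_semigroup (fst q)" using V_finite[OF quot_V[OF q]] by (simp add: is_finite_semigroup_def)
    then show "(x \<odot>\<^bsub>free_pro V A\<^esub> y) q \<in> carrier (fst q)"
      using pro_mult[OF q, of x y] pro_in[OF assms(2) q] pro_in[OF assms(3) q]
      unfolding is_semigroup_def by simp
  next
    fix q assume "q \<notin> quotients V A"
    then show "(x \<odot>\<^bsub>free_pro V A\<^esub> y) q = undefined" by (simp add: free_pro_def)
  qed
  fix p q assume pq: "p \<in> quotients V A" "q \<in> quotients V A"
  obtain u v where u: "u \<in> words A" "x p = snd p u" "x q = snd q u"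
    and v: "v \<in> words A" "y p = snd p v" "y q = snd q v"
    using pro_two_word[OF assms(1,2) pq] pro_two_word[OF assms(1,3) pq] by blast
  have "u @ v \<in> words A" using u v by (simp add: words_append)
  moreover have "(x \<odot>\<^bsub>free_pro V A\<^esub> y) p = snd p (u @ v)" "(x \<odot>\<^bsub>free_pro V A\<^esub> y) q = snd q (u @ v)"
    using u v pq by (simp_all add: pro_mult quot_hom)
  ultimately show "\<exists>w\<in>words A. (x \<odot>\<^bsub>free_pro V A\<^esub> y) p = snd p w \<and> (x \<odot>\<^bsub>free_pro V A\<^esub> y) q = snd q w"
    by blast
qed

lemma word_emb_app: "q \<in> quotients V A \<Longrightarrow> word_emb V A w q = snd q w"
  unfolding word_emb_def by (cases q) simp

lemma word_emb_in:
  assumes "w \<in> words A"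
  shows "word_emb V A w \<in> F A"
proof (rule proI)
  show "word_emb V A w \<in> (\<Pi>\<^sub>E q\<in>quotients V A. carrier (fst q))"
  proof (rule PiE_I)
    fix q assume "q \<in> quotients V A"
    then show "word_emb V A w q \<in> carrier (fst q)" using assms by (simp add: quot_in word_emb_app)
  qed (simp add: word_emb_def)
  fix p q assume "p \<in> quotients V A" "q \<in> quotients V A"
  then show "\<exists>v\<in>words A. word_emb V A w p = snd p v \<and> word_emb V A w q = snd q v"
    using assms by (intro bexI[of _ w]) (simp_all add: word_emb_app)
qed

subsection \<open>Ultralimits of words\<close>

text \<open>The limit along \<open>U\<close> of the embedded words. The value in each quotient is
  well defined because an ultrafilter singles out one of finitely many values.\<close>

definition ulim :: "'a set \<Rightarrow> 'i filter \<Rightarrow> ('i \<Rightarrow> 'a list) \<Rightarrow> 'a quot \<Rightarrow> nat" where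
  "ulim A U f = (\<lambda>q\<in>quotients V A. THE s. eventually (\<lambda>i. snd q (f i) = s) U)"

lemma ulim_app:
  assumes U: "ultra U" and f: "eventually (\<lambda>i. f i \<in> words A) U" and q: "q \<in> quotients V A"
  shows "eventually (\<lambda>i. snd q (f i) = ulim A U f q) U"
proof -
  interpret fin_quot A "snd q" by (rule quot_fin_quot[OF q])
  have "eventually (\<lambda>i. snd q (f i) \<in> snd q ` words A) U"
    using f by eventually_elim auto
  from ultra_finite[OF U fin this]
  obtain s where s: "eventually (\<lambda>i. snd q (f i) = s) U" by blast
  have "(THE s. eventually (\<lambda>i. snd q (f i) = s) U) = s"
  proof (intro the_equality s)
    fix t assume "eventually (\<lambda>i. snd q (f i) = t) U"
    with s have "eventually (\<lambda>i. t = s) U" by eventually_elim simp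
    from ultra_happens[OF U this] show "t = s" by simp
  qed
  then have "ulim A U f q = s" using q by (simp add: ulim_def)
  then show ?thesis using s by simp
qed

lemma ulim_in:
  assumes U: "ultra U" and f: "eventually (\<lambda>i. f i \<in> words A) U"
  shows "ulim A U f \<in> F A"
proof (rule proI)
  note app = ulim_app[OF U f]
  show "ulim A U f \<in> (\<Pi>\<^sub>E q\<in>quotients V A. carrier (fst q))"
  proof (rule PiE_I)
    fix q assume q: "q \<in> quotients V A"
    from ultra_happens[OF U eventually_conj[OF f app[OF q]]]
    obtain i where "f i \<in> words A" "snd q (f i) = ulim A U f q" by blast
    then show "ulim A U f q \<in> carrier (fst q)" using quot_in[OF q, of "f i"] by simp
  qed (simp add: ulim_def)
  fix p q assume "p \<in> quotients V A" "q \<in> quotients V A"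
  from ultra_happens[OF U eventually_conj[OF f eventually_conj[OF app[OF this(1)] app[OF this(2)]]]]
  obtain i where "f i \<in> words A" "snd p (f i) = ulim A U f p" "snd q (f i) = ulim A U f q" by blast
  then show "\<exists>w\<in>words A. ulim A U f p = snd p w \<and> ulim A U f q = snd q w"
    by (intro bexI[of _ "f i"]) simp_all
qed

text \<open>The cones of quotients finer than a given one form a filter base by directedness, and
  none is empty by reflexivity. An ultrafilter below it gives limits of families indexed by the
  quotients themselves.\<close>

lemma tail_ultra:
  assumes A: "A \<noteq> {}"
  shows "\<exists>U::'a quot filter. ultra U \<and> (\<forall>q\<in>quotients V A. eventually (\<lambda>p. p \<in> quotients V A \<and> finer A p q) U)"
proof -
  let ?B = "\<lambda>q. {p \<in> quotients V A. finer A p q}"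
  let ?F = "INF q\<in>quotients V A. principal (?B q)"
  have ev: "eventually P ?F \<longleftrightarrow> (\<exists>q\<in>quotients V A. eventually P (principal (?B q)))" for P
  proof (rule eventually_INF_base)
    fix a b assume "a \<in> quotients V A" "b \<in> quotients V A"
    from quot_join[OF A this] obtain r where "r \<in> quotients V A" "finer A r a" "finer A r b" by blast
    then have "?B r \<subseteq> ?B a \<inter> ?B b" using finer_trans by blast
    with \<open>r \<in> quotients V A\<close>
    show "\<exists>x\<in>quotients V A. principal (?B x) \<le> inf (principal (?B a)) (principal (?B b))"
      by (intro bexI[of _ r]) (simp_all add: inf_principal)
  qed (rule quot_exists[OF A])
  have "?F \<noteq> bot"
  proof
    assume "?F = bot"
    then have "eventually (\<lambda>_. False) ?F" by simp
    then obtain q where q: "q \<in> quotients V A" "eventually (\<lambda>_. False) (principal (?B q))"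
      unfolding ev by blast
    then have "?B q = {}" by (simp add: eventually_principal)
    then show False using q finer_refl by blast
  qed
  then obtain U where "U \<le> ?F" "ultra U" using ultra_exists by blast
  moreover have "eventually (\<lambda>p. p \<in> quotients V A \<and> finer A p q) ?F" if "q \<in> quotients V A" for q
    unfolding ev using that by (intro bexI[of _ q]) (simp_all add: eventually_principal)
  ultimately show ?thesis using filter_leD by blast
qed

text \<open>A single ultrafilter serves both families, so the same finer quotient \<open>p\<close>
  witnesses both values. Factorisations with an unknown factor on each side need this simultaneous
  choice.\<close>

lemma compactness2:
  assumes A: "A \<noteq> {}" and w: "\<And>q. q \<in> quotients V A \<Longrightarrow> w q \<in> words A" "\<And>q. q \<in> quotients V A \<Longrightarrow> w' q \<in> words A"
  shows "\<exists>x\<in>F A. \<exists>x'\<in>F A. \<forall>q\<in>quotients V A. \<exists>p\<in>quotients V A.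
           finer A p q \<and> x q = snd q (w p) \<and> x' q = snd q (w' p)"
proof -
  obtain U :: "'a quot filter" where U: "ultra U"
    and tail: "\<And>q. q \<in> quotients V A \<Longrightarrow> eventually (\<lambda>p. p \<in> quotients V A \<and> finer A p q) U"
    using tail_ultra[OF A] by blast
  have Q: "eventually (\<lambda>p. p \<in> quotients V A) U"
  proof -
    obtain q where "q \<in> quotients V A" using quot_exists[OF A] by blast
    from tail[OF this] show ?thesis by eventually_elim simp
  qed
  have ev: "eventually (\<lambda>p. w p \<in> words A) U" "eventually (\<lambda>p. w' p \<in> words A) U"
    using Q by (eventually_elim, use w in blast)+
  have "\<exists>p\<in>quotients V A. finer A p q \<and> ulim A U w q = snd q (w p) \<and> ulim A U w' q = snd q (w' p)"
    if q: "q \<in> quotients V A" for q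
  proof -
    from ultra_happens[OF U eventually_conj[OF tail[OF q]
        eventually_conj[OF ulim_app[OF U ev(1) q] ulim_app[OF U ev(2) q]]]]
    obtain p where "p \<in> quotients V A" "finer A p q" "snd q (w p) = ulim A U w q" "snd q (w' p) = ulim A U w' q"
      by blast
    then show ?thesis by (intro bexI[of _ p]) simp_all
  qed
  then show ?thesis using ulim_in[OF U ev(1)] ulim_in[OF U ev(2)] by blast
qed

lemma compactness:
  assumes "A \<noteq> {}" "\<And>q. q \<in> quotients V A \<Longrightarrow> w q \<in> words A"
  shows "\<exists>x\<in>F A. \<forall>q\<in>quotients V A. \<exists>p\<in>quotients V A. finer A p q \<and> x q = snd q (w p)"
  using compactness2[of A w w] assms by blast

lemma accumulation_point:
  assumes w: "\<And>n. w n \<in> words A"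
  shows "\<exists>x\<in>F A. \<forall>q\<in>quotients V A. \<forall>n::nat. \<exists>m\<ge>n. x q = snd q (w m)"
proof -
  obtain U :: "nat filter" where U: "ultra U" and le: "U \<le> sequentially" using free_ultra_nat by blast
  have ev: "eventually (\<lambda>n. w n \<in> words A) U" using w by simp
  have "\<exists>m\<ge>n. ulim A U w q = snd q (w m)" if "q \<in> quotients V A" for q n
  proof -
    have "eventually (\<lambda>m. m \<ge> n) U" using le eventually_ge_at_top filter_leD by blast
    from ultra_happens[OF U eventually_conj[OF this ulim_app[OF U ev that]]]
    obtain m where "m \<ge> n" "snd q (w m) = ulim A U w q" by blast
    then show ?thesis by (intro exI[of _ m]) simp
  qed
  then show ?thesis using ulim_in[OF U ev] by blast
qed

subsection \<open>Topology\<close>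

lemma topspace_free_pro: "topspace (free_pro_top V A) = F A"
proof -
  have "F A \<subseteq> (\<Pi>\<^sub>E q\<in>quotients V A. carrier (fst q))" using pro_ext_PiE by (rule subsetI)
  then show ?thesis unfolding free_pro_top_def by (simp add: inf_absorb2)
qed

lemma continuous_proj:
  "q \<in> quotients V A \<Longrightarrow> continuous_map (free_pro_top V A) (discrete_topology (carrier (fst q))) (\<lambda>x. x q)"
  unfolding free_pro_top_def
  by (intro continuous_map_from_subtopology continuous_map_product_projection)

lemma Hausdorff_free_pro: "Hausdorff_space (free_pro_top V A)"
  unfolding free_pro_top_def
  by (intro Hausdorff_space_subtopology) (simp add: Hausdorff_space_product_topology)

text \<open>A basic neighbourhood restricts finitely many coordinates, and one common refinement
  controls them all. Hence the closure can be tested in one quotient at a time.\<close>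

lemma closure_of_words:
  assumes A: "A \<noteq> {}" and K: "K \<subseteq> words A"
  shows "x \<in> free_pro_top V A closure_of (word_emb V A ` K) \<longleftrightarrow>
           x \<in> F A \<and> (\<forall>q\<in>quotients V A. \<exists>w\<in>K. x q = snd q w)"
proof (intro iffI conjI ballI)
  assume cl: "x \<in> free_pro_top V A closure_of (word_emb V A ` K)"
  then show x: "x \<in> F A" unfolding in_closure_of topspace_free_pro by simp
  fix q assume q: "q \<in> quotients V A"
  have "openin (free_pro_top V A) {y \<in> topspace (free_pro_top V A). y q \<in> {x q}}" (is "openin _ ?T")
    using continuous_proj[OF q] by (rule openin_continuous_map_preimage) (use pro_in[OF x q] in simp)
  moreover have "x \<in> ?T" using x by (simp add: topspace_free_pro)
  ultimately have "\<exists>y. y \<in> word_emb V A ` K \<and> y \<in> ?T"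
    by (intro cl[unfolded in_closure_of, THEN conjunct2, THEN spec, THEN mp] conjI)
  then obtain y where y: "y \<in> word_emb V A ` K" "y q = x q" by blast
  then obtain w where "w \<in> K" "y = word_emb V A w" by blast
  then show "\<exists>w\<in>K. x q = snd q w" using y(2) by (intro bexI[of _ w]) (simp_all add: word_emb_app[OF q])
next
  assume R: "x \<in> F A \<and> (\<forall>q\<in>quotients V A. \<exists>w\<in>K. x q = snd q w)"
  then have x: "x \<in> F A" by blast
  show "x \<in> free_pro_top V A closure_of (word_emb V A ` K)"
    unfolding in_closure_of
  proof (intro conjI allI impI)
    show "x \<in> topspace (free_pro_top V A)" using x by (simp add: topspace_free_pro)
    fix T assume "x \<in> T \<and> openin (free_pro_top V A) T"
    then obtain T' where T': "openin (product_topology (\<lambda>q. discrete_topology (carrier (fst q))) (quotients V A)) T'"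
      and T: "T = T' \<inter> F A" and "x \<in> T'"
      unfolding free_pro_top_def openin_subtopology by blast
    from this(1)[unfolded openin_product_topology_alt, rule_format, OF this(3)]
    obtain W where fin: "finite {q \<in> quotients V A. W q \<noteq> carrier (fst q)}"
      and xW: "x \<in> Pi\<^sub>E (quotients V A) W" and WT: "Pi\<^sub>E (quotients V A) W \<subseteq> T'"
      by (simp only: topspace_discrete_topology) blast
    obtain r where r: "r \<in> quotients V A" and fr: "\<And>q. q \<in> quotients V A \<Longrightarrow> W q \<noteq> carrier (fst q) \<Longrightarrow> finer A r q"
      using quot_finite_join[OF A fin] by blast
    obtain w where w: "w \<in> K" "x r = snd r w" using R r by blast
    then have wA: "w \<in> words A" using K by blast
    have "word_emb V A w \<in> Pi\<^sub>E (quotients V A) W"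
    proof (rule PiE_I)
      fix q assume q: "q \<in> quotients V A"
      show "word_emb V A w q \<in> W q"
      proof (cases "W q = carrier (fst q)")
        case True
        then show ?thesis using quot_in[OF q wA] word_emb_app[OF q] by simp
      next
        case False
        then have "x q = snd q w" using pro_finer[OF x r q fr[OF q] wA] w by blast
        then show ?thesis using PiE_mem[OF xW q] word_emb_app[OF q] by simp
      qed
    qed (simp add: word_emb_def)
    then show "\<exists>y. y \<in> word_emb V A ` K \<and> y \<in> T"
      using w(1) WT T word_emb_in[OF wA] by blast
  qed
qed

subsection \<open>Extension of homomorphisms\<close>

text \<open>The extension by duality: composing a quotient of the target words with \<open>f\<close>
  gives a quotient of the source words, where \<open>x\<close> is evaluated. The carrier is cut down
  to the image because quotients are surjective.\<close>

definition hom_ext :: "'a set \<Rightarrow> 'b set \<Rightarrow> ('a list \<Rightarrow> 'b list) \<Rightarrow> ('a quot \<Rightarrow> nat) \<Rightarrow> 'b quot \<Rightarrow> nat" where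
  "hom_ext A B f = (\<lambda>x\<in>F A. \<lambda>q\<in>quotients V B. x ((fst q)\<lparr>carrier := (snd q \<circ> f) ` words A\<rparr>, snd q \<circ> f))"

context
  fixes A :: "'a set" and B :: "'b set" and f :: "'a list \<Rightarrow> 'b list"
  assumes A: "A \<noteq> {}" and B: "B \<noteq> {}" and f: "f \<in> sg_hom (free_sg A) (free_sg B)"
begin

lemma hom_words: "u \<in> words A \<Longrightarrow> f u \<in> words B"
proof -
  have "f \<in> words A \<rightarrow> words B" using f by (simp add: sg_hom_def)
  then show "u \<in> words A \<Longrightarrow> f u \<in> words B" by (rule funcset_mem)
qed

lemma hom_append: "u \<in> words A \<Longrightarrow> v \<in> words A \<Longrightarrow> f (u @ v) = f u @ f v"
  using f by (simp add: sg_hom_def)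

lemma pullback_quot:
  assumes q: "q \<in> quotients V B"
  shows "((fst q)\<lparr>carrier := (snd q \<circ> f) ` words A\<rparr>, snd q \<circ> f) \<in> quotients V A"
proof (rule quot_sub[OF quot_V[OF q] _ A])
  show "snd q \<circ> f \<in> sg_hom (free_sg A) (fst q)"
    unfolding sg_hom_def
    by (auto simp: hom_append quot_hom[OF q hom_words hom_words] intro!: quot_in[OF q] hom_words)
qed

lemma hom_ext_app:
  "x \<in> F A \<Longrightarrow> q \<in> quotients V B \<Longrightarrow>
    hom_ext A B f x q = x ((fst q)\<lparr>carrier := (snd q \<circ> f) ` words A\<rparr>, snd q \<circ> f)"
  by (simp add: hom_ext_def)

lemma hom_ext_in:
  assumes x: "x \<in> F A"
  shows "hom_ext A B f x \<in> F B"
proof (rule proI)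
  show "hom_ext A B f x \<in> (\<Pi>\<^sub>E q\<in>quotients V B. carrier (fst q))"
  proof (rule PiE_I)
    fix q assume q: "q \<in> quotients V B"
    have "hom_ext A B f x q \<in> (snd q \<circ> f) ` words A"
      using pro_in[OF x pullback_quot[OF q]] hom_ext_app[OF x q] by simp
    then obtain w where "w \<in> words A" "hom_ext A B f x q = snd q (f w)" by auto
    then show "hom_ext A B f x q \<in> carrier (fst q)" using quot_in[OF q hom_words] by simp
  qed (simp add: hom_ext_def x)
  fix p q assume pq: "p \<in> quotients V B" "q \<in> quotients V B"
  from pro_two_word[OF A x pullback_quot[OF pq(1)] pullback_quot[OF pq(2)]]
  obtain w where "w \<in> words A" "hom_ext A B f x p = snd p (f w)" "hom_ext A B f x q = snd q (f w)"
    using hom_ext_app[OF x pq(1)] hom_ext_app[OF x pq(2)] by auto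
  then show "\<exists>w\<in>words B. hom_ext A B f x p = snd p w \<and> hom_ext A B f x q = snd q w"
    using hom_words by blast
qed

lemma hom_ext_word:
  assumes "w \<in> words A"
  shows "hom_ext A B f (word_emb V A w) = word_emb V B (f w)"
proof (rule pro_eqI[OF hom_ext_in[OF word_emb_in[OF assms]] word_emb_in[OF hom_words[OF assms]]])
  fix q assume q: "q \<in> quotients V B"
  show "hom_ext A B f (word_emb V A w) q = word_emb V B (f w) q"
    using hom_ext_app[OF word_emb_in[OF assms] q] word_emb_app[OF pullback_quot[OF q]] word_emb_app[OF q]
    by simp
qed

lemma hom_ext_continuous: "continuous_map (free_pro_top V A) (free_pro_top V B) (hom_ext A B f)"
proof -
  have comp: "continuous_map (free_pro_top V A) (discrete_topology (carrier (fst q))) (\<lambda>x. hom_ext A B f x q)"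
    if q: "q \<in> quotients V B" for q
  proof -
    let ?p = "((fst q)\<lparr>carrier := (snd q \<circ> f) ` words A\<rparr>, snd q \<circ> f)"
    have "continuous_map (discrete_topology (carrier (fst ?p))) (discrete_topology (carrier (fst q))) id"
      by (auto intro: quot_in[OF q hom_words])
    from continuous_map_compose[OF continuous_proj[OF pullback_quot[OF q]] this]
    show ?thesis
      by (rule continuous_map_eq) (simp add: hom_ext_app[OF _ q] topspace_free_pro)
  qed
  have "hom_ext A B f ` F A \<subseteq> F B" using hom_ext_in by blast
  moreover have "continuous_map (free_pro_top V A)
     (product_topology (\<lambda>q. discrete_topology (carrier (fst q))) (quotients V B)) (hom_ext A B f)"
    unfolding continuous_map_componentwise
  proof (intro conjI ballI comp)
    show "hom_ext A B f ` topspace (free_pro_top V A) \<subseteq> extensional (quotients V B)"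
      unfolding topspace_free_pro using pro_ext_PiE[OF hom_ext_in] by (auto simp: PiE_def)
  qed
  ultimately show ?thesis
    unfolding free_pro_top_def[of V B] continuous_map_in_subtopology
    by (auto simp: topspace_free_pro)
qed

lemma hom_ext_hom: "hom_ext A B f \<in> sg_hom (free_pro V A) (free_pro V B)"
  unfolding sg_hom_def
proof (intro CollectI conjI ballI funcsetI)
  fix x assume x: "x \<in> F A"
  then show "hom_ext A B f x \<in> F B" by (rule hom_ext_in)
  fix y assume y: "y \<in> F A"
  show "hom_ext A B f (x \<odot>\<^bsub>free_pro V A\<^esub> y) = hom_ext A B f x \<odot>\<^bsub>free_pro V B\<^esub> hom_ext A B f y"
  proof (rule pro_eqI[OF hom_ext_in pro_closed])
    fix q assume q: "q \<in> quotients V B"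
    show "hom_ext A B f (x \<odot>\<^bsub>free_pro V A\<^esub> y) q = (hom_ext A B f x \<odot>\<^bsub>free_pro V B\<^esub> hom_ext A B f y) q"
      using hom_ext_app[OF _ q] x y pro_closed[OF A x y] pro_mult[OF q] pro_mult[OF pullback_quot[OF q]]
      by simp
  qed (simp_all add: x y A B pro_closed hom_ext_in)
qed

text \<open>Uniqueness in the definite description: words are dense, and continuous maps into a
  Hausdorff space that agree on a dense set are equal.\<close>

lemma pro_ext_eq: "pro_ext V A B f = hom_ext A B f"
  unfolding pro_ext_def
proof (rule the_equality)
  show "hom_ext A B f \<in> extensional (F A) \<and> hom_ext A B f \<in> sg_hom (free_pro V A) (free_pro V B) \<and>
     continuous_map (free_pro_top V A) (free_pro_top V B) (hom_ext A B f) \<and>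
     (\<forall>w\<in>carrier (free_sg A). hom_ext A B f (word_emb V A w) = word_emb V B (f w))"
    using hom_ext_hom hom_ext_continuous hom_ext_word by (simp add: hom_ext_def)
next
  fix g assume g: "g \<in> extensional (F A) \<and> g \<in> sg_hom (free_pro V A) (free_pro V B) \<and>
     continuous_map (free_pro_top V A) (free_pro_top V B) g \<and>
     (\<forall>w\<in>carrier (free_sg A). g (word_emb V A w) = word_emb V B (f w))"
  show "g = hom_ext A B f"
  proof (rule extensionalityI)
    show "g \<in> extensional (F A)" using g by blast
    show "hom_ext A B f \<in> extensional (F A)" by (simp add: hom_ext_def)
    fix x assume x: "x \<in> F A"
    have "x \<in> free_pro_top V A closure_of (word_emb V A ` words A)"
      using closure_of_words[OF A, of "words A" x] x pro_word[OF x] by blast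
    moreover have "g y = hom_ext A B f y" if "y \<in> word_emb V A ` words A" for y
      using that g by (auto simp: hom_ext_word)
    ultimately show "g x = hom_ext A B f x"
      using forall_in_closure_of_eq[OF _ Hausdorff_free_pro conjunct1[OF conjunct2[OF conjunct2[OF g]]] hom_ext_continuous]
      by blast
  qed
qed

text \<open>Continuous images of compact spaces are closed, which is why a test in each quotient
  separately suffices. Concretely, the preimages \<open>v q\<close> found in single quotients have
  an ultralimit, and the extension maps it to \<open>y\<close>.\<close>

lemma pro_ext_image:
  "y \<in> pro_ext V A B f ` F A \<longleftrightarrow> y \<in> F B \<and> (\<forall>q\<in>quotients V B. \<exists>v\<in>words A. y q = snd q (f v))"
proof
  assume "y \<in> pro_ext V A B f ` F A"
  then obtain x where x: "x \<in> F A" "y = hom_ext A B f x" unfolding pro_ext_eq by blast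
  have "\<exists>v\<in>words A. y q = snd q (f v)" if "q \<in> quotients V B" for q
    using pro_word[OF x(1) pullback_quot[OF that]] by (simp add: x(2) hom_ext_app[OF x(1) that])
  then show "y \<in> F B \<and> (\<forall>q\<in>quotients V B. \<exists>v\<in>words A. y q = snd q (f v))"
    using x hom_ext_in by blast
next
  assume R: "y \<in> F B \<and> (\<forall>q\<in>quotients V B. \<exists>v\<in>words A. y q = snd q (f v))"
  then have y: "y \<in> F B" by blast
  obtain v where v: "\<And>q. q \<in> quotients V B \<Longrightarrow> v q \<in> words A \<and> y q = snd q (f (v q))"
  proof -
    have "\<forall>q\<in>quotients V B. \<exists>v. v \<in> words A \<and> y q = snd q (f v)" using R by blast
    from bchoice[OF this] show ?thesis using that by blast
  qed
  obtain U :: "'b quot filter" where U: "ultra U"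
    and tail: "\<And>q. q \<in> quotients V B \<Longrightarrow> eventually (\<lambda>p. p \<in> quotients V B \<and> finer B p q) U"
    using tail_ultra[OF B] by blast
  obtain q0 where "q0 \<in> quotients V B" using quot_exists[OF B] by blast
  from tail[OF this] have ev: "eventually (\<lambda>p. v p \<in> words A) U"
    by eventually_elim (use v in blast)
  let ?x = "ulim A U v"
  have x: "?x \<in> F A" by (rule ulim_in[OF U ev])
  have "hom_ext A B f ?x = y"
  proof (rule pro_eqI[OF hom_ext_in[OF x] y])
    fix q assume q: "q \<in> quotients V B"
    from ultra_happens[OF U eventually_conj[OF tail[OF q] ulim_app[OF U ev pullback_quot[OF q]]]]
    obtain p where p: "p \<in> quotients V B" "finer B p q" and eq: "hom_ext A B f ?x q = snd q (f (v p))"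
      by (auto simp: hom_ext_app[OF x q])
    have "y q = snd q (f (v p))"
      using pro_finer[OF y p(1) q p(2) hom_words] v[OF p(1)] by blast
    then show "hom_ext A B f ?x q = y q" using eq by simp
  qed
  then show "y \<in> pro_ext V A B f ` F A" using x unfolding pro_ext_eq by blast
qed

end

end

section \<open>Homomorphisms of words\<close>

locale word_hom =
  fixes A :: "'a set" and B :: "'b set" and f :: "'a list \<Rightarrow> 'b list"
  assumes hom: "f \<in> sg_hom (free_sg A) (free_sg B)"
begin

lemma in_words: "u \<in> words A \<Longrightarrow> f u \<in> words B"
proof -
  have "f \<in> words A \<rightarrow> words B" using hom by (simp add: sg_hom_def)
  then show "u \<in> words A \<Longrightarrow> f u \<in> words B" by (rule funcset_mem)
qed

lemma hom_append: "u \<in> words A \<Longrightarrow> v \<in> words A \<Longrightarrow> f (u @ v) = f u @ f v"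
  using hom by (simp add: sg_hom_def)

lemma hom_Cons: "a \<in> A \<Longrightarrow> u \<in> words A \<Longrightarrow> f (a # u) = f [a] @ f u"
  using hom_append[of "[a]" u] by (simp add: words_single)

lemma nonempty: "u \<in> words A \<Longrightarrow> f u \<noteq> []"
  using in_words[of u] by (simp add: words_iff)

lemma length_ge: "u \<in> words A \<Longrightarrow> length u \<le> length (f u)"
proof (induction u)
  case (Cons a u)
  then have a: "a \<in> A" by (simp add: words_iff)
  then have "f [a] \<noteq> []" using nonempty[of "[a]"] by (simp add: words_single)
  then have 1: "1 \<le> length (f [a])" by (simp add: Suc_le_eq)
  show ?case
  proof (cases "u = []")
    case True
    then show ?thesis using 1 by simp
  next
    case False
    then have "u \<in> words A" using Cons.prems by (simp add: words_iff)
    then show ?thesis using 1 Cons.IH hom_Cons[OF a] by simp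
  qed
qed simp

lemma sublist_image:
  assumes "sublist u v" "u \<in> words A" "v \<in> words A"
  shows "sublist (f u) (f v)"
proof -
  obtain x y where v: "v = x @ u @ y" using assms(1) unfolding sublist_def by blast
  then have l: "x \<in> lists A" "y \<in> lists A" using assms(3) by (simp_all add: words_iff)
  have r: "prefix (f u) (f (u @ y))"
    using hom_append[OF assms(2), of y] l by (cases "y = []") (simp_all add: words_iff)
  have uy: "u @ y \<in> words A" using words_append_right[OF assms(2) l(2)] .
  have "suffix (f (u @ y)) (f v)"
    using hom_append[OF _ uy, of x] l v by (cases "x = []") (simp_all add: words_iff suffix_def)
  with r show ?thesis by (meson prefix_imp_sublist suffix_imp_sublist sublist_order.order.trans)
qed

lemma block_sublist:
  assumes "a \<in> set v" "v \<in> words A"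
  shows "sublist (f [a]) (f v)"
proof (rule sublist_image)
  show "sublist [a] v" using split_list[OF assms(1)] unfolding sublist_def by auto
  show "[a] \<in> words A" using assms by (auto simp: words_iff)
qed (rule assms)

text \<open>No block is shorter than \<open>w\<close>, so an occurrence crosses at most one
  boundary. That boundary later becomes the origin of a biinfinite word.\<close>

lemma factor_two_blocks:
  assumes "sublist w (f v)" "v \<in> words A" and len: "\<And>a. a \<in> A \<Longrightarrow> length w \<le> length (f [a])"
  shows "(\<exists>a\<in>A. sublist w (f [a])) \<or>
    (\<exists>a\<in>A. \<exists>b\<in>A. \<exists>x y. w = x @ y \<and> x \<noteq> [] \<and> y \<noteq> [] \<and> suffix x (f [a]) \<and> prefix y (f [b]))"
  using assms(1,2)
proof (induction v)
  case (Cons a v)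
  then have a: "a \<in> A" by (simp add: words_iff)
  show ?case
  proof (cases v)
    case Nil
    then show ?thesis using Cons.prems a by auto
  next
    case (Cons b v')
    then have v: "v \<in> words A" and b: "b \<in> A" using Cons.prems by (auto simp: words_iff)
    have "sublist w (f [a]) \<or> sublist w (f v) \<or> (\<exists>x y. w = x @ y \<and> suffix x (f [a]) \<and> prefix y (f v))"
      using Cons.prems(1) hom_Cons[OF a v] by (simp add: sublist_append)
    then consider "sublist w (f [a])" | "sublist w (f v)"
      | x y where "w = x @ y" "suffix x (f [a])" "prefix y (f v)" "x \<noteq> []" "y \<noteq> []"
    proof (elim disjE exE conjE)
      fix x y assume xy: "w = x @ y" "suffix x (f [a])" "prefix y (f v)"
      show thesis
      proof (cases "x = [] \<or> y = []")
        case True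
        then have "sublist w (f [a]) \<or> sublist w (f v)"
          using xy prefix_imp_sublist suffix_imp_sublist by auto
        then show thesis using that by blast
      qed (use xy that in blast)
    qed (use that in blast)+
    then show ?thesis
    proof cases
      case 2
      then show ?thesis using Cons.IH v by blast
    next
      case (3 x y)
      have "prefix (f [b]) (f v)"
      proof (cases "v' = []")
        case False
        then have "v' \<in> words A" using v Cons by (simp add: words_iff)
        then show ?thesis using hom_Cons[OF b] Cons by simp
      qed (simp add: Cons)
      moreover have "length y \<le> length (f [b])" using len[OF b] 3(1) by simp
      ultimately have "prefix y (f [b])" using 3(3) prefix_length_prefix by blast
      then show ?thesis using 3 a b by blast
    qed (use a in blast)
  qed
qed (simp add: words_iff)

lemma prefix_contains_block:
  assumes w: "prefix w (f v)" "v \<in> words A" and M: "\<And>a. a \<in> A \<Longrightarrow> length (f [a]) \<le> M" "M \<le> length w"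
  shows "\<exists>a\<in>A. sublist (f [a]) w"
proof -
  obtain a v' where v: "v = a # v'" using w(2) by (cases v) (auto simp: words_iff)
  then have a: "a \<in> A" using w(2) by (simp add: words_iff)
  have "prefix (f [a]) (f v)"
  proof (cases "v' = []")
    case False
    then have "v' \<in> words A" using v w(2) by (simp add: words_iff)
    then show ?thesis using hom_Cons[OF a] v by simp
  qed (simp add: v)
  then have "prefix (f [a]) w" using w(1) M a prefix_length_prefix order_trans by blast
  then show ?thesis using a prefix_imp_sublist by blast
qed

text \<open>An occurrence may start inside a block, but at most \<open>M\<close> letters are lost
  there; more than \<open>M\<close> remain, enough for the next block in full.\<close>

lemma factor_contains_block:
  assumes "sublist w (f v)" "v \<in> words A" and M: "\<And>a. a \<in> A \<Longrightarrow> length (f [a]) \<le> M" "2 * M < length w"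
  shows "\<exists>a\<in>A. sublist (f [a]) w"
  using assms(1,2)
proof (induction v)
  case (Cons a v)
  then have a: "a \<in> A" by (simp add: words_iff)
  have short: "\<not> sublist w (f [a])" using M(1)[OF a] M(2) sublist_length_le[of w "f [a]"] by auto
  show ?case
  proof (cases "v = []")
    case True
    then show ?thesis using Cons.prems short by simp
  next
    case False
    then have v: "v \<in> words A" using Cons.prems by (simp add: words_iff)
    have "sublist w (f v) \<or> (\<exists>x y. w = x @ y \<and> suffix x (f [a]) \<and> prefix y (f v))"
      using Cons.prems(1) short hom_Cons[OF a v] by (simp add: sublist_append)
    then show ?thesis
    proof (elim disjE exE conjE)
      assume "sublist w (f v)"
      then show ?thesis using Cons.IH v by blast
    next
      fix x y assume xy: "w = x @ y" "suffix x (f [a])" "prefix y (f v)"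
      have "length x \<le> M" using suffix_length_le[OF xy(2)] M(1)[OF a] by simp
      then have "M \<le> length y" using M(2) xy(1) by simp
      from prefix_contains_block[OF xy(3) v M(1) this] obtain b where "b \<in> A" "sublist (f [b]) y" by blast
      then show ?thesis using xy(1) by (metis sublist_append)
    qed
  qed
qed (simp add: words_iff)

end


section \<open>The language of a primitive directive sequence\<close>

lemma foldr_comp_Cons: "foldr (\<circ>) (f # fs) g = f \<circ> foldr (\<circ>) fs g"
  by (simp only: foldr_Cons comp_apply[of "(\<circ>) f"])

lemma foldr_comp: "foldr (\<circ>) fs g = foldr (\<circ>) fs id \<circ> g"
proof (induction fs)
  case (Cons f fs)
  show ?case
    unfolding foldr_comp_Cons by (subst Cons.IH) (rule comp_assoc[symmetric])
qed simp

lemma ds_comp_refl [simp]: "ds_comp \<sigma> n n = id"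
  by (simp add: ds_comp_def)

lemma ds_comp_trans: "n \<le> m \<Longrightarrow> m \<le> k \<Longrightarrow> ds_comp \<sigma> n k = ds_comp \<sigma> n m \<circ> ds_comp \<sigma> m k"
proof -
  assume "n \<le> m" "m \<le> k"
  then have "[n..<k] = [n..<m] @ [m..<k]" using upt_add_eq_append[of n m "k - m"] by simp
  then have "ds_comp \<sigma> n k = foldr (\<circ>) (map \<sigma> [n..<m]) (foldr (\<circ>) (map \<sigma> [m..<k]) id)"
    by (simp add: ds_comp_def)
  then show ?thesis
    unfolding ds_comp_def foldr_comp[of "map \<sigma> [n..<m]" "foldr (\<circ>) (map \<sigma> [m..<k]) id"] .
qed

lemma ds_comp_Suc: "n \<le> m \<Longrightarrow> ds_comp \<sigma> n (Suc m) = ds_comp \<sigma> n m \<circ> \<sigma> m"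
  using ds_comp_trans[of n m "Suc m" \<sigma>] by (simp add: ds_comp_def[of _ m "Suc m"])

locale primitive_directive =
  fixes A :: "nat \<Rightarrow> 'a set" and \<sigma> :: "nat \<Rightarrow> 'a list \<Rightarrow> 'a list"
  assumes ds: "directive_sequence A \<sigma>" and prim: "primitive_ds A \<sigma>"
begin

lemma A_finite: "finite (A n)" and A_nonempty: "A n \<noteq> {}"
  and \<sigma>_hom: "\<sigma> n \<in> sg_hom (free_sg (A (Suc n))) (free_sg (A n))"
  using ds unfolding directive_sequence_def by blast+

lemma ds_comp_hom: "n \<le> m \<Longrightarrow> ds_comp \<sigma> n m \<in> sg_hom (free_sg (A m)) (free_sg (A n))"
proof (induction m rule: dec_induct)
  case base
  show ?case by (simp add: sg_hom_def)
next
  case (step m)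
  interpret f: word_hom "A m" "A n" "ds_comp \<sigma> n m" by standard (rule step.IH)
  interpret g: word_hom "A (Suc m)" "A m" "\<sigma> m" by standard (rule \<sigma>_hom)
  show ?case
    unfolding ds_comp_Suc[OF step.hyps(1)] sg_hom_def
    by (simp add: f.hom_append g.hom_append f.in_words g.in_words)
qed

lemma comp_word_hom: "n \<le> m \<Longrightarrow> word_hom (A m) (A n) (ds_comp \<sigma> n m)"
  by standard (rule ds_comp_hom)

lemma ds_comp_words: "n \<le> m \<Longrightarrow> v \<in> words (A m) \<Longrightarrow> ds_comp \<sigma> n m v \<in> words (A n)"
  by (rule word_hom.in_words[OF comp_word_hom])

lemma ds_comp_app: "n \<le> m \<Longrightarrow> m \<le> k \<Longrightarrow> ds_comp \<sigma> n k v = ds_comp \<sigma> n m (ds_comp \<sigma> m k v)"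
  using ds_comp_trans[of n m k \<sigma>] by simp

abbreviation L :: "'a list set" where
  "L \<equiv> language A \<sigma>"

lemma L_iff: "u \<in> L \<longleftrightarrow> u \<noteq> [] \<and> (\<exists>n. \<exists>a\<in>A n. sublist u (ds_comp \<sigma> 0 n [a]))"
  by (auto simp: language_def fac_def)

lemma L_factor: "u \<in> L \<Longrightarrow> sublist v u \<Longrightarrow> v \<noteq> [] \<Longrightarrow> v \<in> L"
  unfolding L_iff by (blast intro: sublist_order.order.trans)

lemma L_words:
  assumes "u \<in> L"
  shows "u \<in> words (A 0)"
proof -
  obtain n a where a: "u \<noteq> []" "a \<in> A n" "sublist u (ds_comp \<sigma> 0 n [a])"
    using assms unfolding L_iff by blast
  have "ds_comp \<sigma> 0 n [a] \<in> words (A 0)" using a(2) by (simp add: ds_comp_words words_single)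
  then have "set (ds_comp \<sigma> 0 n [a]) \<subseteq> A 0" by (auto simp: words_iff)
  then have "set u \<subseteq> A 0" using set_mono_sublist[OF a(3)] by blast
  then show ?thesis using a(1) by (auto simp: words_iff)
qed

lemma image_letter_L: "a \<in> A n \<Longrightarrow> ds_comp \<sigma> 0 n [a] \<in> L"
  unfolding L_iff using ds_comp_words[of 0 n "[a]"] by (intro conjI exI[of _ n] bexI[of _ a]) (simp_all add: words_iff)

lemma image_length_mono:
  assumes "m \<le> n" "\<And>a. a \<in> A m \<Longrightarrow> l \<le> length (ds_comp \<sigma> 0 m [a])" "v \<in> words (A n)"
  shows "l * length (ds_comp \<sigma> m n v) \<le> length (ds_comp \<sigma> 0 n v)"
proof -
  interpret f: word_hom "A m" "A 0" "ds_comp \<sigma> 0 m" by (rule comp_word_hom) simp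
  have "l * length u \<le> length (ds_comp \<sigma> 0 m u)" if "u \<in> words (A m)" for u
    using that
  proof (induction u)
    case (Cons a u)
    then have a: "a \<in> A m" by (simp add: words_iff)
    show ?case
    proof (cases "u = []")
      case True
      then show ?thesis using assms(2)[OF a] by simp
    next
      case False
      then have "u \<in> words (A m)" using Cons.prems by (simp add: words_iff)
      then show ?thesis using Cons.IH f.hom_Cons[OF a] assms(2)[OF a] by simp
    qed
  qed simp
  from this[OF ds_comp_words[OF assms(1,3)]] show ?thesis
    using ds_comp_app[of 0 m n] assms(1) by simp
qed

text \<open>After a positive composition each letter has an image of at least two letters at the old
  level, so the minimal length doubles. The bound then persists at all later levels because
  homomorphisms are nonerasing.\<close>

lemma image_length_at_top: "\<exists>N. \<forall>n\<ge>N. \<forall>v\<in>words (A n). l \<le> length (ds_comp \<sigma> 0 n v)"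
proof (induction l)
  case (Suc l)
  then obtain N where N: "\<And>v. v \<in> words (A N) \<Longrightarrow> l \<le> length (ds_comp \<sigma> 0 N v)" by auto
  obtain m where m: "m > N" "positive_hom (A m) (A N) (ds_comp \<sigma> N m)"
    using prim unfolding primitive_ds_def by blast
  have "Suc l \<le> length (ds_comp \<sigma> 0 m [a])" if "a \<in> A m" for a
  proof -
    have 2: "2 \<le> length (ds_comp \<sigma> N m [a])" using m(2) that unfolding positive_hom_def by blast
    have "l * length (ds_comp \<sigma> N m [a]) \<le> length (ds_comp \<sigma> 0 m [a])"
      using m(1) that N by (intro image_length_mono) (simp_all add: words_single)
    moreover have "l * 2 \<le> l * length (ds_comp \<sigma> N m [a])" using 2 by (rule mult_le_mono2)
    \<comment> \<open>Doubling gives nothing for \<open>l = 0\<close>; in that case the nonerasing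
      bound supplies the letter.\<close>
    moreover have "length (ds_comp \<sigma> N m [a]) \<le> length (ds_comp \<sigma> 0 m [a])"
      using word_hom.length_ge[OF comp_word_hom[of 0 N] ds_comp_words[of N m "[a]"]] m(1) that
        ds_comp_app[of 0 N m "[a]"] by (simp add: words_single)
    ultimately show ?thesis using 2 by linarith
  qed
  then have *: "Suc l * length (ds_comp \<sigma> m n v) \<le> length (ds_comp \<sigma> 0 n v)" if "n \<ge> m" "v \<in> words (A n)" for n v
    using image_length_mono[of m n "Suc l" v] that by blast
  have "Suc l \<le> length (ds_comp \<sigma> 0 n v)" if "n \<ge> m" "v \<in> words (A n)" for n v
  proof -
    have "1 \<le> length (ds_comp \<sigma> m n v)"
      using ds_comp_words[OF that] by (simp add: words_iff Suc_le_eq)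
    then have "Suc l * 1 \<le> Suc l * length (ds_comp \<sigma> m n v)" by (rule mult_le_mono2)
    then have "Suc l \<le> Suc l * length (ds_comp \<sigma> m n v)" by (simp only: mult_1_right)
    from this *[OF that] show ?thesis by (rule order_trans)
  qed
  then show ?case by blast
qed simp

lemma long_words: "\<exists>v\<in>L. l \<le> length v"
proof -
  obtain n where n: "\<And>v. v \<in> words (A n) \<Longrightarrow> l \<le> length (ds_comp \<sigma> 0 n v)"
    using image_length_at_top[of l] by auto
  obtain a where "a \<in> A n" using A_nonempty by blast
  then show ?thesis using image_letter_L n by (intro bexI[of _ "ds_comp \<sigma> 0 n [a]"]) (simp_all add: words_single)
qed

text \<open>If \<open>u\<close> occurs in the image of a letter of level \<open>n\<close> and the
  composition from \<open>m\<close> to \<open>n\<close> is positive, then \<open>u\<close> occurs in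
  every block of level \<open>m\<close>. A long enough word of the language contains such a block in
  full.\<close>

lemma uniform_recurrence:
  assumes "u \<in> L"
  shows "\<exists>l. \<forall>v\<in>L. l \<le> length v \<longrightarrow> sublist u v"
proof -
  obtain n a where a: "a \<in> A n" "sublist u (ds_comp \<sigma> 0 n [a])" using assms unfolding L_iff by blast
  obtain m where m: "m > n" "positive_hom (A m) (A n) (ds_comp \<sigma> n m)"
    using prim unfolding primitive_ds_def by blast
  interpret f: word_hom "A n" "A 0" "ds_comp \<sigma> 0 n" by (rule comp_word_hom) simp
  interpret g: word_hom "A m" "A 0" "ds_comp \<sigma> 0 m" by (rule comp_word_hom) simp
  have block: "sublist u (ds_comp \<sigma> 0 m [b])" if b: "b \<in> A m" for b
  proof -
    have "a \<in> set (ds_comp \<sigma> n m [b])" using m(2) b a(1) unfolding positive_hom_def by blast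
    moreover have "ds_comp \<sigma> n m [b] \<in> words (A n)" using m(1) b by (simp add: ds_comp_words words_single)
    ultimately have "sublist (ds_comp \<sigma> 0 n [a]) (ds_comp \<sigma> 0 n (ds_comp \<sigma> n m [b]))"
      by (rule f.block_sublist)
    then show ?thesis using a(2) ds_comp_app[of 0 n m "[b]"] m(1) sublist_order.order.trans by simp
  qed
  \<comment> \<open>All levels up to \<open>m\<close> are bounded, not only \<open>m\<close> itself,
    so that a word longer than the bound can arise only from a level above \<open>m\<close> and thus
    decomposes into blocks of level \<open>m\<close>.\<close>
  define W where "W = (\<Union>r\<le>m. (\<lambda>c. length (ds_comp \<sigma> 0 r [c])) ` A r)"
  have "finite W" unfolding W_def using A_finite by blast
  define M where "M = Max W"
  have M: "length (ds_comp \<sigma> 0 r [c]) \<le> M" if "r \<le> m" "c \<in> A r" for r c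
    unfolding M_def by (rule Max_ge[OF \<open>finite W\<close>]) (use that in \<open>auto simp: W_def\<close>)
  have "sublist u v" if v: "v \<in> L" "2 * M + 1 \<le> length v" for v
  proof -
    obtain r c where c: "c \<in> A r" "sublist v (ds_comp \<sigma> 0 r [c])" using v(1) unfolding L_iff by blast
    have "r > m"
    proof (rule ccontr)
      assume "\<not> r > m"
      then have "length v \<le> M" using sublist_length_le[OF c(2)] M[of r c] c(1) by simp
      then show False using v(2) by simp
    qed
    then have "sublist v (ds_comp \<sigma> 0 m (ds_comp \<sigma> m r [c]))" using c(2) ds_comp_app[of 0 m r "[c]"] by simp
    moreover have "ds_comp \<sigma> m r [c] \<in> words (A m)" using \<open>r > m\<close> c(1) by (simp add: ds_comp_words words_single)
    ultimately obtain b where "b \<in> A m" "sublist (ds_comp \<sigma> 0 m [b]) v"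
      using g.factor_contains_block[of v _ M] M[of m] v(2) by auto
    then show ?thesis using block sublist_order.order.trans by blast
  qed
  then show ?thesis by blast
qed

end

section \<open>The distinguished J-class of a finite quotient\<close>

context fin_quot
begin

text \<open>The J-order of the quotient, pulled back to words. The contexts may be empty, which
  plays the role of the adjoined identity.\<close>

definition below :: "'a list \<Rightarrow> 'a list \<Rightarrow> bool" where
  "below w v \<longleftrightarrow> (\<exists>r\<in>lists A. \<exists>t\<in>lists A. \<phi> w = \<phi> (r @ v @ t))"

lemma belowI: "\<phi> w = \<phi> (r @ v @ t) \<Longrightarrow> r \<in> lists A \<Longrightarrow> t \<in> lists A \<Longrightarrow> below w v"
  unfolding below_def by blast

lemma below_refl: "below w w"
  by (rule belowI[of _ "[]" _ "[]"]) simp_all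

lemma below_trans:
  assumes "below u v" "below v w" "v \<in> words A" "w \<in> words A"
  shows "below u w"
proof -
  obtain r t where rt: "r \<in> lists A" "t \<in> lists A" "\<phi> u = \<phi> (r @ v @ t)" using assms(1) unfolding below_def by blast
  obtain r' t' where rt': "r' \<in> lists A" "t' \<in> lists A" "\<phi> v = \<phi> (r' @ w @ t')" using assms(2) unfolding below_def by blast
  have "r' @ w @ t' \<in> words A" using rt' assms(4) by (simp add: words_append_left words_append_right)
  from cong_ctxt[OF assms(3) this rt(1,2) rt'(3)] rt(3)
  have "\<phi> u = \<phi> ((r @ r') @ w @ (t' @ t))" by simp
  then show ?thesis by (rule belowI) (use rt rt' in simp_all)
qed

lemma below_sublist:
  assumes "sublist v w" "w \<in> words A"
  shows "below w v"
proof -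
  obtain r t where w: "w = r @ v @ t" using assms(1) unfolding sublist_def by blast
  then have "r \<in> lists A" "t \<in> lists A" using assms(2) by (simp_all add: words_iff)
  then show ?thesis using w by (intro belowI[of w r v t]) simp_all
qed

lemma below_eq: "\<phi> w = \<phi> w' \<Longrightarrow> below w w'"
  by (rule belowI[of _ "[]" _ "[]"]) simp_all

lemma below_stability:
  assumes "below u (u @ w)" "u \<in> words A" "w \<in> lists A"
  shows "\<exists>t\<in>lists A. \<phi> u = \<phi> (u @ w @ t)"
proof -
  obtain r t where "r \<in> lists A" "t \<in> lists A" "\<phi> u = \<phi> (r @ u @ w @ t)"
    using assms(1) unfolding below_def by auto
  with stability[OF assms(2) _ assms(3)] show ?thesis by blast
qed

end

locale lang_quot = primitive_directive A \<sigma> + fin_quot "A 0" \<phi>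
  for A :: "nat \<Rightarrow> 'a set" and \<sigma> and \<phi> :: "'a list \<Rightarrow> 'c"
begin

text \<open>Among the ideals generated by values of words of the language, take one of least
  cardinality, generated by \<open>u0\<close>. Long words contain \<open>u0\<close>, so their ideals
  lie in this one and equal it by minimality.\<close>

lemma long_below: "\<exists>N. \<forall>u\<in>L. \<forall>v\<in>L. N \<le> length u \<longrightarrow> N \<le> length v \<longrightarrow> below u v"
proof -
  define I where "I u = {\<phi> w |w. w \<in> words (A 0) \<and> below w u}" for u
  have fin_I: "finite (I u)" for u
    by (rule finite_subset[OF _ fin]) (auto simp: I_def)
  obtain u0 where u0: "u0 \<in> L" and min: "\<And>u. u \<in> L \<Longrightarrow> card (I u0) \<le> card (I u)"
  proof -
    obtain u where "u \<in> L" using long_words by blast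
    then show ?thesis using that ex_has_least_nat[of "\<lambda>u. u \<in> L" u "\<lambda>u. card (I u)"] by blast
  qed
  obtain N where N: "\<And>v. v \<in> L \<Longrightarrow> N \<le> length v \<Longrightarrow> sublist u0 v"
    using uniform_recurrence[OF u0] by blast
  have I_eq: "I v = I u0" if v: "v \<in> L" "N \<le> length v" for v
  proof (rule card_subset_eq[OF fin_I])
    have "below v u0" using below_sublist[OF N[OF v] L_words[OF v(1)]] .
    then show sub: "I v \<subseteq> I u0"
      unfolding I_def using below_trans[OF _ _ L_words[OF v(1)] L_words[OF u0]] by blast
    show "card (I v) = card (I u0)"
      using card_mono[OF fin_I sub] min[OF v(1)] by simp
  qed
  have "below u v" if u: "u \<in> L" "N \<le> length u" and v: "v \<in> L" "N \<le> length v" for u v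
  proof -
    have "\<phi> u \<in> I u" unfolding I_def using L_words[OF u(1)] below_refl by blast
    then have "\<phi> u \<in> I v" using I_eq[OF u] I_eq[OF v] by simp
    then obtain w where w: "\<phi> u = \<phi> w" "w \<in> words (A 0)" "below w v" unfolding I_def by blast
    show ?thesis by (rule below_trans[OF below_eq[OF w(1)] w(3) w(2) L_words[OF v(1)]])
  qed
  then show ?thesis by blast
qed

text \<open>The value of \<open>w\<close> lies in the J-class that all sufficiently long words of
  the language share in this quotient.\<close>

definition core :: "'a list \<Rightarrow> bool" where
  "core w \<longleftrightarrow> (\<exists>N. \<forall>v\<in>L. N \<le> length v \<longrightarrow> below w v \<and> below v w)"

lemma core_long: "\<exists>N. \<forall>v\<in>L. N \<le> length v \<longrightarrow> core v"
  using long_below unfolding core_def by blast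

lemma core_equiv:
  assumes "core w" "below w w'" "below w' w" "w \<in> words (A 0)" "w' \<in> words (A 0)"
  shows "core w'"
proof -
  obtain N where N: "\<And>v. v \<in> L \<Longrightarrow> N \<le> length v \<Longrightarrow> below w v \<and> below v w"
    using assms(1) unfolding core_def by blast
  have "below w' v \<and> below v w'" if v: "v \<in> L" "N \<le> length v" for v
    using below_trans[OF assms(3) conjunct1[OF N[OF v]] assms(4) L_words[OF v(1)]]
      below_trans[OF conjunct2[OF N[OF v]] assms(2,4,5)] ..
  then show ?thesis unfolding core_def by blast
qed

lemma core_eq: "core w \<Longrightarrow> \<phi> w = \<phi> w' \<Longrightarrow> w \<in> words (A 0) \<Longrightarrow> w' \<in> words (A 0) \<Longrightarrow> core w'"
  by (rule core_equiv) (simp_all add: below_eq)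

text \<open>Nonempty contexts are required because they will become elements of the free pro-V
  semigroup, which has no empty word. Stripping the outer letters of a long word leaves a word still
  above a multiple of \<open>w'\<close>; putting the two letters back makes both contexts
  nonempty.\<close>

lemma core_below_strict:
  assumes "core w" "core w'" "w \<in> words (A 0)" "w' \<in> words (A 0)"
  shows "\<exists>r\<in>words (A 0). \<exists>t\<in>words (A 0). \<phi> w = \<phi> (r @ w' @ t)"
proof -
  obtain N where N: "\<And>v. v \<in> L \<Longrightarrow> N \<le> length v \<Longrightarrow> below w v"
    using assms(1) unfolding core_def by blast
  obtain N' where N': "\<And>v. v \<in> L \<Longrightarrow> N' \<le> length v \<Longrightarrow> below v w'"
    using assms(2) unfolding core_def by blast
  \<comment> \<open>Two letters are removed below: what remains must be nonempty and of length at
    least \<open>N'\<close>.\<close>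
  obtain v where v: "v \<in> L" "N + N' + 3 \<le> length v" using long_words by blast
  then obtain a v1 where v1: "v = a # v1" by (cases v) auto
  then obtain m b where "v1 = m @ [b]" using v(2) by (cases v1 rule: rev_cases) auto
  with v1 have vm: "v = [a] @ m @ [b]" by simp
  have "sublist m v" unfolding vm sublist_def by blast
  moreover have "m \<noteq> []" using vm v(2) by auto
  ultimately have "m \<in> L" by (rule L_factor[OF v(1)])
  then have "below m w'" using N' vm v(2) by simp
  then obtain r' t' where m: "r' \<in> lists (A 0)" "t' \<in> lists (A 0)" "\<phi> m = \<phi> (r' @ w' @ t')"
    unfolding below_def by blast
  have "below w v" using N[OF v(1)] v(2) by simp
  then obtain r t where w: "r \<in> lists (A 0)" "t \<in> lists (A 0)" "\<phi> w = \<phi> (r @ v @ t)"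
    unfolding below_def by blast
  have ab: "a \<in> A 0" "b \<in> A 0" using L_words[OF v(1)] vm by (simp_all add: words_iff)
  have "\<phi> ((r @ [a]) @ m @ ([b] @ t)) = \<phi> ((r @ [a]) @ (r' @ w' @ t') @ ([b] @ t))"
    using w m ab assms(4) L_words[OF \<open>m \<in> L\<close>] by (intro cong_ctxt) (auto simp: words_iff)
  then have "\<phi> w = \<phi> ((r @ [a] @ r') @ w' @ (t' @ [b] @ t))" using w(3) vm by simp
  moreover have "r @ [a] @ r' \<in> words (A 0)" "t' @ [b] @ t \<in> words (A 0)"
    using w m ab by (simp_all add: words_iff)
  ultimately show ?thesis by blast
qed

lemma core_below: "core w \<Longrightarrow> core w' \<Longrightarrow> w \<in> words (A 0) \<Longrightarrow> w' \<in> words (A 0) \<Longrightarrow> below w w'"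
  using core_below_strict unfolding below_def by (meson words_lists)

text \<open>Split a long word as \<open>u @ v\<close> with \<open>u\<close>, \<open>v\<close> and
  the product all in the class. By stability \<open>u\<close> absorbs some \<open>v @ t\<close> on
  the right, hence all its powers. An idempotent power is then above \<open>u\<close> and below its
  factor \<open>v\<close>, so it lies in the class.\<close>

lemma core_idempotent: "\<exists>w\<in>words (A 0). core w \<and> \<phi> w = \<phi> (w @ w)"
proof -
  obtain N where N: "\<And>v. v \<in> L \<Longrightarrow> N \<le> length v \<Longrightarrow> core v" using core_long by blast
  obtain z where z: "z \<in> L" "2 * N + 2 \<le> length z" using long_words by blast
  define u v where "u = take (N + 1) z" and "v = drop (N + 1) z"
  have uv: "z = u @ v" "length u = N + 1" "N + 1 \<le> length v" using z(2) by (simp_all add: u_def v_def)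
  have neq: "u \<noteq> []" "v \<noteq> []" using uv by auto
  have "sublist u z" "sublist v z" unfolding uv(1) by simp_all
  then have "u \<in> L" "v \<in> L" using L_factor[OF z(1)] neq by blast+
  then have c: "core u" "core v" "core z" using N uv z by auto
  have w: "u \<in> words (A 0)" "v \<in> words (A 0)" "z \<in> words (A 0)"
    using L_words \<open>u \<in> L\<close> \<open>v \<in> L\<close> z(1) by auto
  have "below u (u @ v)" using core_below[OF c(1,3) w(1,3)] uv(1) by simp
  from below_stability[OF this w(1) words_lists[OF w(2)]]
  obtain t where t: "t \<in> lists (A 0)" "\<phi> u = \<phi> (u @ (v @ t))" by auto
  have y: "v @ t \<in> words (A 0)" using w t by (simp add: words_append_right)
  obtain k where k: "k > 0" "\<phi> (wpow k (v @ t)) = \<phi> (wpow k (v @ t) @ wpow k (v @ t))"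
    using pow_idem[OF y] by blast
  have pw: "wpow k (v @ t) \<in> words (A 0)" using wpow_words[OF y k(1)] .
  have "\<phi> u = \<phi> (u @ wpow j (v @ t))" for j
  proof (induction j)
    case (Suc j)
    have "\<phi> ((u @ (v @ t)) @ wpow j (v @ t)) = \<phi> (u @ wpow j (v @ t))"
      using w y t by (intro cong_right) (simp_all add: wpow_lists words_append words_lists)
    then show ?case using Suc by simp
  qed simp
  then have "below u (wpow k (v @ t))"
    using w by (intro belowI[of u u _ "[]"]) (simp_all add: words_lists)
  moreover have "below (wpow k (v @ t)) u"
  proof (rule below_trans[OF below_sublist[OF _ pw] core_below[OF c(2,1) w(2,1)] w(2,1)])
    show "sublist v (wpow k (v @ t))" using k(1) by (cases k) (auto simp: sublist_def)
  qed
  ultimately have "core (wpow k (v @ t))" using core_equiv[OF c(1)] w(1) pw by blast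
  then show ?thesis using k pw by blast
qed

text \<open>Reading \<open>y\<close> from left to right, each new letter keeps the value in the same R-class, because
  so it does for the window of length \<open>l\<close> before it, which belongs to the language.\<close>

lemma core_local:
  "\<exists>l. \<forall>y\<in>words (A 0). l \<le> length y \<longrightarrow> (\<forall>u. sublist u y \<longrightarrow> u \<noteq> [] \<longrightarrow> length u \<le> Suc l \<longrightarrow> u \<in> L)
     \<longrightarrow> core y"
proof -
  obtain N where N: "\<And>v. v \<in> L \<Longrightarrow> N \<le> length v \<Longrightarrow> core v" using core_long by blast
  \<comment> \<open>One more than \<open>N\<close> keeps the window nonempty, while windows of
    length \<open>l\<close> are still long enough to be in the class.\<close>
  define l where "l = N + 1"
  have "core y" if "y \<in> words (A 0)" "l \<le> length y"
    "\<And>u. sublist u y \<Longrightarrow> u \<noteq> [] \<Longrightarrow> length u \<le> Suc l \<Longrightarrow> u \<in> L" for y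
    using that
  proof (induction y rule: rev_induct)
    case (snoc a y)
    show ?case
    proof (cases "length y \<ge> l")
      case False
      then have "y @ [a] \<in> L" using snoc.prems by simp
      then show ?thesis using N snoc.prems(2) by (simp add: l_def)
    next
      case True
      then have yne: "y \<noteq> []" by (auto simp: l_def)
      have y: "y \<in> words (A 0)" and a: "a \<in> A 0" using snoc.prems(1) yne by (simp_all add: words_iff)
      have sub_y: "sublist u (y @ [a])" if "sublist u y" for u
        using that by (metis sublist_append)
      have cy: "core y" by (rule snoc.IH[OF y True]) (use snoc.prems(3) sub_y in blast)
      define p s where "p = take (length y - l) y" and "s = drop (length y - l) y"
      have ps: "y = p @ s" "length s = l" using True by (simp_all add: p_def s_def)
      have s: "s \<noteq> []" using ps(2) by (auto simp: l_def)
      have "s \<in> L" by (rule snoc.prems(3)) (use ps s in \<open>auto simp: sublist_def\<close>)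
      have "y @ [a] = p @ (s @ [a]) @ []" using ps(1) by simp
      then have "sublist (s @ [a]) (y @ [a])" unfolding sublist_def by blast
      then have "s @ [a] \<in> L" by (rule snoc.prems(3)) (use ps in simp_all)
      have w: "s \<in> words (A 0)" "s @ [a] \<in> words (A 0)" using L_words \<open>s \<in> L\<close> \<open>s @ [a] \<in> L\<close> by auto
      have "core s" "core (s @ [a])" using N \<open>s \<in> L\<close> \<open>s @ [a] \<in> L\<close> ps(2) by (auto simp: l_def)
      from core_below[OF this w] obtain t where t: "t \<in> lists (A 0)" "\<phi> s = \<phi> (s @ [a] @ t)"
        using below_stability[of s "[a]"] w(1) a by auto
      have "\<phi> (p @ s) = \<phi> (p @ (s @ [a] @ t))"
        using w t a y ps(1) by (intro cong_left) (auto simp: words_iff)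
      then have "\<phi> y = \<phi> ([] @ (y @ [a]) @ t)" using ps(1) by simp
      then have "below y (y @ [a])" by (rule belowI) (use t in simp_all)
      moreover have "below (y @ [a]) y"
        by (rule below_sublist[OF _ snoc.prems(1)]) (simp add: sublist_def, metis append_Nil)
      ultimately show ?thesis using core_equiv[OF cy] y snoc.prems(1) by blast
    qed
  qed simp
  then show ?thesis by blast
qed

text \<open>Put \<open>z = x @ y @ x\<close>. A periodic power of \<open>z\<close> begins with
  \<open>x\<close> and lies in the same J-class, so by stability \<open>x\<close> is that power
  times some \<open>t\<close>. Inserting one more period \<open>p\<close> gives \<open>x\<close> the
  value of \<open>wpow p z @ x\<close>, which begins with \<open>x @ y\<close>. The unknown
  \<open>t\<close> has disappeared, and what follows is composed of \<open>x\<close> and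
  \<open>z\<close> only.\<close>

lemma core_absorb:
  assumes w: "x \<in> words (A 0)" "y \<in> words (A 0)" and cx: "core x"
    and cz: "\<And>n. n > 0 \<Longrightarrow> core (wpow n (x @ y @ x))"
  shows "\<exists>n. \<phi> x = \<phi> ((x @ y) @ x @ wpow n (x @ y @ x) @ x)"
proof -
  let ?z = "x @ y @ x"
  have z: "?z \<in> words (A 0)" using w by (simp add: words_append)
  obtain i p where ip: "i > 0" "p > 0" and per: "\<phi> (wpow i ?z) = \<phi> (wpow (i + p) ?z)"
    using pow_periodic[OF z] by blast
  define c where "c = y @ x @ wpow (i - 1) ?z"
  have zi: "wpow i ?z = x @ c" using ip(1) by (cases i) (simp_all add: c_def)
  have c: "c \<in> lists (A 0)" using w by (simp add: c_def wpow_lists words_lists)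
  have zw: "wpow i ?z \<in> words (A 0)" "wpow (i + p) ?z \<in> words (A 0)" using wpow_words[OF z] ip by auto
  have "below x (x @ c)" using core_below[OF cx cz[OF ip(1)] w(1) zw(1)] zi by simp
  from below_stability[OF this w(1) c] obtain t where t: "t \<in> lists (A 0)" "\<phi> x = \<phi> (wpow i ?z @ t)"
    unfolding zi by auto
  have "\<phi> x = \<phi> (wpow (i + p) ?z @ t)" using cong_right[OF zw t(1) per] t(2) by simp
  also have "\<dots> = \<phi> (wpow p ?z @ (wpow i ?z @ t))" by (simp only: add.commute[of i p] wpow_add append_assoc)
  also have "\<dots> = \<phi> (wpow p ?z @ x)"
    using t zw w z by (intro cong_left) (simp_all add: words_append_right wpow_lists words_lists)
  also have "\<dots> = \<phi> ((x @ y) @ x @ wpow (p - 1) ?z @ x)" using ip(2) by (cases p) simp_all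
  finally show ?thesis by blast
qed

end

text \<open>A limit takes its value at a quotient from a word chosen for a finer one, so the class
  must be preserved under coarsening.\<close>

lemma core_coarser:
  assumes "lang_quot A \<sigma> \<phi>" "lang_quot A \<sigma> \<psi>"
    and fine: "\<And>u v. u \<in> words (A 0) \<Longrightarrow> v \<in> words (A 0) \<Longrightarrow> \<phi> u = \<phi> v \<Longrightarrow> \<psi> u = \<psi> v"
    and "lang_quot.core A \<sigma> \<phi> w" "w \<in> words (A 0)"
  shows "lang_quot.core A \<sigma> \<psi> w"
proof -
  interpret f: lang_quot A \<sigma> \<phi> by fact
  interpret g: lang_quot A \<sigma> \<psi> by fact
  have "g.below u v" if b: "f.below u v" "u \<in> words (A 0)" "v \<in> words (A 0)" for u v
  proof -
    obtain r t where "r \<in> lists (A 0)" "t \<in> lists (A 0)" "\<phi> u = \<phi> (r @ v @ t)"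
      using b(1) unfolding f.below_def by blast
    moreover from this b(3) have "r @ v @ t \<in> words (A 0)"
      by (simp add: words_append_left words_append_right)
    ultimately show ?thesis using fine[OF b(2)] g.belowI by blast
  qed
  then show ?thesis
    using assms(4,5) f.L_words unfolding f.core_def g.core_def by blast
qed

section \<open>Locally testable quotients\<close>

text \<open>Values are coded injectively as numbers and multiplied through chosen representative
  words; the congruence makes the product independent of the choice. The assumption
  \<open>lsl\<close> states on words that the local monoids at idempotents are semilattices.\<close>

lemma finite_quot_in_LSl:
  assumes "fin_quot A \<phi>" and A: "A \<noteq> {}"
    and lsl: "\<And>w v v'. \<lbrakk>w \<in> words A; v \<in> words A; v' \<in> words A; \<phi> w = \<phi> (w @ w)\<rbrakk> \<Longrightarrow>
      \<phi> ((w @ v @ w) @ (w @ v @ w)) = \<phi> (w @ v @ w) \<and>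
      \<phi> ((w @ v @ w) @ (w @ v' @ w)) = \<phi> ((w @ v' @ w) @ (w @ v @ w))"
  shows "\<exists>q\<in>quotients LSl A. \<forall>u\<in>words A. \<forall>v\<in>words A. snd q u = snd q v \<longrightarrow> \<phi> u = \<phi> v"
proof -
  interpret fin_quot A \<phi> by fact
  obtain g :: "'b \<Rightarrow> nat" where g: "inj_on g (\<phi> ` words A)"
    using finite_imp_inj_to_nat_seg[OF fin] by blast
  define \<psi> where "\<psi> w = g (\<phi> w)" for w
  have \<psi>_eq: "\<psi> u = \<psi> v \<longleftrightarrow> \<phi> u = \<phi> v" if "u \<in> words A" "v \<in> words A" for u v
    using inj_onD[OF g, of "\<phi> u" "\<phi> v"] that by (auto simp: \<psi>_def)
  define c where "c s = (SOME w. w \<in> words A \<and> \<psi> w = s)" for s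
  have c: "c (\<psi> w) \<in> words A" "\<psi> (c (\<psi> w)) = \<psi> w" if "w \<in> words A" for w
    using someI[of "\<lambda>v. v \<in> words A \<and> \<psi> v = \<psi> w" w] that unfolding c_def by simp_all
  define S :: "nat semigrp" where "S = \<lparr>carrier = \<psi> ` words A, sgmult = (\<lambda>s t. \<psi> (c s @ c t))\<rparr>"
  have mult: "\<psi> u \<odot>\<^bsub>S\<^esub> \<psi> v = \<psi> (u @ v)" if "u \<in> words A" "v \<in> words A" for u v
  proof -
    have "\<phi> (c (\<psi> u) @ c (\<psi> v)) = \<phi> (u @ v)"
      by (rule cong) (use c that \<psi>_eq in simp_all)
    then show ?thesis by (simp add: S_def \<psi>_def)
  qed
  have carS: "carrier S = \<psi> ` words A" by (simp add: S_def)
  have fs: "is_finite_semigroup S"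
    unfolding is_finite_semigroup_def is_semigroup_def carS ball_simps
  proof (intro conjI ballI)
    show "\<psi> ` words A \<noteq> {}" using words_nonempty[OF A] by simp
    have "\<psi> ` words A = g ` \<phi> ` words A" by (auto simp: \<psi>_def)
    then show "finite (\<psi> ` words A)" using fin by simp
  qed (auto simp: mult words_append)
  have "S \<in> LSl"
    unfolding LSl_def Let_def
  proof (intro CollectI conjI allI impI ballI fs)
    fix e x
    assume e: "idempotent S e" and x: "x \<in> {e \<odot>\<^bsub>S\<^esub> s \<odot>\<^bsub>S\<^esub> e |s. s \<in> carrier S}"
    obtain w where w: "w \<in> words A" "e = \<psi> w" using e unfolding idempotent_def carS by blast
    have "\<psi> (w @ w) = \<psi> w" using e mult[OF w(1,1)] unfolding idempotent_def w(2) by simp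
    then have ww: "\<phi> w = \<phi> (w @ w)" using \<psi>_eq[OF words_append[OF w(1,1)] w(1)] by simp
    have sand: "\<exists>v\<in>words A. y = \<psi> (w @ v @ w)" if y: "y \<in> {e \<odot>\<^bsub>S\<^esub> s \<odot>\<^bsub>S\<^esub> e |s. s \<in> carrier S}" for y
    proof -
      obtain v where v: "v \<in> words A" "y = \<psi> w \<odot>\<^bsub>S\<^esub> \<psi> v \<odot>\<^bsub>S\<^esub> \<psi> w" using y unfolding carS w(2) by blast
      have "y = \<psi> (w @ v @ w)"
        using mult[OF w(1) v(1)] mult[OF words_append[OF w(1) v(1)] w(1)] v(2) by simp
      then show ?thesis using v(1) by blast
    qed
    obtain v where v: "v \<in> words A" "x = \<psi> (w @ v @ w)" using sand[OF x] by blast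
    have wvw: "w @ u @ w \<in> words A" if "u \<in> words A" for u using that w(1) by (simp add: words_append)
    show "x \<odot>\<^bsub>S\<^esub> x = x"
      using mult[OF wvw[OF v(1)] wvw[OF v(1)]] lsl[OF w(1) v(1) v(1) ww] v(2) by (simp add: \<psi>_def)
    fix y assume "y \<in> {e \<odot>\<^bsub>S\<^esub> s \<odot>\<^bsub>S\<^esub> e |s. s \<in> carrier S}"
    then obtain v' where v': "v' \<in> words A" "y = \<psi> (w @ v' @ w)" using sand by blast
    show "x \<odot>\<^bsub>S\<^esub> y = y \<odot>\<^bsub>S\<^esub> x"
      using mult[OF wvw[OF v(1)] wvw[OF v'(1)]] mult[OF wvw[OF v'(1)] wvw[OF v(1)]]
        lsl[OF w(1) v(1) v'(1) ww] v(2) v'(2) by (simp add: \<psi>_def)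
  qed
  moreover have "\<psi> \<in> sg_hom (free_sg A) S"
    unfolding sg_hom_def by (auto simp: mult carS)
  ultimately have "(S, \<psi>) \<in> quotients LSl A" by (simp add: quotients_def carS)
  then show ?thesis using \<psi>_eq by (intro bexI[of _ "(S, \<psi>)"]) simp_all
qed

section \<open>Factors seen through a window of length \<open>k\<close>\<close>

definition short_factors :: "nat \<Rightarrow> 'a list \<Rightarrow> 'a list set" where
  "short_factors k w = {u. u \<noteq> [] \<and> length u \<le> k \<and> sublist u w}"

definition suf :: "nat \<Rightarrow> 'a list \<Rightarrow> 'a list" where
  "suf k w = rev (take k (rev w))"

lemma take_append_take: "take k (u @ v) = take k (take k u @ take k v)"
  by (cases "k \<le> length u") (simp_all add: min_def)

lemma suf_append_suf: "suf k (u @ v) = suf k (suf k u @ suf k v)"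
  unfolding suf_def using take_append_take[of k "rev v" "rev u"] by simp

lemma suf_suffix: "suffix (suf k w) w"
  unfolding suf_def by (simp add: suffix_to_prefix take_is_prefix)

lemma suffix_suf: "suffix x w \<Longrightarrow> length x \<le> k \<Longrightarrow> suffix x (suf k w)"
  unfolding suf_def suffix_to_prefix by (auto simp: prefix_def)

lemma suf_append: "k \<le> length w \<Longrightarrow> suf k (v @ w) = suf k w"
  by (simp add: suf_def)

text \<open>A short factor of the product that lies in neither word straddles the boundary and sees
  at most \<open>k\<close> letters on each side. Together with the prefix and suffix of length
  \<open>k\<close>, the set of short factors therefore determines a congruence.\<close>

lemma short_factors_append:
  "short_factors k (u @ v) = short_factors k u \<union> short_factors k v \<union> short_factors k (suf k u @ take k v)"
proof (intro equalityI subsetI)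
  fix x assume x: "x \<in> short_factors k (u @ v)"
  then have "sublist x (u @ v)" by (simp add: short_factors_def)
  then consider "sublist x u" | "sublist x v"
    | y z where "x = y @ z" "suffix y u" "prefix z v"
    unfolding sublist_append by blast
  then show "x \<in> short_factors k u \<union> short_factors k v \<union> short_factors k (suf k u @ take k v)"
  proof cases
    case (3 y z)
    have len: "length y \<le> k" "length z \<le> k" using x 3(1) by (simp_all add: short_factors_def)
    have "suffix y (suf k u)" using suffix_suf 3(2) len(1) by blast
    moreover have "prefix z (take k v)"
      using 3(3) len(2) by (auto simp: prefix_def)
    ultimately have "sublist x (suf k u @ take k v)" using 3(1) unfolding sublist_append by blast
    then show ?thesis using x by (simp add: short_factors_def)
  qed (use x in \<open>simp_all add: short_factors_def\<close>)
next
  fix x assume "x \<in> short_factors k u \<union> short_factors k v \<union> short_factors k (suf k u @ take k v)"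
  moreover have "sublist (suf k u @ take k v) (u @ v)"
  proof -
    obtain a where "u = a @ suf k u" using suf_suffix[of k u] unfolding suffix_def by blast
    then have "u @ v = a @ (suf k u @ take k v) @ drop k v" by simp
    then show ?thesis unfolding sublist_def by blast
  qed
  ultimately show "x \<in> short_factors k (u @ v)"
    unfolding short_factors_def by (auto intro: sublist_order.order.trans)
qed

text \<open>Words with idempotent value are at least \<open>k\<close> long, so in a product of words
  \<open>w @ v @ w\<close> the outer prefix and suffix are fixed and the inner boundaries create no
  new short factor. Only the union of the factor sets remains, and union is idempotent and
  commutative.\<close>

lemma locally_testable_quotient:
  assumes A: "finite A" "A \<noteq> {}"
  shows "\<exists>q\<in>quotients LSl A. \<forall>u\<in>words A. \<forall>v\<in>words A. snd q u = snd q v \<longrightarrow> short_factors k u = short_factors k v"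
proof -
  define \<phi> where "\<phi> w = (take k w, suf k w, short_factors k w)" for w :: "'a list"
  have fq: "fin_quot A \<phi>"
  proof
    let ?B = "{u. set u \<subseteq> A \<and> length u \<le> k}"
    have B: "finite ?B" using finite_lists_length_le[OF A(1)] .
    have "\<phi> ` words A \<subseteq> ?B \<times> ?B \<times> Pow ?B"
    proof
      fix y assume "y \<in> \<phi> ` words A"
      then obtain w where w: "w \<in> words A" "y = \<phi> w" by blast
      have "set w \<subseteq> A" using w(1) by (auto simp: words_iff)
      then have "set (take k w) \<subseteq> A" "set (suf k w) \<subseteq> A"
        using set_take_subset[of k w] set_take_subset[of k "rev w"] by (auto simp: suf_def)
      moreover have "short_factors k w \<subseteq> ?B"
        using set_mono_sublist \<open>set w \<subseteq> A\<close> unfolding short_factors_def by blast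
      ultimately show "y \<in> ?B \<times> ?B \<times> Pow ?B" by (simp add: w(2) \<phi>_def suf_def)
    qed
    then show "finite (\<phi> ` words A)" by (rule finite_subset) (simp add: B)
  next
    fix u u' v v' assume "\<phi> u = \<phi> u'" "\<phi> v = \<phi> v'"
    then have "take k u = take k u'" "suf k u = suf k u'" "short_factors k u = short_factors k u'"
      "take k v = take k v'" "suf k v = suf k v'" "short_factors k v = short_factors k v'"
      by (simp_all add: \<phi>_def)
    then show "\<phi> (u @ v) = \<phi> (u' @ v')"
      using take_append_take[of k u v] take_append_take[of k u' v'] suf_append_suf[of k u v]
        suf_append_suf[of k u' v'] short_factors_append[of k u v] short_factors_append[of k u' v']
      by (simp add: \<phi>_def)
  qed
  have key: "\<phi> ((w @ v @ w) @ (w @ v' @ w)) =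
      (take k w, suf k w, short_factors k (w @ v @ w) \<union> short_factors k (w @ v' @ w))"
    and key': "\<phi> (w @ v @ w) = (take k w, suf k w, short_factors k (w @ v @ w))"
    if "w \<in> words A" "\<phi> w = \<phi> (w @ w)" for w v v'
  proof -
    \<comment> \<open>Comparing lengths forces \<open>k \<le> length w\<close>: doubling a nonempty
      word shorter than \<open>k\<close> would lengthen its truncated prefix.\<close>
    have "take k w = take k (w @ w)" using that(2) unfolding \<phi>_def prod.inject by (rule conjunct1)
    then have "length (take k w) = length (take k (w @ w))" by (rule arg_cong)
    then have "min k (length w) = min k (length w + length w)" by (simp only: length_take length_append min.commute)
    moreover have "w \<noteq> []" using that(1) by (simp add: words_iff)
    ultimately have k: "k \<le> length w" by (cases w) (auto simp: min_def split: if_splits)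
    have F: "short_factors k w = short_factors k (w @ w)" using that(2) by (simp add: \<phi>_def)
    \<comment> \<open>What straddles the boundary of \<open>w @ w\<close> already occurs in
      \<open>w\<close>, since both have the same short factors.\<close>
    have "short_factors k (suf k w @ take k w) \<subseteq> short_factors k w"
      using F short_factors_append[of k w w] by blast
    moreover have "short_factors k w \<subseteq> short_factors k (w @ v @ w)"
      using short_factors_append[of k w "v @ w"] by blast
    ultimately have "short_factors k ((w @ v @ w) @ (w @ v' @ w)) =
        short_factors k (w @ v @ w) \<union> short_factors k (w @ v' @ w)"
      using short_factors_append[of k "w @ v @ w" "w @ v' @ w"] suf_append[OF k, of "w @ v"] k by auto
    moreover have "suf k ((w @ v @ w) @ (w @ v' @ w)) = suf k w" "suf k (w @ v @ w) = suf k w"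
      using suf_append[OF k, of "(w @ v @ w) @ (w @ v')"] suf_append[OF k, of "w @ v"] by simp_all
    ultimately show "\<phi> ((w @ v @ w) @ (w @ v' @ w)) =
        (take k w, suf k w, short_factors k (w @ v @ w) \<union> short_factors k (w @ v' @ w))"
      "\<phi> (w @ v @ w) = (take k w, suf k w, short_factors k (w @ v @ w))"
      using k by (simp_all add: \<phi>_def)
  qed
  have "\<exists>q\<in>quotients LSl A. \<forall>u\<in>words A. \<forall>v\<in>words A. snd q u = snd q v \<longrightarrow> \<phi> u = \<phi> v"
  proof (rule finite_quot_in_LSl[OF fq A(2)])
    fix w v v' assume "w \<in> words A" "\<phi> w = \<phi> (w @ w)"
    note k = key[OF this] key'[OF this]
    show "\<phi> ((w @ v @ w) @ (w @ v @ w)) = \<phi> (w @ v @ w) \<and>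
      \<phi> ((w @ v @ w) @ (w @ v' @ w)) = \<phi> ((w @ v' @ w) @ (w @ v @ w))"
      unfolding k by (simp add: Un_commute)
  qed
  then obtain q where q: "q\<in>quotients LSl A" "\<And>u v. u \<in> words A \<Longrightarrow> v \<in> words A \<Longrightarrow> snd q u = snd q v \<Longrightarrow> \<phi> u = \<phi> v"
    by blast
  show ?thesis
  proof (intro bexI[OF _ q(1)] ballI impI)
    fix u v assume "u \<in> words A" "v \<in> words A" "snd q u = snd q v"
    from q(2)[OF this] show "short_factors k u = short_factors k v" by (simp add: \<phi>_def)
  qed
qed

lemma quotients_mono: "V \<subseteq> W \<Longrightarrow> quotients V A \<subseteq> quotients W A"
  by (auto simp: quotients_def)

section \<open>Ideals of semigroups\<close>

lemma principal_ideal_closed: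
  assumes S: "is_semigroup S" and y: "y \<in> carrier S" and z: "z \<in> principal_ideal S y" and s: "s \<in> carrier S"
  shows "s \<odot>\<^bsub>S\<^esub> z \<in> principal_ideal S y" "z \<odot>\<^bsub>S\<^esub> s \<in> principal_ideal S y"
proof -
  have cl: "a \<odot>\<^bsub>S\<^esub> b \<in> carrier S" if "a \<in> carrier S" "b \<in> carrier S" for a b
    using S that unfolding is_semigroup_def by blast
  have as: "(a \<odot>\<^bsub>S\<^esub> b) \<odot>\<^bsub>S\<^esub> c = a \<odot>\<^bsub>S\<^esub> (b \<odot>\<^bsub>S\<^esub> c)"
    if "a \<in> carrier S" "b \<in> carrier S" "c \<in> carrier S" for a b c
    using S that unfolding is_semigroup_def by blast
  consider "z = y" | a where "a \<in> carrier S" "z = a \<odot>\<^bsub>S\<^esub> y" | b where "b \<in> carrier S" "z = y \<odot>\<^bsub>S\<^esub> b"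
    | a b where "a \<in> carrier S" "b \<in> carrier S" "z = a \<odot>\<^bsub>S\<^esub> y \<odot>\<^bsub>S\<^esub> b"
    using z unfolding principal_ideal_def by blast
  note cases = this
  show "s \<odot>\<^bsub>S\<^esub> z \<in> principal_ideal S y"
  proof (cases rule: cases)
    case 1
    then show ?thesis using s unfolding principal_ideal_def by blast
  next
    case (2 a)
    then have "s \<odot>\<^bsub>S\<^esub> z = (s \<odot>\<^bsub>S\<^esub> a) \<odot>\<^bsub>S\<^esub> y" using as s y by simp
    then show ?thesis using cl[OF s 2(1)] unfolding principal_ideal_def by blast
  next
    case (3 b)
    then have "s \<odot>\<^bsub>S\<^esub> z = s \<odot>\<^bsub>S\<^esub> y \<odot>\<^bsub>S\<^esub> b" using as s y by simp
    then show ?thesis using s 3(1) unfolding principal_ideal_def by blast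
  next
    case (4 a b)
    then have "s \<odot>\<^bsub>S\<^esub> z = (s \<odot>\<^bsub>S\<^esub> a) \<odot>\<^bsub>S\<^esub> y \<odot>\<^bsub>S\<^esub> b" using as s y cl by simp
    then show ?thesis using cl[OF s 4(1)] 4(2) unfolding principal_ideal_def by blast
  qed
  show "z \<odot>\<^bsub>S\<^esub> s \<in> principal_ideal S y"
  proof (cases rule: cases)
    case 1
    then show ?thesis using s unfolding principal_ideal_def by blast
  next
    case (2 a)
    then show ?thesis using s unfolding principal_ideal_def by blast
  next
    case (3 b)
    then have "z \<odot>\<^bsub>S\<^esub> s = y \<odot>\<^bsub>S\<^esub> (b \<odot>\<^bsub>S\<^esub> s)" using as s y by simp
    then show ?thesis using cl[OF 3(1) s] unfolding principal_ideal_def by blast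
  next
    case (4 a b)
    then have "z \<odot>\<^bsub>S\<^esub> s = a \<odot>\<^bsub>S\<^esub> y \<odot>\<^bsub>S\<^esub> (b \<odot>\<^bsub>S\<^esub> s)" using as s y cl by simp
    then show ?thesis using cl[OF 4(2) s] 4(1) unfolding principal_ideal_def by blast
  qed
qed

lemma principal_ideal_self: "x \<in> principal_ideal S x"
  by (simp add: principal_ideal_def)

lemma principal_ideal_mono:
  assumes S: "is_semigroup S" and y: "y \<in> carrier S" and x: "x \<in> principal_ideal S y"
  shows "principal_ideal S x \<subseteq> principal_ideal S y"
proof
  note cl = principal_ideal_closed[OF S y]
  fix z assume "z \<in> principal_ideal S x"
  then consider "z = x" | a where "a \<in> carrier S" "z = a \<odot>\<^bsub>S\<^esub> x" | b where "b \<in> carrier S" "z = x \<odot>\<^bsub>S\<^esub> b"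
    | a b where "a \<in> carrier S" "b \<in> carrier S" "z = a \<odot>\<^bsub>S\<^esub> x \<odot>\<^bsub>S\<^esub> b"
    unfolding principal_ideal_def by blast
  then show "z \<in> principal_ideal S y"
    by cases (simp_all add: x cl)
qed

lemma principal_ideal_sandwich:
  "s \<in> carrier S \<Longrightarrow> t \<in> carrier S \<Longrightarrow> s \<odot>\<^bsub>S\<^esub> x \<odot>\<^bsub>S\<^esub> t \<in> principal_ideal S x"
  unfolding principal_ideal_def by blast

lemma green_J_equiv: "equiv (carrier S) (green_J S)"
  unfolding equiv_def refl_on_def sym_def trans_def green_J_def by auto


section \<open>The J-class and the V-image of a directive sequence\<close>

lemma (in pseudovar) pro_semigroup:
  assumes A: "A \<noteq> {}"
  shows "is_semigroup (free_pro V A)"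
  unfolding is_semigroup_def
proof (intro conjI ballI)
  obtain a where "a \<in> A" using A by blast
  then have "word_emb V A [a] \<in> F A" by (intro word_emb_in) (simp add: words_single)
  then show "F A \<noteq> {}" by blast
next
  fix x y assume xy: "x \<in> F A" "y \<in> F A"
  then show "x \<odot>\<^bsub>free_pro V A\<^esub> y \<in> F A" by (rule pro_closed[OF A])
  fix z assume z: "z \<in> F A"
  show "x \<odot>\<^bsub>free_pro V A\<^esub> y \<odot>\<^bsub>free_pro V A\<^esub> z = x \<odot>\<^bsub>free_pro V A\<^esub> (y \<odot>\<^bsub>free_pro V A\<^esub> z)"
  proof (rule pro_eqI)
    fix q assume q: "q \<in> quotients V A"
    then have "is_semigroup (fst q)" using V_finite[OF quot_V[OF q]] by (simp add: is_finite_semigroup_def)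
    then show "(x \<odot>\<^bsub>free_pro V A\<^esub> y \<odot>\<^bsub>free_pro V A\<^esub> z) q = (x \<odot>\<^bsub>free_pro V A\<^esub> (y \<odot>\<^bsub>free_pro V A\<^esub> z)) q"
      using pro_in[OF xy(1) q] pro_in[OF xy(2) q] pro_in[OF z q]
      unfolding is_semigroup_def by (simp add: pro_mult[OF q])
  qed (simp_all add: pro_closed[OF A] xy z)
qed

locale pv_directive = pseudovar V + primitive_directive A \<sigma>
  for V :: "nat semigrp set" and A :: "nat \<Rightarrow> 'a set" and \<sigma> +
  assumes LSl: "LSl \<subseteq> V"
begin

abbreviation Q :: "'a quot set" where
  "Q \<equiv> quotients V (A 0)"

abbreviation M :: "('a quot \<Rightarrow> nat) semigrp" where
  "M \<equiv> free_pro V (A 0)"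

abbreviation core :: "'a quot \<Rightarrow> 'a list \<Rightarrow> bool" where
  "core q \<equiv> lang_quot.core A \<sigma> (snd q)"

abbreviation ImV :: "('a quot \<Rightarrow> nat) set" where
  "ImV \<equiv> V_image V A \<sigma>"

lemma M_semigroup: "is_semigroup M"
  by (rule pro_semigroup[OF A_nonempty])

lemma quot_lang: "q \<in> Q \<Longrightarrow> lang_quot A \<sigma> (snd q)"
  unfolding lang_quot_def by (intro conjI primitive_directive_axioms quot_fin_quot)

lemma M_closed: "x \<in> F (A 0) \<Longrightarrow> y \<in> F (A 0) \<Longrightarrow> x \<odot>\<^bsub>M\<^esub> y \<in> F (A 0)"
  by (rule pro_closed[OF A_nonempty])

section \<open>The J-class described by its finite values\<close>

definition J :: "('a quot \<Rightarrow> nat) set" where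
  "J = {x \<in> F (A 0). \<forall>q\<in>Q. \<exists>w\<in>words (A 0). x q = snd q w \<and> core q w}"

lemma J_core:
  assumes "x \<in> J" "q \<in> Q" "w \<in> words (A 0)" "x q = snd q w"
  shows "core q w"
proof -
  obtain v where "v \<in> words (A 0)" "x q = snd q v" "core q v" using assms(1,2) unfolding J_def by blast
  then show ?thesis using lang_quot.core_eq[OF quot_lang[OF assms(2)], of v w] assms(3,4) by simp
qed

text \<open>Contexts \<open>r\<close> and \<open>t\<close> exist in each quotient, and compactness
  joins them to elements \<open>s\<close> and \<open>s'\<close>. Both take their value at
  \<open>q\<close> from the same finer \<open>p\<close>, whose factorisation descends to
  \<open>q\<close>.\<close>

lemma J_factorisation:
  assumes x: "x \<in> J" and y: "y \<in> J"
  shows "\<exists>s\<in>F (A 0). \<exists>t\<in>F (A 0). x = s \<odot>\<^bsub>M\<^esub> y \<odot>\<^bsub>M\<^esub> t"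
proof -
  have xy: "x \<in> F (A 0)" "y \<in> F (A 0)" using x y unfolding J_def by blast+
  have "\<exists>w r t. w \<in> words (A 0) \<and> r \<in> words (A 0) \<and> t \<in> words (A 0) \<and> y q = snd q w \<and> x q = snd q (r @ w @ t)"
    if q: "q \<in> Q" for q
  proof -
    obtain u where u: "u \<in> words (A 0)" "x q = snd q u" using pro_word[OF xy(1) q] by blast
    obtain w where w: "w \<in> words (A 0)" "y q = snd q w" using pro_word[OF xy(2) q] by blast
    obtain r t where "r \<in> words (A 0)" "t \<in> words (A 0)" "snd q u = snd q (r @ w @ t)"
      using lang_quot.core_below_strict[OF quot_lang[OF q] J_core[OF x q u] J_core[OF y q w] u(1) w(1)] by blast
    then show ?thesis using u w by (intro exI[of _ w] exI[of _ r] exI[of _ t]) simp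
  qed
  then obtain w r t where wrt: "\<And>q. q \<in> Q \<Longrightarrow> w q \<in> words (A 0) \<and> r q \<in> words (A 0) \<and> t q \<in> words (A 0) \<and>
      y q = snd q (w q) \<and> x q = snd q (r q @ w q @ t q)"
    by metis
  have rt: "\<And>q. q \<in> Q \<Longrightarrow> r q \<in> words (A 0)" "\<And>q. q \<in> Q \<Longrightarrow> t q \<in> words (A 0)" using wrt by blast+
  obtain s s' where s: "s \<in> F (A 0)" "s' \<in> F (A 0)"
    and lim: "\<And>q. q \<in> Q \<Longrightarrow> \<exists>p\<in>Q. finer (A 0) p q \<and> s q = snd q (r p) \<and> s' q = snd q (t p)"
    using compactness2[of "A 0" r t, OF A_nonempty rt] by blast
  have "x = s \<odot>\<^bsub>M\<^esub> y \<odot>\<^bsub>M\<^esub> s'"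
  proof (rule pro_eqI[OF xy(1)])
    show "s \<odot>\<^bsub>M\<^esub> y \<odot>\<^bsub>M\<^esub> s' \<in> F (A 0)" by (simp add: M_closed s xy)
    fix q assume q: "q \<in> Q"
    obtain p where p: "p \<in> Q" "finer (A 0) p q" "s q = snd q (r p)" "s' q = snd q (t p)" using lim[OF q] by blast
    have w: "w p \<in> words (A 0)" "r p \<in> words (A 0)" "t p \<in> words (A 0)" using wrt[OF p(1)] by blast+
    have "y q = snd q (w p)" using pro_finer[OF xy(2) p(1) q p(2)] wrt[OF p(1)] by blast
    moreover have "x q = snd q (r p @ w p @ t p)"
      using pro_finer[OF xy(1) p(1) q p(2) words_append[OF w(2) words_append[OF w(1,3)]]] wrt[OF p(1)] by simp
    ultimately show "x q = (s \<odot>\<^bsub>M\<^esub> y \<odot>\<^bsub>M\<^esub> s') q"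
      using w p(3,4) by (simp add: pro_mult[OF q] quot_hom[OF q, symmetric] words_append)
  qed
  then show ?thesis using s by blast
qed

lemma J_principal_ideal:
  assumes "x \<in> J" "y \<in> J"
  shows "principal_ideal M x = principal_ideal M y"
proof -
  have *: "principal_ideal M x \<subseteq> principal_ideal M y" if x: "x \<in> J" and y: "y \<in> J" for x y
  proof (rule principal_ideal_mono[OF M_semigroup])
    show "y \<in> F (A 0)" using y unfolding J_def by blast
    obtain s t where "s \<in> F (A 0)" "t \<in> F (A 0)" "x = s \<odot>\<^bsub>M\<^esub> y \<odot>\<^bsub>M\<^esub> t" using J_factorisation[OF x y] by blast
    then show "x \<in> principal_ideal M y" by (simp add: principal_ideal_sandwich)
  qed
  show ?thesis using *[OF assms] *[OF assms(2,1)] by (rule equalityI)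
qed

lemma principal_ideal_below:
  assumes "x \<in> principal_ideal M y" "y \<in> F (A 0)" "q \<in> Q"
    "u \<in> words (A 0)" "x q = snd q u" "v \<in> words (A 0)" "y q = snd q v"
  shows "fin_quot.below (A 0) (snd q) u v"
proof -
  interpret fin_quot "A 0" "snd q" by (rule quot_fin_quot[OF assms(3)])
  have lift: "\<exists>w\<in>words (A 0). a q = snd q w" if "a \<in> carrier M" for a using pro_word[OF that assms(3)] .
  have mult: "snd q a \<odot>\<^bsub>fst q\<^esub> snd q b = snd q (a @ b)" if "a \<in> words (A 0)" "b \<in> words (A 0)" for a b
    using quot_hom[OF assms(3) that] by simp
  consider "x = y" | a where "a \<in> carrier M" "x = a \<odot>\<^bsub>M\<^esub> y" | b where "b \<in> carrier M" "x = y \<odot>\<^bsub>M\<^esub> b"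
    | a b where "a \<in> carrier M" "b \<in> carrier M" "x = a \<odot>\<^bsub>M\<^esub> y \<odot>\<^bsub>M\<^esub> b"
    using assms(1) unfolding principal_ideal_def by blast
  then show ?thesis
  proof cases
    case 1
    then show ?thesis using assms by (intro below_eq) simp
  next
    case (2 a)
    obtain r where r: "r \<in> words (A 0)" "a q = snd q r" using lift[OF 2(1)] by blast
    have "snd q u = snd q (r @ v @ [])"
      unfolding assms(5)[symmetric] 2(2) pro_mult[OF assms(3)] r(2) assms(7) mult[OF r(1) assms(6)] by simp
    then show ?thesis by (rule belowI) (simp_all add: r(1) words_lists)
  next
    case (3 b)
    obtain t where t: "t \<in> words (A 0)" "b q = snd q t" using lift[OF 3(1)] by blast
    have "snd q u = snd q ([] @ v @ t)"
      unfolding assms(5)[symmetric] 3(2) pro_mult[OF assms(3)] t(2) assms(7) mult[OF assms(6) t(1)] by simp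
    then show ?thesis by (rule belowI) (simp_all add: t(1) words_lists)
  next
    case (4 a b)
    obtain r where r: "r \<in> words (A 0)" "a q = snd q r" using lift[OF 4(1)] by blast
    obtain t where t: "t \<in> words (A 0)" "b q = snd q t" using lift[OF 4(2)] by blast
    have "snd q u = snd q (r @ v @ t)"
      unfolding assms(5)[symmetric] 4(3) pro_mult[OF assms(3)] r(2) t(2) assms(7) mult[OF r(1) assms(6)]
        mult[OF words_append[OF r(1) assms(6)] t(1)] by simp
    then show ?thesis by (rule belowI) (simp_all add: r(1) t(1) words_lists)
  qed
qed

lemma J_principal_ideal_closed:
  assumes x: "x \<in> F (A 0)" and y: "y \<in> J" and eq: "principal_ideal M x = principal_ideal M y"
  shows "x \<in> J"
proof -
  have yF: "y \<in> F (A 0)" using y unfolding J_def by blast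
  have xy: "x \<in> principal_ideal M y" "y \<in> principal_ideal M x" using principal_ideal_self[of x M] principal_ideal_self[of y M] eq by simp_all
  have "\<exists>w\<in>words (A 0). x q = snd q w \<and> core q w" if q: "q \<in> Q" for q
  proof -
    obtain u where u: "u \<in> words (A 0)" "x q = snd q u" using pro_word[OF x q] by blast
    obtain w where w: "w \<in> words (A 0)" "y q = snd q w" using pro_word[OF yF q] by blast
    have "core q u"
      by (rule lang_quot.core_equiv[OF quot_lang[OF q] J_core[OF y q w]])
        (use principal_ideal_below[OF xy(1) yF q u w] principal_ideal_below[OF xy(2) x q w u] u w in simp_all)
    then show ?thesis using u by blast
  qed
  then show ?thesis using x unfolding J_def by blast
qed

lemma J_F: "x \<in> J \<Longrightarrow> x \<in> F (A 0)"
  unfolding J_def by blast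

lemma J_green:
  assumes y: "y \<in> J"
  shows "green_J M `` {y} = J"
proof (intro equalityI subsetI)
  fix x assume "x \<in> green_J M `` {y}"
  then have "x \<in> F (A 0)" "principal_ideal M x = principal_ideal M y" by (simp_all add: green_J_def)
  then show "x \<in> J" by (rule J_principal_ideal_closed[OF _ y])
next
  fix x assume x: "x \<in> J"
  then show "x \<in> green_J M `` {y}"
    using J_principal_ideal[OF y x] J_F[OF x] J_F[OF y] by (simp add: green_J_def)
qed

text \<open>Being idempotent and lying in the class both pass to coarser quotients, so a limit of
  words idempotent in single quotients is an idempotent of \<open>J\<close>.\<close>

lemma J_idempotent: "\<exists>e\<in>J. idempotent M e"
proof -
  have "\<exists>w. w \<in> words (A 0) \<and> core q w \<and> snd q w = snd q (w @ w)" if "q \<in> Q" for q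
    using lang_quot.core_idempotent[OF quot_lang[OF that]] by blast
  then obtain w where w: "\<And>q. q \<in> Q \<Longrightarrow> w q \<in> words (A 0) \<and> core q (w q) \<and> snd q (w q) = snd q (w q @ w q)"
    by metis
  then have wA: "\<And>q. q \<in> Q \<Longrightarrow> w q \<in> words (A 0)" by blast
  obtain e where e: "e \<in> F (A 0)" and lim: "\<And>q. q \<in> Q \<Longrightarrow> \<exists>p\<in>Q. finer (A 0) p q \<and> e q = snd q (w p)"
    using compactness[of "A 0" w, OF A_nonempty wA] by blast
  have q: "\<exists>v\<in>words (A 0). e q = snd q v \<and> core q v \<and> snd q v = snd q (v @ v)" if qQ: "q \<in> Q" for q
  proof -
    obtain p where p: "p \<in> Q" "finer (A 0) p q" "e q = snd q (w p)" using lim[OF qQ] by blast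
    note wp = w[OF p(1)]
    have "core q (w p)"
    proof (rule core_coarser[OF quot_lang[OF p(1)] quot_lang[OF qQ]])
      fix u v assume "u \<in> words (A 0)" "v \<in> words (A 0)" "snd p u = snd p v"
      then show "snd q u = snd q v" using finerD[OF p(2)] by blast
    qed (use wp in simp_all)
    moreover have "snd q (w p) = snd q (w p @ w p)"
      using finerD[OF p(2), of "w p" "w p @ w p"] wp by (simp add: words_append)
    ultimately show ?thesis using p(3) wp by blast
  qed
  have "e \<odot>\<^bsub>M\<^esub> e = e"
  proof (rule pro_eqI[OF M_closed[OF e e] e])
    fix r assume r: "r \<in> Q"
    from q[OF r] obtain v where v: "v \<in> words (A 0)" "e r = snd r v" "snd r v = snd r (v @ v)" by blast
    show "(e \<odot>\<^bsub>M\<^esub> e) r = e r"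
      unfolding pro_mult[OF r] v(2) quot_hom[OF r v(1,1), symmetric] v(3)[symmetric] ..
  qed
  moreover have "e \<in> J" using e q unfolding J_def by blast
  ultimately show ?thesis using e unfolding idempotent_def by blast
qed

subsection \<open>Limits of long words of the language\<close>

lemma closure_L_iff:
  "x \<in> free_pro_top V (A 0) closure_of (word_emb V (A 0) ` L) \<longleftrightarrow>
    x \<in> F (A 0) \<and> (\<forall>q\<in>Q. \<exists>w\<in>L. x q = snd q w)"
  by (rule closure_of_words[OF A_nonempty]) (use L_words in blast)

text \<open>Only finitely many words are shorter than \<open>N\<close>, and each one in the language
  is separated from \<open>x\<close> by some quotient. In a common refinement of these with
  \<open>q\<close>, a word of the language with the value of \<open>x\<close> cannot be
  short.\<close>

lemma closure_L_long:
  assumes x: "x \<in> free_pro_top V (A 0) closure_of (word_emb V (A 0) ` L)" "x \<notin> word_emb V (A 0) ` L"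
    and q: "q \<in> Q"
  shows "\<exists>w\<in>L. N \<le> length w \<and> x q = snd q w"
proof (rule ccontr)
  assume neg: "\<not> ?thesis"
  have xF: "x \<in> F (A 0)" and cl: "\<And>p. p \<in> Q \<Longrightarrow> \<exists>w\<in>L. x p = snd p w" using x(1) unfolding closure_L_iff by blast+
  define B where "B = {w \<in> L. length w < N}"
  have "B \<subseteq> {w. set w \<subseteq> A 0 \<and> length w \<le> N}" using L_words unfolding B_def words_iff by auto
  then have finB: "finite B" using finite_lists_length_le[OF A_finite] finite_subset by blast
  have "\<exists>p. p \<in> Q \<and> x p \<noteq> snd p w" if "w \<in> B" for w
  proof (rule ccontr)
    assume "\<not> ?thesis"
    then have eq: "\<And>p. p \<in> Q \<Longrightarrow> x p = snd p w" by blast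
    have "w \<in> L" using that by (simp add: B_def)
    have "x = word_emb V (A 0) w"
      by (rule pro_eqI[OF xF word_emb_in[OF L_words[OF \<open>w \<in> L\<close>]]]) (simp add: eq word_emb_app)
    then show False using x(2) \<open>w \<in> L\<close> by blast
  qed
  then obtain p where p: "\<And>w. w \<in> B \<Longrightarrow> p w \<in> Q \<and> x (p w) \<noteq> snd (p w) w" by metis
  have "finite (insert q (p ` B))" "insert q (p ` B) \<subseteq> Q" using finB q p by auto
  from quot_finite_join[OF A_nonempty this]
  obtain r where r: "r \<in> Q" "finer (A 0) r q" "\<And>w. w \<in> B \<Longrightarrow> finer (A 0) r (p w)" by blast
  obtain w where w: "w \<in> L" "x r = snd r w" using cl[OF r(1)] by blast
  have "x q = snd q w" using pro_finer[OF xF r(1) q r(2) L_words[OF w(1)] w(2)] .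
  then have "w \<in> B" using neg w(1) unfolding B_def by auto
  then have "x (p w) = snd (p w) w"
    using pro_finer[OF xF r(1) _ r(3) L_words[OF w(1)] w(2)] p by blast
  then show False using p[OF \<open>w \<in> B\<close>] by blast
qed

lemma closure_L_J: "free_pro_top V (A 0) closure_of (word_emb V (A 0) ` L) - word_emb V (A 0) ` L \<subseteq> J"
proof
  fix x assume x: "x \<in> free_pro_top V (A 0) closure_of (word_emb V (A 0) ` L) - word_emb V (A 0) ` L"
  have "\<exists>w\<in>words (A 0). x q = snd q w \<and> core q w" if q: "q \<in> Q" for q
  proof -
    obtain N where N: "\<And>v. v \<in> L \<Longrightarrow> N \<le> length v \<Longrightarrow> core q v"
      using lang_quot.core_long[OF quot_lang[OF q]] by blast
    obtain w where "w \<in> L" "N \<le> length w" "x q = snd q w" using closure_L_long[of x q N] x q by blast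
    then show ?thesis using N L_words by blast
  qed
  moreover have "x \<in> F (A 0)" using x unfolding Diff_iff closure_L_iff by blast
  ultimately show "x \<in> J" unfolding J_def by blast
qed

text \<open>The hypothesis \<open>LSl \<subseteq> V\<close> enters here: the quotients of V can see
  all factors of any bounded length.\<close>

lemma testable: "\<exists>q\<in>Q. \<forall>u\<in>words (A 0). \<forall>v\<in>words (A 0). snd q u = snd q v \<longrightarrow> short_factors k u = short_factors k v"
proof -
  obtain q where q: "q \<in> quotients LSl (A 0)" and
    "\<forall>u\<in>words (A 0). \<forall>v\<in>words (A 0). snd q u = snd q v \<longrightarrow> short_factors k u = short_factors k v"
    using locally_testable_quotient[of "A 0" k, OF A_finite A_nonempty] by (elim bexE)
  moreover have "q \<in> Q" using q quotients_mono[OF LSl] by (rule rev_subsetD)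
  ultimately show ?thesis by (intro bexI)
qed

text \<open>The image at every level is closed, so membership is a condition on one level and one
  finite quotient at a time.\<close>

lemma Im_iff: "x \<in> ImV \<longleftrightarrow> x \<in> F (A 0) \<and> (\<forall>n. \<forall>q\<in>Q. \<exists>v\<in>words (A n). x q = snd q (ds_comp \<sigma> 0 n v))"
proof -
  have "x \<in> pro_ext V (A n) (A 0) (ds_comp \<sigma> 0 n) ` F (A n) \<longleftrightarrow>
      x \<in> F (A 0) \<and> (\<forall>q\<in>Q. \<exists>v\<in>words (A n). x q = snd q (ds_comp \<sigma> 0 n v))" for n
    by (rule pro_ext_image[OF A_nonempty A_nonempty ds_comp_hom]) simp
  then show ?thesis unfolding V_image_def INT_iff by simp
qed

lemma Im_F: "x \<in> ImV \<Longrightarrow> x \<in> F (A 0)"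
  unfolding Im_iff by blast

lemma Im_closed:
  assumes "x \<in> ImV" "y \<in> ImV"
  shows "x \<odot>\<^bsub>M\<^esub> y \<in> ImV"
  unfolding Im_iff
proof (intro conjI allI ballI)
  show "x \<odot>\<^bsub>M\<^esub> y \<in> F (A 0)" using assms Im_F M_closed by blast
  fix n q assume q: "q \<in> Q"
  obtain u where u: "u \<in> words (A n)" "x q = snd q (ds_comp \<sigma> 0 n u)" using assms(1) q unfolding Im_iff by blast
  obtain v where v: "v \<in> words (A n)" "y q = snd q (ds_comp \<sigma> 0 n v)" using assms(2) q unfolding Im_iff by blast
  have "(x \<odot>\<^bsub>M\<^esub> y) q = snd q (ds_comp \<sigma> 0 n (u @ v))"
    unfolding pro_mult[OF q] u(2) v(2) word_hom.hom_append[OF comp_word_hom[OF le0] u(1) v(1)]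
    by (rule quot_hom[OF q ds_comp_words[OF le0 u(1)] ds_comp_words[OF le0 v(1)], symmetric])
  then show "\<exists>w\<in>words (A n). (x \<odot>\<^bsub>M\<^esub> y) q = snd q (ds_comp \<sigma> 0 n w)"
    using words_append[OF u(1) v(1)] by blast
qed

text \<open>Images from level \<open>m\<close> are also images from every level
  \<open>n \<le> m\<close>, so an accumulation point along growing levels lies in all the
  images.\<close>

lemma Im_accumulation:
  assumes v: "\<And>n. v n \<in> words (A n)"
  shows "\<exists>x\<in>ImV. \<forall>q\<in>Q. \<forall>n. \<exists>m\<ge>n. x q = snd q (ds_comp \<sigma> 0 m (v m))"
proof -
  obtain x where x: "x \<in> F (A 0)" and acc: "\<And>q n. q \<in> Q \<Longrightarrow> \<exists>m\<ge>n. x q = snd q (ds_comp \<sigma> 0 m (v m))"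
    using accumulation_point[of "\<lambda>n. ds_comp \<sigma> 0 n (v n)" "A 0", OF ds_comp_words[OF le0 v]] by blast
  have "\<exists>u\<in>words (A n). x q = snd q (ds_comp \<sigma> 0 n u)" if q: "q \<in> Q" for n q
  proof -
    obtain m where m: "m \<ge> n" "x q = snd q (ds_comp \<sigma> 0 m (v m))" using acc[OF q] by blast
    then have "x q = snd q (ds_comp \<sigma> 0 n (ds_comp \<sigma> n m (v m)))" using ds_comp_app[of 0 n m] by simp
    then show ?thesis using ds_comp_words[OF m(1) v] by blast
  qed
  then have "x \<in> ImV" using x unfolding Im_iff by blast
  then show ?thesis using acc by blast
qed

text \<open>Images of single letters accumulate at a point of the closure, and their lengths tend to
  infinity, so the point is no word of the language. It shows both that the V-image meets the
  J-class and that the set used to identify this class is nonempty.\<close>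

lemma Im_closure_L:
  "\<exists>x\<in>ImV. x \<in> free_pro_top V (A 0) closure_of (word_emb V (A 0) ` L) - word_emb V (A 0) ` L"
proof -
  define a where "a n = (SOME a. a \<in> A n)" for n
  have a: "a n \<in> A n" for n unfolding a_def some_in_eq by (rule A_nonempty)
  then have "[a n] \<in> words (A n)" for n by (simp add: words_single)
  from Im_accumulation[of "\<lambda>n. [a n]", OF this]
  obtain x where x: "x \<in> ImV" and "\<forall>q\<in>Q. \<forall>n. \<exists>m\<ge>n. x q = snd q (ds_comp \<sigma> 0 m [a m])" by (elim bexE)
  note acc = this(2)[THEN bspec, THEN spec]
  have "x \<in> free_pro_top V (A 0) closure_of (word_emb V (A 0) ` L)"
    unfolding closure_L_iff
  proof (intro conjI ballI Im_F[OF x])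
    fix q assume "q \<in> Q"
    from acc[OF this, of 0] obtain m where "x q = snd q (ds_comp \<sigma> 0 m [a m])" by blast
    then show "\<exists>w\<in>L. x q = snd q w" using image_letter_L[OF a] by (intro bexI)
  qed
  moreover have "x \<notin> word_emb V (A 0) ` L"
  proof
    assume "x \<in> word_emb V (A 0) ` L"
    then obtain u where u: "u \<in> L" "x = word_emb V (A 0) u" by blast
    \<comment> \<open>With a window one letter longer than \<open>u\<close>, any word of at least
      that length is told apart from \<open>u\<close>.\<close>
    obtain q where q: "q \<in> Q" and "\<forall>w\<in>words (A 0). \<forall>w'\<in>words (A 0). snd q w = snd q w'
        \<longrightarrow> short_factors (Suc (length u)) w = short_factors (Suc (length u)) w'"
      using testable[of "Suc (length u)"] by (elim bexE)
    note test = this(2)[rule_format]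
    obtain N where "\<forall>n\<ge>N. \<forall>v\<in>words (A n). Suc (length u) \<le> length (ds_comp \<sigma> 0 n v)"
      using image_length_at_top[of "Suc (length u)"] by (elim exE)
    note N = this[rule_format]
    obtain m where m: "m \<ge> N" "x q = snd q (ds_comp \<sigma> 0 m [a m])" using acc[OF q, of N] by blast
    let ?w = "ds_comp \<sigma> 0 m [a m]"
    have len: "Suc (length u) \<le> length ?w" using N[OF m(1)] a by (simp add: words_single)
    have "snd q u = snd q ?w" using m(2) unfolding u(2) word_emb_app[OF q] .
    then have eq: "short_factors (Suc (length u)) u = short_factors (Suc (length u)) ?w"
      by (rule test[OF L_words[OF u(1)] L_words[OF image_letter_L[OF a]]])
    have "take (Suc (length u)) ?w \<in> short_factors (Suc (length u)) ?w"
      using len by (simp add: short_factors_def sublist_take) (cases ?w, simp_all)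
    then have "take (Suc (length u)) ?w \<in> short_factors (Suc (length u)) u" by (simp only: eq)
    then have "sublist (take (Suc (length u)) ?w) u" unfolding short_factors_def by blast
    then show False using sublist_length_le[of "take (Suc (length u)) ?w" u] len by simp
  qed
  ultimately show ?thesis by (intro bexI[OF _ x]) simp
qed

text \<open>Uniqueness needs an actual point in the closure outside the language: two J-classes
  sharing it coincide.\<close>

lemma J_class_eq: "J_class V A \<sigma> = J"
  unfolding J_class_def Let_def
proof (rule the_equality)
  obtain e where e: "e \<in> J" "idempotent M e" using J_idempotent by blast
  have "e \<in> F (A 0)" using e(1) unfolding J_def by blast
  then have "J \<in> F (A 0) // green_J M" unfolding J_green[OF e(1), symmetric] by (rule quotientI)
  then show "regular_J_class M J \<and>
      free_pro_top V (A 0) closure_of (word_emb V (A 0) ` L) - word_emb V (A 0) ` L \<subseteq> J"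
    unfolding regular_J_class_def by (intro conjI closure_L_J bexI[of _ e] e)
next
  fix J' assume J': "regular_J_class M J' \<and>
      free_pro_top V (A 0) closure_of (word_emb V (A 0) ` L) - word_emb V (A 0) ` L \<subseteq> J'"
  obtain x where x: "x \<in> free_pro_top V (A 0) closure_of (word_emb V (A 0) ` L) - word_emb V (A 0) ` L"
    using Im_closure_L by blast
  have xJ: "x \<in> J" "x \<in> J'" using x closure_L_J J' by blast+
  have "J' \<in> F (A 0) // green_J M" using J' unfolding regular_J_class_def by blast
  then obtain z where z: "J' = green_J M `` {z}" by (rule quotientE)
  then have "(z, x) \<in> green_J M" using xJ(2) by simp
  then have "J' = green_J M `` {x}" unfolding z by (rule equiv_class_eq[OF green_J_equiv])
  then show "J' = J" using J_green[OF xJ(1)] by simp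
qed

end

section \<open>Words occurring in images from every level\<close>

context primitive_directive
begin

text \<open>Here \<open>v\<close> ranges over all words of level \<open>n\<close>, whereas the
  language uses images of letters only. The gap between the two is what both the V-image and the
  limit words detect.\<close>

definition persistent :: "'a list \<Rightarrow> bool" where
  "persistent u \<longleftrightarrow> u \<noteq> [] \<and> (\<forall>n. \<exists>v\<in>words (A n). sublist u (ds_comp \<sigma> 0 n v))"

lemma image_factor_mono:
  assumes "m \<le> n" "v \<in> words (A n)" "sublist u (ds_comp \<sigma> 0 n v)"
  shows "\<exists>v'\<in>words (A m). sublist u (ds_comp \<sigma> 0 m v')"
  using assms(3) ds_comp_words[OF assms(1,2)] unfolding ds_comp_app[OF le0 assms(1)] by (intro bexI)

text \<open>Only finitely many words of length at most \<open>k\<close> lie outside the language.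
  Each is absent from the images of some level, hence from those of all higher levels, and
  \<open>N\<close> bounds these finitely many levels.\<close>

lemma persistent_imp_local:
  assumes pers: "\<And>u. persistent u \<Longrightarrow> u \<in> L"
  shows "\<exists>N. \<forall>n\<ge>N. \<forall>v\<in>words (A n). \<forall>u. sublist u (ds_comp \<sigma> 0 n v) \<longrightarrow> u \<noteq> [] \<longrightarrow> length u \<le> k \<longrightarrow> u \<in> L"
proof -
  define B where "B = {u \<in> words (A 0). length u \<le> k \<and> u \<notin> L}"
  have "B \<subseteq> {u. set u \<subseteq> A 0 \<and> length u \<le> k}" unfolding B_def words_iff by auto
  then have "finite B" by (rule finite_subset) (rule finite_lists_length_le[OF A_finite])
  have "\<exists>n. \<forall>v\<in>words (A n). \<not> sublist u (ds_comp \<sigma> 0 n v)" if "u \<in> B" for u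
  proof -
    have "\<not> persistent u" "u \<noteq> []" using pers that by (auto simp: B_def)
    then show ?thesis unfolding persistent_def by blast
  qed
  then obtain f where f: "\<And>u v. u \<in> B \<Longrightarrow> v \<in> words (A (f u)) \<Longrightarrow> \<not> sublist u (ds_comp \<sigma> 0 (f u) v)" by metis
  \<comment> \<open>The inserted \<open>0\<close> covers the case that no short word lies outside
    the language.\<close>
  define N where "N = Max (insert 0 (f ` B))"
  have fN: "f u \<le> N" if "u \<in> B" for u
    unfolding N_def by (rule Max_ge) (use \<open>finite B\<close> that in simp_all)
  have "u \<in> L" if n: "n \<ge> N" and v: "v \<in> words (A n)" and u: "sublist u (ds_comp \<sigma> 0 n v)" "u \<noteq> []" "length u \<le> k" for n v u
  proof (rule ccontr)
    assume "u \<notin> L"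
    have "set u \<subseteq> A 0"
      using set_mono_sublist[OF u(1)] ds_comp_words[OF le0 v] by (auto simp: words_iff)
    then have "u \<in> B" using u \<open>u \<notin> L\<close> by (auto simp: B_def words_iff)
    have "f u \<le> n" using fN[OF \<open>u \<in> B\<close>] n by simp
    from image_factor_mono[OF this v u(1)] f[OF \<open>u \<in> B\<close>] show False by blast
  qed
  then show ?thesis by blast
qed

end

context pv_directive
begin

lemma persistent_imp_Im_J:
  assumes pers: "\<And>u. persistent u \<Longrightarrow> u \<in> L"
  shows "ImV \<subseteq> J"
proof
  fix x assume x: "x \<in> ImV"
  have "\<exists>w\<in>words (A 0). x q = snd q w \<and> core q w" if q: "q \<in> Q" for q
  proof -
    obtain l where l: "\<forall>y\<in>words (A 0). l \<le> length y \<longrightarrow>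
        (\<forall>u. sublist u y \<longrightarrow> u \<noteq> [] \<longrightarrow> length u \<le> Suc l \<longrightarrow> u \<in> L) \<longrightarrow> core q y"
      using lang_quot.core_local[OF quot_lang[OF q]] by (elim exE)
    obtain N where N: "\<forall>n\<ge>N. \<forall>v\<in>words (A n). \<forall>u. sublist u (ds_comp \<sigma> 0 n v) \<longrightarrow> u \<noteq> [] \<longrightarrow> length u \<le> Suc l \<longrightarrow> u \<in> L"
      using persistent_imp_local[OF pers] by blast
    obtain N' where N': "\<forall>n\<ge>N'. \<forall>v\<in>words (A n). l \<le> length (ds_comp \<sigma> 0 n v)"
      using image_length_at_top by blast
    define n where "n = max N N'"
    obtain v where v: "v \<in> words (A n)" "x q = snd q (ds_comp \<sigma> 0 n v)" using x q unfolding Im_iff by blast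
    have "N \<le> n" "N' \<le> n" by (simp_all add: n_def)
    then have "core q (ds_comp \<sigma> 0 n v)"
      using l[THEN bspec, OF ds_comp_words[OF le0 v(1)]] N N' v(1) by simp
    then show ?thesis using v ds_comp_words[OF le0 v(1)] by blast
  qed
  then show "x \<in> J" using Im_F[OF x] unfolding J_def by blast
qed

text \<open>Images containing \<open>u\<close> accumulate at an element of the V-image, hence of
  \<open>J\<close>. In a quotient that sees factors of the length of \<open>u\<close>, a long word
  of the language has the value of some \<open>r @ w @ t\<close>, where \<open>w\<close> is one of
  these images; so it contains \<open>u\<close>.\<close>

lemma Im_J_imp_persistent:
  assumes IJ: "ImV \<subseteq> J" and u: "persistent u"
  shows "u \<in> L"
proof -
  have une: "u \<noteq> []" using u unfolding persistent_def by blast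
  have "\<forall>n. \<exists>v. v \<in> words (A n) \<and> sublist u (ds_comp \<sigma> 0 n v)" using u unfolding persistent_def by blast
  from choice[OF this] obtain v where v: "\<And>n. v n \<in> words (A n)" "\<And>n. sublist u (ds_comp \<sigma> 0 n (v n))" by blast
  obtain x where x: "x \<in> ImV" and acc: "\<forall>q\<in>Q. \<forall>n. \<exists>m\<ge>n. x q = snd q (ds_comp \<sigma> 0 m (v m))"
    using Im_accumulation[of v, OF v(1)] by (elim bexE)
  have xJ: "x \<in> J" using IJ x by (rule subsetD)
  obtain q where q: "q \<in> Q" and "\<forall>w\<in>words (A 0). \<forall>w'\<in>words (A 0). snd q w = snd q w'
      \<longrightarrow> short_factors (length u) w = short_factors (length u) w'"
    using testable[of "length u"] by (elim bexE)
  note test = this(2)[rule_format]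
  obtain m where m: "x q = snd q (ds_comp \<sigma> 0 m (v m))" using acc q by blast
  let ?w = "ds_comp \<sigma> 0 m (v m)"
  have w: "?w \<in> words (A 0)" using v(1) by (simp add: ds_comp_words)
  have cw: "core q ?w" by (rule J_core[OF xJ q w m])
  obtain N where N: "\<And>z. z \<in> L \<Longrightarrow> N \<le> length z \<Longrightarrow> core q z"
    using lang_quot.core_long[OF quot_lang[OF q]] by blast
  obtain z where z: "z \<in> L" "N \<le> length z" using long_words by blast
  obtain r t where rt: "r \<in> words (A 0)" "t \<in> words (A 0)" "snd q z = snd q (r @ ?w @ t)"
    using lang_quot.core_below_strict[OF quot_lang[OF q] N[OF z] cw L_words[OF z(1)] w] by blast
  have "short_factors (length u) z = short_factors (length u) (r @ ?w @ t)"
    by (rule test[OF L_words[OF z(1)] _ rt(3)]) (simp add: words_append rt w)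
  moreover have "sublist u (r @ ?w @ t)" using v(2) by (simp add: sublist_append)
  ultimately have "u \<in> short_factors (length u) z" using une by (simp add: short_factors_def)
  then have "sublist u z" by (simp add: short_factors_def)
  then show ?thesis by (rule L_factor[OF z(1) _ une])
qed

section \<open>Simplicity of the V-image\<close>

lemma carrier_V_image_sg [simp]: "carrier (V_image_sg V A \<sigma>) = ImV"
  by (simp add: V_image_sg_def)

lemma mult_V_image_sg [simp]: "x \<odot>\<^bsub>V_image_sg V A \<sigma>\<^esub> y = x \<odot>\<^bsub>M\<^esub> y"
  by (simp add: V_image_sg_def)

lemma Im_semigroup: "is_semigroup (V_image_sg V A \<sigma>)"
proof -
  have "(x \<odot>\<^bsub>M\<^esub> y) \<odot>\<^bsub>M\<^esub> z = x \<odot>\<^bsub>M\<^esub> (y \<odot>\<^bsub>M\<^esub> z)" if "x \<in> ImV" "y \<in> ImV" "z \<in> ImV" for x y z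
    using M_semigroup Im_F[OF that(1)] Im_F[OF that(2)] Im_F[OF that(3)] unfolding is_semigroup_def by blast
  moreover have "ImV \<noteq> {}" using Im_closure_L by blast
  ultimately show ?thesis unfolding is_semigroup_def by (simp add: Im_closed)
qed

lemma principal_ideal_Im: "principal_ideal (V_image_sg V A \<sigma>) x \<subseteq> principal_ideal M x"
proof
  fix y assume "y \<in> principal_ideal (V_image_sg V A \<sigma>) x"
  then consider "y = x" | a where "a \<in> ImV" "y = a \<odot>\<^bsub>M\<^esub> x" | b where "b \<in> ImV" "y = x \<odot>\<^bsub>M\<^esub> b"
    | a b where "a \<in> ImV" "b \<in> ImV" "y = a \<odot>\<^bsub>M\<^esub> x \<odot>\<^bsub>M\<^esub> b"
    unfolding principal_ideal_def by auto
  then show "y \<in> principal_ideal M x"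
    by cases (use Im_F in \<open>unfold principal_ideal_def, blast+\<close>)
qed

text \<open>J-equivalence inside a subsemigroup implies J-equivalence in the whole semigroup, and
  one element of the V-image is known to lie in \<open>J\<close>.\<close>

lemma simple_imp_Im_J:
  assumes "is_simple (V_image_sg V A \<sigma>)"
  shows "ImV \<subseteq> J"
proof
  fix x assume x: "x \<in> ImV"
  obtain y where y: "y \<in> ImV" "y \<in> J" using Im_closure_L closure_L_J by blast
  have "(x, y) \<in> green_J (V_image_sg V A \<sigma>)" using assms x y unfolding is_simple_def by simp
  then have eq: "principal_ideal (V_image_sg V A \<sigma>) x = principal_ideal (V_image_sg V A \<sigma>) y"
    by (simp add: green_J_def)
  have "x \<in> principal_ideal (V_image_sg V A \<sigma>) y" "y \<in> principal_ideal (V_image_sg V A \<sigma>) x"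
    using principal_ideal_self[of x "V_image_sg V A \<sigma>"] principal_ideal_self[of y "V_image_sg V A \<sigma>"] eq
    by simp_all
  then have "x \<in> principal_ideal M y" "y \<in> principal_ideal M x"
    by (simp_all add: subsetD[OF principal_ideal_Im])
  then have "principal_ideal M x = principal_ideal M y"
    by (intro equalityI principal_ideal_mono[OF M_semigroup]) (simp_all add: Im_F x y)
  then show "x \<in> J" by (rule J_principal_ideal_closed[OF Im_F[OF x] y(2)])
qed

lemma Im_power:
  assumes "z \<in> ImV" "q \<in> Q" "w \<in> words (A 0)" "z q = snd q w"
  shows "\<exists>z'\<in>ImV. z' q = snd q (wpow (Suc n) w)"
proof (induction n)
  case 0
  then show ?case using assms by (intro bexI[of _ z]) simp_all
next
  case (Suc n)
  then obtain z' where z': "z' \<in> ImV" "z' q = snd q (wpow (Suc n) w)" by blast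
  have "(z \<odot>\<^bsub>M\<^esub> z') q = snd q (w @ wpow (Suc n) w)"
    by (intro pro_mult_word[OF assms(2)] assms(3,4) z'(2) wpow_words[OF assms(3)] zero_less_Suc)
  then show ?case by (intro bexI[OF _ Im_closed[OF assms(1) z'(1)]]) simp
qed

text \<open>Products of \<open>x\<close> and \<open>y\<close> stay in the V-image, hence in
  \<open>J\<close>, so \<open>core_absorb\<close> applies. Its right factor is again the value of
  such a product, though of one depending on \<open>q\<close>.\<close>

lemma Im_J_absorb:
  assumes IJ: "ImV \<subseteq> J" and x: "x \<in> ImV" and y: "y \<in> ImV" and q: "q \<in> Q"
  shows "\<exists>u v w. u \<in> words (A 0) \<and> v \<in> words (A 0) \<and> w \<in> words (A 0) \<and> x q = snd q u \<and> y q = snd q v \<and>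
    x q = snd q (u @ v @ w) \<and> (\<exists>t\<in>ImV. t q = snd q w)"
proof -
  obtain u where u: "u \<in> words (A 0)" "x q = snd q u" using pro_word[OF Im_F[OF x] q] by blast
  obtain v where v: "v \<in> words (A 0)" "y q = snd q v" using pro_word[OF Im_F[OF y] q] by blast
  let ?z = "u @ v @ u"
  have zw: "?z \<in> words (A 0)" using u v by (simp add: words_append)
  have z: "(x \<odot>\<^bsub>M\<^esub> (y \<odot>\<^bsub>M\<^esub> x)) q = snd q ?z"
    by (intro pro_mult_word[OF q] words_append u v)
  have zIm: "x \<odot>\<^bsub>M\<^esub> (y \<odot>\<^bsub>M\<^esub> x) \<in> ImV" by (intro Im_closed x y)
  have cz: "core q (wpow n ?z)" if "n > 0" for n
  proof -
    obtain m where n: "n = Suc m" using \<open>n > 0\<close> by (cases n) auto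
    obtain z' where z': "z' \<in> ImV" "z' q = snd q (wpow n ?z)"
      using Im_power[OF zIm q zw z, of m] unfolding n by blast
    show ?thesis by (rule J_core[OF subsetD[OF IJ z'(1)] q wpow_words[OF zw that] z'(2)])
  qed
  have cx: "core q u" by (rule J_core[OF subsetD[OF IJ x] q u])
  obtain n where n: "snd q u = snd q ((u @ v) @ u @ wpow n ?z @ u)"
    using lang_quot.core_absorb[OF quot_lang[OF q] u(1) v(1) cx cz] by blast
  have "\<exists>t\<in>ImV. t q = snd q (u @ wpow n ?z @ u)"
  \<comment> \<open>For \<open>n = 0\<close> the power is the empty word, which no element
    represents, so the product of \<open>x\<close> with itself is taken directly.\<close>
  proof (cases n)
    case 0
    have "(x \<odot>\<^bsub>M\<^esub> x) q = snd q (u @ u)" by (intro pro_mult_word[OF q] u)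
    then show ?thesis using Im_closed[OF x x] 0 by (intro bexI) simp_all
  next
    case (Suc m)
    obtain z' where z': "z' \<in> ImV" "z' q = snd q (wpow n ?z)"
      using Im_power[OF zIm q zw z, of m] unfolding Suc by blast
    have "(x \<odot>\<^bsub>M\<^esub> (z' \<odot>\<^bsub>M\<^esub> x)) q = snd q (u @ wpow n ?z @ u)"
      by (intro pro_mult_word[OF q] u z' words_append wpow_words[OF zw]) (simp_all add: Suc)
    then show ?thesis using Im_closed[OF x Im_closed[OF z'(1) x]] by (intro bexI)
  qed
  moreover have "u @ wpow n ?z @ u \<in> words (A 0)"
    by (intro words_append_left words_lists[OF u(1)] wpow_lists[OF words_lists[OF zw]] u(1))
  ultimately show ?thesis using u v n by (intro exI[of _ u] exI[of _ v] exI[of _ "u @ wpow n ?z @ u"]) simp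
qed

text \<open>Compactness turns the factors \<open>w q\<close> into one \<open>t\<close>. Its value at
  each quotient is also the value of some element of the V-image, and membership there is tested
  quotient by quotient, so \<open>t\<close> belongs to it.\<close>

lemma Im_J_imp_factor:
  assumes IJ: "ImV \<subseteq> J" and x: "x \<in> ImV" and y: "y \<in> ImV"
  shows "\<exists>t\<in>ImV. x = x \<odot>\<^bsub>M\<^esub> y \<odot>\<^bsub>M\<^esub> t"
proof -
  obtain u v w where uvw: "\<And>q. q \<in> Q \<Longrightarrow> u q \<in> words (A 0) \<and> v q \<in> words (A 0) \<and> w q \<in> words (A 0) \<and>
      x q = snd q (u q) \<and> y q = snd q (v q) \<and> x q = snd q (u q @ v q @ w q) \<and> (\<exists>t\<in>ImV. t q = snd q (w q))"
    using Im_J_absorb[OF assms] by metis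
  then have "\<And>q. q \<in> Q \<Longrightarrow> w q \<in> words (A 0)" by blast
  from compactness[of "A 0" w, OF A_nonempty this]
  obtain t where t: "t \<in> F (A 0)" and lim: "\<forall>q\<in>Q. \<exists>p\<in>Q. finer (A 0) p q \<and> t q = snd q (w p)" by blast
  have "t \<in> ImV"
    unfolding Im_iff
  proof (intro conjI allI ballI t)
    fix n q assume q: "q \<in> Q"
    obtain p where p: "p \<in> Q" "finer (A 0) p q" "t q = snd q (w p)" using lim q by blast
    obtain s where s: "s \<in> ImV" "s p = snd p (w p)" using uvw[OF p(1)] by blast
    have "s q = snd q (w p)" using pro_finer[OF Im_F[OF s(1)] p(1) q p(2) _ s(2)] uvw[OF p(1)] by blast
    then show "\<exists>v\<in>words (A n). t q = snd q (ds_comp \<sigma> 0 n v)" using s(1) p(3) q unfolding Im_iff by metis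
  qed
  moreover have "x = x \<odot>\<^bsub>M\<^esub> y \<odot>\<^bsub>M\<^esub> t"
  proof (rule pro_eqI[OF Im_F[OF x]])
    show "x \<odot>\<^bsub>M\<^esub> y \<odot>\<^bsub>M\<^esub> t \<in> F (A 0)" by (intro M_closed Im_F x y t)
    fix q assume q: "q \<in> Q"
    obtain p where p: "p \<in> Q" "finer (A 0) p q" "t q = snd q (w p)" using lim q by blast
    have ws: "u p \<in> words (A 0)" "v p \<in> words (A 0)" "w p \<in> words (A 0)"
      and eq: "x p = snd p (u p)" "y p = snd p (v p)" "x p = snd p (u p @ v p @ w p)" using uvw[OF p(1)] by blast+
    have xq: "x q = snd q (u p)" "x q = snd q (u p @ v p @ w p)"
      by (rule pro_finer[OF Im_F[OF x] p(1) q p(2)]; intro words_append ws eq)+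
    have yq: "y q = snd q (v p)" by (rule pro_finer[OF Im_F[OF y] p(1) q p(2) ws(2) eq(2)])
    have "(x \<odot>\<^bsub>M\<^esub> y \<odot>\<^bsub>M\<^esub> t) q = snd q ((u p @ v p) @ w p)"
      by (intro pro_mult_word[OF q] words_append ws xq(1) yq p(3))
    then show "x q = (x \<odot>\<^bsub>M\<^esub> y \<odot>\<^bsub>M\<^esub> t) q" using xq(2) by simp
  qed
  ultimately show ?thesis by blast
qed

lemma Im_J_imp_simple:
  assumes IJ: "ImV \<subseteq> J"
  shows "is_simple (V_image_sg V A \<sigma>)"
proof -
  let ?I = "V_image_sg V A \<sigma>"
  have sub: "principal_ideal ?I x \<subseteq> principal_ideal ?I y" if xy: "x \<in> ImV" "y \<in> ImV" for x y
  proof (rule principal_ideal_mono[OF Im_semigroup])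
    obtain t where "t \<in> ImV" "x = x \<odot>\<^bsub>M\<^esub> y \<odot>\<^bsub>M\<^esub> t" using Im_J_imp_factor[OF IJ xy] by blast
    then show "x \<in> principal_ideal ?I y" using principal_ideal_sandwich[of x ?I t y] xy(1) by simp
  qed (simp add: xy)
  have "principal_ideal ?I x = principal_ideal ?I y" if "x \<in> ImV" "y \<in> ImV" for x y
    by (rule equalityI[OF sub[OF that] sub[OF that(2,1)]])
  then show ?thesis unfolding is_simple_def green_J_def by auto
qed

end

section \<open>Biinfinite words\<close>

lemma upto_append: "i \<le> j + 1 \<Longrightarrow> j \<le> k \<Longrightarrow> [i..j] @ [j + 1..k] = [i..k]" for i :: int
proof (cases "i \<le> j")
  case False
  then show "i \<le> j + 1 \<Longrightarrow> ?thesis" by (cases "i = j + 1") simp_all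
qed (simp add: upto_split2[of i j k])

lemma sublist_map_upto:
  fixes a b i j :: int
  assumes "a \<le> i" "i \<le> j" "j \<le> b"
  shows "sublist (map x [i..j]) (map x [a..b])"
proof -
  have "[a..b] = [a..i - 1] @ [i..b]" using upto_append[of a "i - 1" b] assms by simp
  also have "[i..b] = [i..j] @ [j + 1..b]" using upto_append[of i j b] assms by simp
  finally show ?thesis by (simp add: sublist_def) blast
qed

lemma map_upto_words: "x \<in> biinfinite A \<Longrightarrow> i \<le> j \<Longrightarrow> map x [i..j] \<in> words A" for i j :: int
  by (auto simp: words_iff biinfinite_def image_subset_iff)

lemma map_upto_prefix:
  fixes x :: "int \<Rightarrow> 'a"
  assumes "map x [i..i + int (length (u @ v)) - 1] = u @ v"
  shows "map x [i..i + int (length u) - 1] = u"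
proof -
  have "[i..i + int (length u) - 1] @ [i + int (length u)..i + int (length (u @ v)) - 1] =
      [i..i + int (length (u @ v)) - 1]"
    using upto_append[of i "i + int (length u) - 1" "i + int (length (u @ v)) - 1"] by simp
  then have "map x [i..i + int (length u) - 1] @ map x [i + int (length u)..i + int (length (u @ v)) - 1] = u @ v"
    using assms by (metis map_append)
  then show ?thesis by (subst (asm) append_eq_append_conv) simp_all
qed

lemma map_upto_suffix:
  fixes x :: "int \<Rightarrow> 'a"
  assumes "map x [i - int (length (u @ v)) + 1..i] = u @ v"
  shows "map x [i - int (length v) + 1..i] = v"
proof -
  have "[i - int (length (u @ v)) + 1..i - int (length v)] @ [i - int (length v) + 1..i] =
      [i - int (length (u @ v)) + 1..i]"
    using upto_append[of "i - int (length (u @ v)) + 1" "i - int (length v)" i] by simp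
  then have "map x [i - int (length (u @ v)) + 1..i - int (length v)] @ map x [i - int (length v) + 1..i] = u @ v"
    using assms by (metis map_append)
  then show ?thesis by (subst (asm) append_eq_append_conv) simp_all
qed

text \<open>Continuity of the action: a letter depends only on the finite stretch between its
  position and the origin. This permits pointwise limits of biinfinite words.\<close>

lemma hom_biinf_cong:
  assumes "\<And>k. k \<in> {min i (-1)..max i 0} \<Longrightarrow> x k = y k"
  shows "hom_biinf f x i = hom_biinf f y i"
proof -
  have "map x [0..i] = map y [0..i]" using assms by auto
  moreover have "map x [i..-1] = map y [i..-1]" using assms by auto
  ultimately show ?thesis by (simp only: hom_biinf_def)
qed

context word_hom
begin

text \<open>The letter at position \<open>n\<close> is read from the image of the stretch from
  \<open>0\<close> to \<open>n\<close>, not to \<open>l\<close>. The two images are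
  prefix-comparable and both long enough to have that letter.\<close>

lemma hom_biinf_right:
  assumes x: "x \<in> biinfinite A" and l: "0 \<le> l"
  shows "map (hom_biinf f x) [0..int (length (f (map x [0..l]))) - 1] = f (map x [0..l])"
proof (rule nth_equalityI)
  fix n assume "n < length (map (hom_biinf f x) [0..int (length (f (map x [0..l]))) - 1])"
  then have n: "n < length (f (map x [0..l]))" by simp
  have pre: "prefix (f (map x [0..i])) (f (map x [0..j]))" if "0 \<le> i" "i \<le> j" for i j
  proof (cases "i = j")
    case False
    then have j: "map x [0..j] = map x [0..i] @ map x [i + 1..j]"
      using upto_append[of 0 i j] that by (metis map_append zero_le_imp_eq_int add_increasing2 zero_le_one)
    show ?thesis
      unfolding j using False that by (subst hom_append) (auto intro!: map_upto_words[OF x])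
  qed simp
  have len: "n < length (f (map x [0..int n]))"
    using length_ge[OF map_upto_words[OF x, of 0 "int n"]] by simp
  have "f (map x [0..int n]) ! n = f (map x [0..l]) ! n"
  proof (cases "int n \<le> l")
    case True
    then show ?thesis using pre[of "int n" l] len by (auto simp: prefix_def nth_append)
  next
    case False
    then show ?thesis using pre[of l "int n"] l n by (auto simp: prefix_def nth_append)
  qed
  then show "map (hom_biinf f x) [0..int (length (f (map x [0..l]))) - 1] ! n = f (map x [0..l]) ! n"
    using n by (simp add: hom_biinf_def)
qed simp

text \<open>Mirror of \<open>hom_biinf_right\<close>: letters at negative positions are counted from
  the right end, which is unaffected by extending the word to the left.\<close>

lemma hom_biinf_left:
  assumes x: "x \<in> biinfinite A" and k: "k \<le> -1"
  shows "map (hom_biinf f x) [- int (length (f (map x [k..-1])))..-1] = f (map x [k..-1])"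
proof (rule nth_equalityI)
  let ?w = "\<lambda>k. f (map x [k..-1])"
  fix n assume "n < length (map (hom_biinf f x) [- int (length (?w k))..-1])"
  then have n: "n < length (?w k)" by simp
  have suf: "suffix (?w j) (?w i)" if "i \<le> j" "j \<le> -1" for i j
  proof (cases "i = j")
    case False
    then have i: "map x [i..-1] = map x [i..j - 1] @ map x [j..-1]"
      using upto_append[of i "j - 1" "-1"] that by (metis add_diff_cancel_right' diff_add_cancel diff_le_eq le_add_diff_inverse2 less_le map_append order_trans zle_diff1_eq zle_add1_eq_le)
    show ?thesis
      unfolding i using False that by (subst hom_append) (auto intro!: map_upto_words[OF x] simp: suffix_def)
  qed simp
  \<comment> \<open>The letter with index \<open>n\<close> in the image of the stretch from
    \<open>k\<close> to \<open>-1\<close> sits at this position relative to the origin.\<close>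
  define i where "i = int n - int (length (?w k))"
  have i: "i < 0" using n by (simp add: i_def)
  have len: "nat (- i) \<le> length (?w i)"
    using length_ge[OF map_upto_words[OF x, of i "-1"]] i by simp
  have nth: "(v @ w) ! nat (int (length (v @ w)) + i) = w ! nat (int (length w) + i)"
    if "- i \<le> int (length w)" for v w :: "'b list"
  proof -
    have "nat (int (length (v @ w)) + i) = length v + nat (int (length w) + i)" using that by simp
    then show ?thesis by simp
  qed
  have "?w i ! nat (int (length (?w i)) + i) = ?w k ! nat (int (length (?w k)) + i)"
  proof (cases "k \<le> i")
    case True
    then obtain v where "?w k = v @ ?w i" using suf[of k i] i by (auto simp: suffix_def)
    then show ?thesis using nth[of "?w i" v] len by simp
  next
    case False
    then obtain v where "?w i = v @ ?w k" using suf[of i k] k by (auto simp: suffix_def)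
    then show ?thesis using nth[of "?w k" v] n by (simp add: i_def)
  qed
  moreover have "nat (int (length (?w k)) + i) = n" by (simp add: i_def)
  ultimately have "hom_biinf f x i = ?w k ! n" using i by (simp add: hom_biinf_def Let_def)
  then show "map (hom_biinf f x) [- int (length (?w k))..-1] ! n = ?w k ! n"
    using n by (simp add: i_def)
qed simp

lemma hom_biinf_biinfinite:
  assumes x: "x \<in> biinfinite A"
  shows "hom_biinf f x \<in> biinfinite B"
proof -
  have "hom_biinf f x i \<in> B" for i
  proof (cases "0 \<le> i")
    case True
    let ?w = "f (map x [0..i])"
    have w: "?w \<in> words B" by (rule in_words[OF map_upto_words[OF x True]])
    have "i \<le> int (length ?w) - 1" using length_ge[OF map_upto_words[OF x True]] True by simp
    then have "hom_biinf f x i \<in> set (map (hom_biinf f x) [0..int (length ?w) - 1])" using True by simp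
    then have "hom_biinf f x i \<in> set ?w" unfolding hom_biinf_right[OF x True] .
    then show ?thesis using w by (auto simp: words_iff)
  next
    case False
    then have i: "i \<le> -1" by simp
    let ?w = "f (map x [i..-1])"
    have w: "?w \<in> words B" by (rule in_words[OF map_upto_words[OF x i]])
    have "- int (length ?w) \<le> i" using length_ge[OF map_upto_words[OF x i]] i by simp
    then have "hom_biinf f x i \<in> set (map (hom_biinf f x) [- int (length ?w)..-1])" using i by simp
    then have "hom_biinf f x i \<in> set ?w" unfolding hom_biinf_left[OF x i] .
    then show ?thesis using w by (auto simp: words_iff)
  qed
  then show ?thesis by (auto simp: biinfinite_def)
qed

lemma hom_biinf_factor:
  assumes x: "x \<in> biinfinite A" and ij: "i \<le> j"
  shows "\<exists>v\<in>words A. sublist (map (hom_biinf f x) [i..j]) (f v)"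
proof -
  \<comment> \<open>The stretch is enlarged to have letters on both sides of the origin. Images are
    no shorter than their arguments, so those of both halves together cover the positions from
    \<open>i\<close> to \<open>j\<close>.\<close>
  define k l where "k = min i (-1)" and "l = max j 0"
  have kl: "k \<le> -1" "0 \<le> l" "k \<le> i" "j \<le> l" by (auto simp: k_def l_def)
  let ?u = "map x [k..-1]" and ?v = "map x [0..l]"
  have w: "?u \<in> words A" "?v \<in> words A" using map_upto_words[OF x] kl by auto
  have len: "- k \<le> int (length (f ?u))" "l + 1 \<le> int (length (f ?v))"
    using length_ge[OF w(1)] length_ge[OF w(2)] kl by auto
  have "f (?u @ ?v) = map (hom_biinf f x) ([- int (length (f ?u))..-1] @ [0..int (length (f ?v)) - 1])"
    unfolding hom_append[OF w] map_append hom_biinf_right[OF x kl(2)] hom_biinf_left[OF x kl(1)] ..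
  also have "[- int (length (f ?u))..-1] @ [0..int (length (f ?v)) - 1] =
      [- int (length (f ?u))..int (length (f ?v)) - 1]"
    using upto_append[of "- int (length (f ?u))" "-1" "int (length (f ?v)) - 1"] len kl by simp
  finally have "sublist (map (hom_biinf f x) [i..j]) (f (?u @ ?v))"
    using sublist_map_upto[of "- int (length (f ?u))" i j "int (length (f ?v)) - 1"] len kl ij by simp
  then show ?thesis using words_append[OF w] by blast
qed

end

text \<open>Both sides spell the same word \<open>f (g w)\<close> on an interval ending or starting
  at the origin, where \<open>w\<close> is the stretch of \<open>y\<close> between \<open>i\<close>
  and the origin. As \<open>f \<circ> g\<close> does not shorten words, the interval reaches
  \<open>i\<close>.\<close>

lemma hom_biinf_comp:
  assumes "word_hom B C f" "word_hom A B g" and y: "y \<in> biinfinite A"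
  shows "hom_biinf (f \<circ> g) y = hom_biinf f (hom_biinf g y)"
proof
  fix i
  interpret f: word_hom B C f by fact
  interpret g: word_hom A B g by fact
  interpret fg: word_hom A C "f \<circ> g"
    by standard (simp add: sg_hom_def f.in_words g.in_words f.hom_append g.hom_append)
  let ?z = "hom_biinf g y"
  have z: "?z \<in> biinfinite B" by (rule g.hom_biinf_biinfinite[OF y])
  show "hom_biinf (f \<circ> g) y i = hom_biinf f ?z i"
  proof (cases "0 \<le> i")
    case True
    let ?w = "map y [0..i]"
    have w: "?w \<in> words A" by (rule map_upto_words[OF y True])
    have gw: "map ?z [0..int (length (g ?w)) - 1] = g ?w" by (rule g.hom_biinf_right[OF y True])
    have "1 \<le> length (g ?w)" using g.nonempty[OF w] by (simp add: Suc_le_eq)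
    then have "0 \<le> int (length (g ?w)) - 1" by linarith
    from f.hom_biinf_right[OF z this]
    have "map (hom_biinf f ?z) [0..int (length (f (g ?w))) - 1] = f (g ?w)" unfolding gw .
    moreover have "map (hom_biinf (f \<circ> g) y) [0..int (length (f (g ?w))) - 1] = f (g ?w)"
      using fg.hom_biinf_right[OF y True] by simp
    ultimately have "\<forall>k\<in>set [0..int (length (f (g ?w))) - 1]. hom_biinf (f \<circ> g) y k = hom_biinf f ?z k"
      by (simp only: map_eq_conv[symmetric])
    moreover have "i \<in> set [0..int (length (f (g ?w))) - 1]"
      using fg.length_ge[OF w] True by simp
    ultimately show ?thesis by (rule bspec)
  next
    case False
    then have i: "i \<le> -1" by simp
    let ?w = "map y [i..-1]"
    have w: "?w \<in> words A" by (rule map_upto_words[OF y i])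
    have gw: "map ?z [- int (length (g ?w))..-1] = g ?w" by (rule g.hom_biinf_left[OF y i])
    have "- int (length (g ?w)) \<le> -1" using g.length_ge[OF w] i by simp
    from f.hom_biinf_left[OF z this]
    have "map (hom_biinf f ?z) [- int (length (f (g ?w)))..-1] = f (g ?w)" unfolding gw .
    moreover have "map (hom_biinf (f \<circ> g) y) [- int (length (f (g ?w)))..-1] = f (g ?w)"
      using fg.hom_biinf_left[OF y i] by simp
    ultimately have "\<forall>k\<in>set [- int (length (f (g ?w)))..-1]. hom_biinf (f \<circ> g) y k = hom_biinf f ?z k"
      by (simp only: map_eq_conv[symmetric])
    moreover have "i \<in> set [- int (length (f (g ?w)))..-1]"
      using fg.length_ge[OF w] i by simp
    ultimately show ?thesis by (rule bspec)
  qed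
qed


section \<open>Limit words\<close>

context primitive_directive
begin

lemma limit_word_factor_persistent:
  assumes x: "x \<in> limit_words A \<sigma>" and ij: "i \<le> j"
  shows "persistent (map x [i..j])"
  unfolding persistent_def
proof (intro conjI allI)
  show "map x [i..j] \<noteq> []" using ij by simp
  have pos: "\<exists>v\<in>words (A n). sublist (map x [i..j]) (ds_comp \<sigma> 0 n v)" if n: "n \<ge> 1" for n
  proof -
    obtain y where y: "y \<in> biinfinite (A n)" "x = hom_biinf (ds_comp \<sigma> 0 n) y"
      using x n unfolding limit_words_def by auto
    show ?thesis unfolding y(2) by (rule word_hom.hom_biinf_factor[OF comp_word_hom[OF le0] y(1) ij])
  qed
  \<comment> \<open>The intersection defining limit words starts at level 1; descending from
    \<open>Suc n\<close> to \<open>n\<close> also covers level 0.\<close>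
  fix n
  obtain v where "v \<in> words (A (Suc n))" "sublist (map x [i..j]) (ds_comp \<sigma> 0 (Suc n) v)"
    using pos[of "Suc n"] by auto
  then show "\<exists>v\<in>words (A n). sublist (map x [i..j]) (ds_comp \<sigma> 0 n v)"
    by (intro image_factor_mono[of n "Suc n"]) simp_all
qed

lemma limit_words_biinfinite:
  assumes "x \<in> limit_words A \<sigma>"
  shows "x \<in> biinfinite (A 0)"
proof -
  obtain y where "y \<in> biinfinite (A 1)" "x = hom_biinf (ds_comp \<sigma> 0 1) y"
    using assms unfolding limit_words_def by auto
  then show ?thesis using word_hom.hom_biinf_biinfinite[OF comp_word_hom[OF le0]] by blast
qed

lemma limit_words_shift_space:
  assumes "\<And>u. persistent u \<Longrightarrow> u \<in> L"
  shows "limit_words A \<sigma> \<subseteq> shift_space A \<sigma>"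
  using assms limit_words_biinfinite limit_word_factor_persistent unfolding shift_space_def by blast

lemma two_block_window:
  assumes ab: "a \<in> A n" "b \<in> A n" and s: "suffix s (ds_comp \<sigma> 0 n [a])" and p: "prefix p (ds_comp \<sigma> 0 n [b])"
  shows "\<exists>y\<in>biinfinite (A n). map (hom_biinf (ds_comp \<sigma> 0 n) y) [- int (length s)..int (length p) - 1] = s @ p"
proof -
  \<comment> \<open>With \<open>a\<close> everywhere left of the origin and \<open>b\<close> from
    the origin on, the boundary between the two blocks falls at the origin.\<close>
  define y where "y i = (if i < 0 then a else b)" for i :: int
  have y: "y \<in> biinfinite (A n)" using ab by (auto simp: biinfinite_def y_def)
  interpret f: word_hom "A n" "A 0" "ds_comp \<sigma> 0 n" by (rule comp_word_hom) simp
  let ?x = "hom_biinf (ds_comp \<sigma> 0 n) y"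
  obtain s' where s': "ds_comp \<sigma> 0 n [a] = s' @ s" using s unfolding suffix_def by blast
  obtain p' where p': "ds_comp \<sigma> 0 n [b] = p @ p'" using p unfolding prefix_def by blast
  have "map y [-1..-1] = [a]" "map y [0..0] = [b]" by (simp_all add: y_def)
  then have "map ?x [- int (length (s' @ s))..-1] = s' @ s" "map ?x [0..int (length (p @ p')) - 1] = p @ p'"
    using f.hom_biinf_left[OF y, of "-1"] f.hom_biinf_right[OF y, of 0] unfolding s'[symmetric] p'[symmetric]
    by simp_all
  then have "map ?x [- int (length s)..-1] = s" "map ?x [0..int (length p) - 1] = p"
    using map_upto_suffix[of ?x "-1" s' s] map_upto_prefix[of ?x 0 p p'] by simp_all
  moreover have "[- int (length s)..-1] @ [0..int (length p) - 1] = [- int (length s)..int (length p) - 1]"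
    using upto_append[of "- int (length s)" "-1" "int (length p) - 1"] by simp
  ultimately have "map ?x [- int (length s)..int (length p) - 1] = s @ p" by (metis map_append)
  then show ?thesis using y by blast
qed

text \<open>The limit word is an ultralimit of the given images; the bound on \<open>c\<close> keeps the occurrence of
  \<open>u\<close> at a bounded distance from the origin.\<close>

lemma limit_word_exists:
  assumes y: "\<And>n. N \<le> n \<Longrightarrow> y n \<in> biinfinite (A n)"
    and win: "\<And>n. N \<le> n \<Longrightarrow> c n \<le> C \<and>
      map (hom_biinf (ds_comp \<sigma> 0 n) (y n)) [- int (c n)..int (length u) - int (c n) - 1] = u"
  shows "\<exists>x\<in>limit_words A \<sigma>. \<exists>i. map x [i..i + int (length u) - 1] = u"
proof -
  obtain U :: "nat filter" where U: "ultra U" and le: "U \<le> sequentially" using free_ultra_nat by blast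
  have ge: "eventually (\<lambda>n. k \<le> n) U" for k using le eventually_ge_at_top filter_leD by blast
  \<comment> \<open>\<open>z m n\<close> is what \<open>y n\<close> becomes at level
    \<open>m\<close>. All levels are limited along the same ultrafilter, so each \<open>x m\<close>
    obtained below is a preimage of \<open>x 0\<close>.\<close>
  define z where "z m n = hom_biinf (ds_comp \<sigma> m n) (y n)" for m n
  have z: "z m n \<in> biinfinite (A m)" if "m \<le> n" "N \<le> n" for m n
    unfolding z_def by (rule word_hom.hom_biinf_biinfinite[OF comp_word_hom[OF that(1)] y[OF that(2)]])
  have zcomp: "z 0 n = hom_biinf (ds_comp \<sigma> 0 m) (z m n)" if "m \<le> n" "N \<le> n" for m n
    unfolding z_def ds_comp_trans[OF le0 that(1)]
    by (rule hom_biinf_comp[OF comp_word_hom[OF le0] comp_word_hom[OF that(1)] y[OF that(2)]])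
  have "\<exists>s\<in>A m. eventually (\<lambda>n. z m n i = s) U" for m i
  proof (rule ultra_finite[OF U A_finite])
    show "eventually (\<lambda>n. z m n i \<in> A m) U"
      using eventually_conj[OF ge[of m] ge[of N]]
      by eventually_elim (use z in \<open>simp add: biinfinite_def image_subset_iff\<close>)
  qed
  then obtain x where x: "\<And>m i. x m i \<in> A m" "\<And>m i. eventually (\<lambda>n. z m n i = x m i) U" by metis
  have agree: "eventually (\<lambda>n. \<forall>i\<in>K. z m n i = x m i) U" if "finite K" for K m
    using that x(2) by (simp add: eventually_ball_finite)
  have "x 0 = hom_biinf (ds_comp \<sigma> 0 m) (x m)" for m
  proof
    fix i :: int
    let ?K = "{min i (-1)..max i 0}"
    have "eventually (\<lambda>n. (m \<le> n \<and> N \<le> n) \<and> (\<forall>k\<in>?K. z m n k = x m k) \<and> z 0 n i = x 0 i) U"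
      by (intro eventually_conj ge agree x(2)) simp
    from ultra_happens[OF U this] obtain n where n: "m \<le> n" "N \<le> n" "\<forall>k\<in>?K. z m n k = x m k" "z 0 n i = x 0 i"
      by blast
    have "hom_biinf (ds_comp \<sigma> 0 m) (z m n) i = hom_biinf (ds_comp \<sigma> 0 m) (x m) i"
      by (rule hom_biinf_cong) (use n(3) in blast)
    then show "x 0 i = hom_biinf (ds_comp \<sigma> 0 m) (x m) i" using zcomp[OF n(1,2)] n(4) by simp
  qed
  moreover have "x m \<in> biinfinite (A m)" for m using x(1) by (auto simp: biinfinite_def)
  ultimately have lim: "x 0 \<in> limit_words A \<sigma>" unfolding limit_words_def by blast
  have "eventually (\<lambda>n. c n \<in> {..C}) U" using ge[of N] by eventually_elim (use win in simp)
  from ultra_finite[OF U _ this] obtain d where d: "eventually (\<lambda>n. c n = d) U" by auto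
  let ?I = "[- int d..int (length u) - int d - 1]"
  have "eventually (\<lambda>n. N \<le> n \<and> c n = d \<and> (\<forall>i\<in>set ?I. z 0 n i = x 0 i)) U"
    by (intro eventually_conj ge d agree) simp
  from ultra_happens[OF U this] obtain n where n: "N \<le> n" "c n = d" "\<forall>i\<in>set ?I. z 0 n i = x 0 i" by blast
  have "map (z 0 n) ?I = u" using win[OF n(1)] unfolding n(2) z_def by blast
  moreover have "map (z 0 n) ?I = map (x 0) ?I" using n(3) by (simp only: map_eq_conv)
  ultimately have "map (x 0) [- int d..(- int d) + int (length u) - 1] = u" by (simp add: algebra_simps)
  then show ?thesis using lim by blast
qed

text \<open>Once all letter images are at least as long as \<open>u\<close>, an occurrence of
  \<open>u\<close> lies in one block, which would put it in the language, or crosses a single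
  boundary. With the origin on the boundary the offset is at most the length of \<open>u\<close>, so
  some limit word contains \<open>u\<close>.\<close>

lemma shift_space_persistent:
  assumes lim: "limit_words A \<sigma> \<subseteq> shift_space A \<sigma>" and u: "persistent u"
  shows "u \<in> L"
proof (rule ccontr)
  assume nL: "u \<notin> L"
  have une: "u \<noteq> []" using u unfolding persistent_def by blast
  obtain N where N: "\<forall>n\<ge>N. \<forall>v\<in>words (A n). length u \<le> length (ds_comp \<sigma> 0 n v)"
    using image_length_at_top by blast
  have "\<exists>y c. y \<in> biinfinite (A n) \<and> c \<le> length u \<and>
      map (hom_biinf (ds_comp \<sigma> 0 n) y) [- int c..int (length u) - int c - 1] = u" if n: "N \<le> n" for n
  proof -
    interpret f: word_hom "A n" "A 0" "ds_comp \<sigma> 0 n" by (rule comp_word_hom) simp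
    obtain v where v: "v \<in> words (A n)" "sublist u (ds_comp \<sigma> 0 n v)" using u unfolding persistent_def by blast
    have len: "length u \<le> length (ds_comp \<sigma> 0 n [a])" if "a \<in> A n" for a
      using N n that by (simp add: words_single)
    have "\<not> (\<exists>a\<in>A n. sublist u (ds_comp \<sigma> 0 n [a]))"
      using L_factor[OF image_letter_L _ une] nL by blast
    with f.factor_two_blocks[OF v(2,1) len]
    obtain a b s p where ab: "a \<in> A n" "b \<in> A n" and sp: "u = s @ p"
      "suffix s (ds_comp \<sigma> 0 n [a])" "prefix p (ds_comp \<sigma> 0 n [b])" by blast
    obtain y where "y \<in> biinfinite (A n)"
      "map (hom_biinf (ds_comp \<sigma> 0 n) y) [- int (length s)..int (length p) - 1] = s @ p"
      using two_block_window[OF ab sp(2,3)] by blast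
    then show ?thesis using sp(1) by (intro exI[of _ y] exI[of _ "length s"]) simp
  qed
  then obtain y c where "\<And>n. N \<le> n \<Longrightarrow> y n \<in> biinfinite (A n) \<and> c n \<le> length u \<and>
      map (hom_biinf (ds_comp \<sigma> 0 n) (y n)) [- int (c n)..int (length u) - int (c n) - 1] = u"
    by metis
  from limit_word_exists[of N y c "length u" u] this
  obtain x i where x: "x \<in> limit_words A \<sigma>" "map x [i..i + int (length u) - 1] = u" by blast
  have "i \<le> i + int (length u) - 1" using une by (cases u) simp_all
  then have "map x [i..i + int (length u) - 1] \<in> L" using lim x(1) unfolding shift_space_def by blast
  then show False using x(2) nL by simp
qed

end

theorem theorem7p1:
  fixes A :: "nat \<Rightarrow> 'a set" and \<sigma> :: "nat \<Rightarrow> 'a list \<Rightarrow> 'a list" and V :: "nat semigrp set"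
  assumes "directive_sequence A \<sigma>" and "primitive_ds A \<sigma>"
    and "pseudovariety V" and "LSl \<subseteq> V"
  shows "(is_simple (V_image_sg V A \<sigma>) \<longleftrightarrow> V_image V A \<sigma> \<subseteq> J_class V A \<sigma>) \<and>
         (V_image V A \<sigma> \<subseteq> J_class V A \<sigma> \<longleftrightarrow> limit_words A \<sigma> \<subseteq> shift_space A \<sigma>)"
proof -
  interpret pv_directive V A \<sigma>
    by standard (use assms in simp_all)
  show ?thesis
    unfolding J_class_eq
  proof (intro conjI iffI)
    show "V_image V A \<sigma> \<subseteq> J" if "is_simple (V_image_sg V A \<sigma>)"
      using that by (rule simple_imp_Im_J)
    show "is_simple (V_image_sg V A \<sigma>)" if "V_image V A \<sigma> \<subseteq> J"
      using that by (rule Im_J_imp_simple)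
    show "limit_words A \<sigma> \<subseteq> shift_space A \<sigma>" if "V_image V A \<sigma> \<subseteq> J"
      by (rule limit_words_shift_space) (rule Im_J_imp_persistent[OF that])
    show "V_image V A \<sigma> \<subseteq> J" if "limit_words A \<sigma> \<subseteq> shift_space A \<sigma>"
      by (rule persistent_imp_Im_J) (rule shift_space_persistent[OF that])
  qed
qed

end
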